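(* For $\varepsilon>0$ let $\mathcal{F}_\varepsilon:M\times\mathbb{C}\to\mathbb{C}$ be defined by $\mathcal{F}_\varepsilon([r,s]_m,z)=re^{\pi i s}+z^2+\varepsilon e^{4\pi i s}$. For a sufficiently small $\varepsilon>0$, the critical point set of $\mathcal{F}_\varepsilon$ is a circle consisting only of folds and three cusps. Moreover, its image (the critical value set) has no self-intersections. Consequently, $\mathcal{F}_\varepsilon$ is infinitesimally stable.
   Context: $M$ is the quotient of $\mathbb{R}^2$ by the $\mathbb{Z}$-action $n\cdot(r,s)=((-1)^nr,s+n)$ (an open Möbius band), and $[r,s]_m$ denotes the class of $(r,s)$; the map $\mathcal{F}_\varepsilon$ is well defined on $M\times\mathbb{C}$ and is regarded as a smooth map from a $4$-manifold to $\mathbb{R}^2\cong\mathbb{C}$. "Fold" and "cusp" are the standard singularity types of smooth maps from $4$-manifolds to surfaces. "No self-intersections" means that $\mathcal{F}_\varepsilon$ restricted to its critical point set is injective. *)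

theory Defs
  imports "HOL-Analysis.Analysis"
begin

section \<open>Smooth maps between Euclidean spaces\<close>

text \<open>Derivatives are taken with respect to the full neighbourhood filter, so the two
  notions below are meant for open sets \<open>S\<close>.\<close>

primrec differentiable_times :: "nat \<Rightarrow> 'a::euclidean_space set \<Rightarrow> ('a \<Rightarrow> 'b::euclidean_space) \<Rightarrow> bool"
  where
    "differentiable_times 0 S f \<longleftrightarrow> continuous_on S f"
  | "differentiable_times (Suc k) S f \<longleftrightarrow>
       (\<forall>x\<in>S. f differentiable (at x)) \<and>
       (\<forall>v. differentiable_times k S (\<lambda>x. frechet_derivative f (at x) v))"

definition smooth_on :: "'a::euclidean_space set \<Rightarrow> ('a \<Rightarrow> 'b::euclidean_space) \<Rightarrow> bool"
  where "smooth_on S f \<longleftrightarrow> (\<forall>k. differentiable_times k S f)"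

lemma differentiable_times_cong:
  assumes "open S" "\<And>x. x \<in> S \<Longrightarrow> f x = g x" "differentiable_times k S f"
  shows "differentiable_times k S g"
  using assms(2,3)
proof (induction k arbitrary: f g)
  case 0
  then show ?case
    unfolding differentiable_times.simps by (metis continuous_on_eq)
next
  case (Suc k)
  from Suc.prems(2) have f: "f differentiable (at x)" if "x \<in> S" for x
    using that by (metis differentiable_times.simps(2))
  from Suc.prems(2) have f': "differentiable_times k S (\<lambda>x. frechet_derivative f (at x) v)" for v
    by (metis differentiable_times.simps(2))
  have D: "(g has_derivative frechet_derivative f (at x)) (at x)" if "x \<in> S" for x
    using f[OF that] unfolding frechet_derivative_works
    by (rule has_derivative_transform_within_open[OF _ \<open>open S\<close> that Suc.prems(1)])
  then have eq: "frechet_derivative f (at x) = frechet_derivative g (at x)" if "x \<in> S" for x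
    using that frechet_derivative_at by blast
  have "differentiable_times k S (\<lambda>x. frechet_derivative g (at x) v)" for v
    by (rule Suc.IH[OF _ f'[of v]]) (rule fun_cong[OF eq])
  moreover have "g differentiable (at x)" if "x \<in> S" for x
    using D[OF that] unfolding differentiable_def by blast
  ultimately show ?case
    unfolding differentiable_times.simps by blast
qed

lemma differentiable_times_locally:
  assumes "\<And>x. x \<in> S \<Longrightarrow> \<exists>T. open T \<and> x \<in> T \<and> differentiable_times k T f"
  shows "differentiable_times k S f"
  using assms
proof (induction k arbitrary: f)
  case 0
  show ?case
    unfolding differentiable_times.simps
  proof (rule continuous_at_imp_continuous_on, rule ballI)
    fix x assume "x \<in> S"
    with 0 obtain T where "open T" "x \<in> T" "continuous_on T f" by (metis differentiable_times.simps(1))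
    then show "isCont f x" by (simp add: continuous_on_eq_continuous_at)
  qed
next
  case (Suc k)
  show ?case
    unfolding differentiable_times.simps
  proof (intro conjI ballI allI)
    fix x assume "x \<in> S"
    then show "f differentiable (at x)" using Suc.prems by (metis differentiable_times.simps(2))
  next
    fix v
    show "differentiable_times k S (\<lambda>x. frechet_derivative f (at x) v)"
    proof (rule Suc.IH)
      fix x assume "x \<in> S"
      then obtain T where "open T" "x \<in> T" "differentiable_times (Suc k) T f"
        using Suc.prems by blast
      then show "\<exists>T. open T \<and> x \<in> T \<and>
          differentiable_times k T (\<lambda>x. frechet_derivative f (at x) v)"
        unfolding differentiable_times.simps by blast
    qed
  qed
qed

lemma differentiable_times_const: "differentiable_times k S (\<lambda>_. c)"
  by (induction k arbitrary: c)
    (simp_all only: differentiable_times.simps continuous_on_const differentiable_const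
      frechet_derivative_const simp_thms Ball_def)

lemma differentiable_times_affine:
  assumes "bounded_linear L" shows "differentiable_times k S (\<lambda>x. L x + c)"
proof -
  have D: "((\<lambda>x. L x + c) has_derivative L) (at x)" for x
    using assms by (auto intro!: derivative_eq_intros bounded_linear_imp_has_derivative)
  have "frechet_derivative (\<lambda>x. L x + c) (at x) = L" for x
    using D by (rule frechet_derivative_at[symmetric])
  moreover have "(\<lambda>x. L x + c) differentiable (at x)" for x
    using D differentiable_def by blast
  moreover have "continuous_on S (\<lambda>x. L x + c)"
    using assms by (intro continuous_intros linear_continuous_on)
  ultimately show ?thesis
    by (cases k) (simp_all only: differentiable_times.simps differentiable_times_const simp_thms Ball_def)
qed


section \<open>Smooth manifolds given by an atlas\<close>

text \<open>A chart is a pair of its domain and its coordinate map; a smooth structure on the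
  type \<open>'m\<close> is given by a set of charts covering it.\<close>

type_synonym ('m, 'e) chart = "'m set \<times> ('m \<Rightarrow> 'e)"

definition smooth_atlas :: "('m::topological_space, 'e::euclidean_space) chart set \<Rightarrow> bool"
  where "smooth_atlas A \<longleftrightarrow>
    (\<Union>(U, \<phi>)\<in>A. U) = UNIV \<and>
    (\<forall>(U, \<phi>)\<in>A. open U \<and> open (\<phi> ` U) \<and> homeomorphism U (\<phi> ` U) \<phi> (inv_into U \<phi>)) \<and>
    (\<forall>(U, \<phi>)\<in>A. \<forall>(V, \<psi>)\<in>A. smooth_on (\<phi> ` (U \<inter> V)) (\<psi> \<circ> inv_into U \<phi>))"

definition euclidean_atlas :: "('e::euclidean_space, 'e) chart set"
  where "euclidean_atlas = {(UNIV, \<lambda>x. x)}"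

definition product_atlas ::
    "('m, 'e) chart set \<Rightarrow> ('n, 'f) chart set \<Rightarrow> ('m \<times> 'n, 'e \<times> 'f) chart set"
  where "product_atlas A B = {(U \<times> V, map_prod \<phi> \<psi>) | U \<phi> V \<psi>. (U, \<phi>) \<in> A \<and> (V, \<psi>) \<in> B}"

text \<open>Charts of the maximal atlas generated by \<open>A\<close>. The coordinates may take values in a
  Euclidean space other than the model space of \<open>A\<close>; it necessarily has the same dimension.\<close>

definition local_coordinates ::
    "('m::topological_space, 'e::euclidean_space) chart set \<Rightarrow> 'm set \<Rightarrow> ('m \<Rightarrow> 'f::euclidean_space) \<Rightarrow> bool"
  where "local_coordinates A U \<phi> \<longleftrightarrow>
    open U \<and> open (\<phi> ` U) \<and> homeomorphism U (\<phi> ` U) \<phi> (inv_into U \<phi>) \<and>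
    (\<forall>(V, \<psi>)\<in>A. smooth_on (\<phi> ` (U \<inter> V)) (\<psi> \<circ> inv_into U \<phi>) \<and>
                 smooth_on (\<psi> ` (U \<inter> V)) (\<phi> \<circ> inv_into V \<psi>))"

definition smooth_map ::
    "('m, 'e::euclidean_space) chart set \<Rightarrow> ('m \<Rightarrow> 'b::euclidean_space) \<Rightarrow> bool"
  where "smooth_map A f \<longleftrightarrow> (\<forall>(U, \<phi>)\<in>A. smooth_on (\<phi> ` U) (f \<circ> inv_into U \<phi>))"

text \<open>The differential of \<open>f\<close> at \<open>p\<close>, read in a chart around \<open>p\<close>.\<close>

definition differential_in ::
    "('m, 'e::euclidean_space) chart \<Rightarrow> ('m \<Rightarrow> 'b::euclidean_space) \<Rightarrow> 'm \<Rightarrow> 'e \<Rightarrow> 'b"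
  where "differential_in = (\<lambda>(U, \<phi>) f p. frechet_derivative (f \<circ> inv_into U \<phi>) (at (\<phi> p)))"

definition critical_points ::
    "('m, 'e::euclidean_space) chart set \<Rightarrow> ('m \<Rightarrow> 'b::euclidean_space) \<Rightarrow> 'm set"
  where "critical_points A f = {p. \<exists>c\<in>A. p \<in> fst c \<and> \<not> surj (differential_in c f p)}"


section \<open>Folds and cusps of maps from 4-manifolds to surfaces\<close>

definition has_local_form ::
    "('m::topological_space, 'e::euclidean_space) chart set \<Rightarrow> ('m \<Rightarrow> 'b::euclidean_space) \<Rightarrow> 'm \<Rightarrow>
     (real \<times> real \<times> real \<times> real \<Rightarrow> real \<times> real) \<Rightarrow> bool"
  where "has_local_form A f p g \<longleftrightarrow>
    (\<exists>U (\<phi> :: 'm \<Rightarrow> real \<times> real \<times> real \<times> real) V (\<psi> :: 'b \<Rightarrow> real \<times> real).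
       local_coordinates A U \<phi> \<and> p \<in> U \<and> \<phi> p = 0 \<and>
       local_coordinates euclidean_atlas V \<psi> \<and> f ` U \<subseteq> V \<and> \<psi> (f p) = 0 \<and>
       (\<forall>q\<in>U. \<psi> (f q) = g (\<phi> q)))"

definition is_fold ::
    "('m::topological_space, 'e::euclidean_space) chart set \<Rightarrow> ('m \<Rightarrow> 'b::euclidean_space) \<Rightarrow> 'm \<Rightarrow> bool"
  where "is_fold A f p \<longleftrightarrow>
    (\<exists>a\<in>{-1, 1}. \<exists>b\<in>{-1, 1}. \<exists>c\<in>{-1, 1}.
       has_local_form A f p (\<lambda>(t, x, y, z). (t, a * x^2 + b * y^2 + c * z^2)))"

definition is_cusp ::
    "('m::topological_space, 'e::euclidean_space) chart set \<Rightarrow> ('m \<Rightarrow> 'b::euclidean_space) \<Rightarrow> 'm \<Rightarrow> bool"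
  where "is_cusp A f p \<longleftrightarrow>
    (\<exists>b\<in>{-1, 1}. \<exists>c\<in>{-1, 1}.
       has_local_form A f p (\<lambda>(t, x, y, z). (t, x^3 + t * x + b * y^2 + c * z^2)))"


section \<open>Infinitesimal stability\<close>

text \<open>A vector field is given by its components in the charts of the atlas, which are
  related by the derivatives of the coordinate changes.\<close>

definition smooth_vector_field ::
    "('m, 'e::euclidean_space) chart set \<Rightarrow> (('m, 'e) chart \<Rightarrow> 'm \<Rightarrow> 'e) \<Rightarrow> bool"
  where "smooth_vector_field A X \<longleftrightarrow>
    (\<forall>(U, \<phi>)\<in>A. smooth_on (\<phi> ` U) (X (U, \<phi>) \<circ> inv_into U \<phi>)) \<and>
    (\<forall>c\<in>A. \<forall>(V, \<psi>)\<in>A. \<forall>p \<in> fst c \<inter> V. X (V, \<psi>) p = differential_in c \<psi> p (X c p))"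

text \<open>A smooth map \<open>f\<close> is infinitesimally stable if every smooth vector field along \<open>f\<close> has
  the form \<open>df(X) + Y \<circ> f\<close> with \<open>X\<close>, \<open>Y\<close> smooth vector fields on the source and the target.
  Since the target is a Euclidean space \<open>'b\<close>, vector fields along \<open>f\<close> are the smooth maps from
  the source to \<open>'b\<close>, and vector fields on the target are the smooth maps from \<open>'b\<close> to itself.\<close>

definition infinitesimally_stable ::
    "('m, 'e::euclidean_space) chart set \<Rightarrow> ('m \<Rightarrow> 'b::euclidean_space) \<Rightarrow> bool"
  where "infinitesimally_stable A f \<longleftrightarrow>
    smooth_map A f \<and>
    (\<forall>w :: 'm \<Rightarrow> 'b. smooth_map A w \<longrightarrow>
       (\<exists>X (Y :: 'b \<Rightarrow> 'b). smooth_vector_field A X \<and> smooth_on UNIV Y \<and>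
          (\<forall>c\<in>A. \<forall>p\<in>fst c. w p = differential_in c f p (X c p) + Y (f p))))"


section \<open>The open Moebius band\<close>

definition moebius_action :: "int \<Rightarrow> real \<times> real \<Rightarrow> real \<times> real"
  where "moebius_action n = (\<lambda>(r, s). ((-1) powi n * r, s + of_int n))"

definition moebius_rel :: "real \<times> real \<Rightarrow> real \<times> real \<Rightarrow> bool"
  where "moebius_rel p q \<longleftrightarrow> (\<exists>n. q = moebius_action n p)"

lemma moebius_action_0: "moebius_action 0 p = p"
  by (simp add: moebius_action_def split: prod.splits)

lemma moebius_action_add: "moebius_action m (moebius_action n p) = moebius_action (m + n) p"
  by (simp add: moebius_action_def power_int_add split: prod.splits)

lemma equivp_moebius_rel: "equivp moebius_rel"
proof (rule equivpI)
  show "reflp moebius_rel"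
    by (metis moebius_action_0 moebius_rel_def reflpI)
  show "symp moebius_rel"
    by (metis add.left_inverse moebius_action_0 moebius_action_add moebius_rel_def sympI)
  show "transp moebius_rel"
    by (metis moebius_action_add moebius_rel_def transpI)
qed

quotient_type moebius = "real \<times> real" / moebius_rel
  morphisms rep_moebius moebius_class
  by (rule equivp_moebius_rel)

instantiation moebius :: topological_space
begin

definition open_moebius :: "moebius set \<Rightarrow> bool"
  where "open_moebius U \<longleftrightarrow> open (moebius_class -` U)"

instance
  by standard (auto simp: open_moebius_def vimage_Union)

end

definition moebius_atlas :: "(moebius, real \<times> real) chart set"
  where "moebius_atlas =
    {(moebius_class ` U, inv_into U moebius_class) | U. open U \<and> inj_on moebius_class U}"

lemma moebius_class_eq_iff:
  "moebius_class p = moebius_class q \<longleftrightarrow> (\<exists>n. q = moebius_action n p)"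
  using moebius.abs_eq_iff moebius_rel_def by auto

lemma bounded_linear_moebius_action:
  "\<exists>L. bounded_linear L \<and> moebius_action n = (\<lambda>p. L p + (0, of_int n))"
proof (intro exI conjI)
  show "bounded_linear (\<lambda>p::real \<times> real. ((-1) powi n * fst p, snd p))"
    by (intro bounded_linear_Pair bounded_linear_intros)
qed (auto simp: moebius_action_def)

lemma continuous_moebius_action: "continuous_on S (moebius_action n)"
  unfolding moebius_action_def case_prod_unfold by (intro continuous_intros)

lemma open_moebius_class_image:
  assumes "open U" shows "open (moebius_class ` U)"
proof -
  have "moebius_class -` moebius_class ` U = (\<Union>n. moebius_action n -` U)"
  proof (intro set_eqI iffI)
    fix q assume "q \<in> moebius_class -` moebius_class ` U"
    then obtain p where "p \<in> U" "moebius_class q = moebius_class p" by auto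
    then show "q \<in> (\<Union>n. moebius_action n -` U)" by (auto simp: moebius_class_eq_iff)
  next
    fix q assume "q \<in> (\<Union>n. moebius_action n -` U)"
    then obtain n where "moebius_action n q \<in> U" by auto
    moreover have "moebius_class q = moebius_class (moebius_action n q)"
      by (auto simp: moebius_class_eq_iff)
    ultimately show "q \<in> moebius_class -` moebius_class ` U" by (metis imageI vimageI)
  qed
  moreover have "open (moebius_action n -` U)" for n
    using assms continuous_moebius_action open_vimage by blast
  ultimately show ?thesis
    unfolding open_moebius_def by (simp add: open_UN)
qed

lemma continuous_moebius_class: "continuous_on S moebius_class"
proof -
  have "continuous_on UNIV moebius_class"
    unfolding continuous_on_open_vimage[OF open_UNIV] by (simp add: open_moebius_def)
  then show ?thesis using continuous_on_subset by blast
qed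

lemma homeomorphism_moebius_class:
  assumes "open U" "inj_on moebius_class U"
  shows "homeomorphism U (moebius_class ` U) moebius_class (inv_into U moebius_class)"
proof (rule homeomorphismI)
  show "continuous_on (moebius_class ` U) (inv_into U moebius_class)"
  proof (subst continuous_on_open_vimage[OF open_moebius_class_image[OF assms(1)]], intro allI impI)
    fix B :: "(real \<times> real) set" assume "open B"
    have "inv_into U moebius_class -` B \<inter> moebius_class ` U = moebius_class ` (U \<inter> B)"
      using assms(2) by (auto simp: inv_into_f_f)
    then show "open (inv_into U moebius_class -` B \<inter> moebius_class ` U)"
      using open_moebius_class_image assms(1) \<open>open B\<close> by (simp add: open_Int)
  qed
qed (use assms(2) continuous_moebius_class in \<open>auto simp: inv_into_f_f\<close>)

definition moebius_C_atlas :: "(moebius \<times> complex, (real \<times> real) \<times> complex) chart set"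
  where "moebius_C_atlas = product_atlas moebius_atlas euclidean_atlas"

lemma smooth_atlas_moebius_C: "smooth_atlas moebius_C_atlas"
proof -
  let ?W = "\<lambda>U. moebius_class ` U \<times> (UNIV :: complex set)"
  let ?\<phi> = "\<lambda>U. map_prod (inv_into U moebius_class) (\<lambda>z::complex. z)"
  have atlas: "moebius_C_atlas = {(?W U, ?\<phi> U) | U. open U \<and> inj_on moebius_class U}"
    unfolding moebius_C_atlas_def product_atlas_def moebius_atlas_def euclidean_atlas_def
  proof (intro set_eqI iffI)
    fix c assume "c \<in> {(?W U, ?\<phi> U) | U. open U \<and> inj_on moebius_class U}"
    then obtain U where "c = (?W U, ?\<phi> U)" "open U" "inj_on moebius_class U"
      by (elim CollectE exE conjE)
    then show "c \<in> {(U \<times> V, map_prod \<phi> \<psi>) | U \<phi> V \<psi>.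
        (U, \<phi>) \<in> {(moebius_class ` U, inv_into U moebius_class) | U. open U \<and> inj_on moebius_class U} \<and>
        (V, \<psi>) \<in> {(UNIV, \<lambda>x. x)}}"
      by (intro CollectI exI conjI) (assumption | rule refl singletonI)+
  qed (clarsimp, intro exI conjI, rule refl, rule refl)
  have im: "?\<phi> U ` ?W U = U \<times> UNIV" if "inj_on moebius_class U" for U
    using that by (force simp: inv_into_f_f image_iff)
  have inj: "inj_on (?\<phi> U) (?W U)" for U
    by (intro map_prod_inj_on inj_on_inv_into order.refl inj_on_id2)
  have inv: "inv_into (?W U) (?\<phi> U) (x, z) = (moebius_class x, z)"
    if "inj_on moebius_class U" "x \<in> U" for U x z
    by (rule inv_into_f_eq[OF inj]) (use that in \<open>auto simp: inv_into_f_f\<close>)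
  have cover: "(\<Union>(U, \<phi>)\<in>moebius_C_atlas. U) = UNIV"
  proof -
    have "\<exists>U. open U \<and> inj_on moebius_class U \<and> (m, z) \<in> ?W U" for m z
    proof -
      obtain r s where m: "m = moebius_class (r, s)"
        by (metis Quotient3_abs_rep[OF Quotient3_moebius] surj_pair)
      define U :: "(real \<times> real) set" where "U = UNIV \<times> {s - 1/2<..<s + 1/2}"
      have "open U" unfolding U_def by (intro open_Times) auto
      moreover have "inj_on moebius_class U"
      proof (rule inj_onI)
        fix p q assume pq: "p \<in> U" "q \<in> U" "moebius_class p = moebius_class q"
        then obtain n where n: "q = moebius_action n p" by (auto simp: moebius_class_eq_iff)
        with pq have "\<bar>real_of_int n\<bar> < 1" by (auto simp: U_def moebius_action_def)
        then have "n = 0" by linarith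
        with n show "p = q" by (simp add: moebius_action_0)
      qed
      moreover have "(m, z) \<in> ?W U" by (auto simp: m U_def)
      ultimately show ?thesis by blast
    qed
    then have *: "\<exists>U. open U \<and> inj_on moebius_class U \<and> p \<in> ?W U" for p
      by (metis surj_pair)
    show ?thesis
    proof (rule UNIV_eq_I[symmetric])
      fix p
      obtain U where U: "open U" "inj_on moebius_class U" "p \<in> ?W U"
        using *[of p] by (elim exE conjE)
      then have "(?W U, ?\<phi> U) \<in> moebius_C_atlas"
        unfolding atlas by (intro CollectI exI conjI) (assumption | rule refl)+
      then show "p \<in> (\<Union>(U, \<phi>)\<in>moebius_C_atlas. U)"
        by (rule UN_I) (simp only: prod.case U(3))
    qed
  qed
  have homeo: "open (?W U) \<and> open (?\<phi> U ` ?W U) \<and>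
      homeomorphism (?W U) (?\<phi> U ` ?W U) (?\<phi> U) (inv_into (?W U) (?\<phi> U))"
    if U: "open U" "inj_on moebius_class U" for U
  proof (intro conjI)
    show "open (?W U)" using open_moebius_class_image[OF U(1)] by (simp add: open_Times)
    show "open (?\<phi> U ` ?W U)" using U im by (simp add: open_Times)
    have h: "homeomorphism U (moebius_class ` U) moebius_class (inv_into U moebius_class)"
      using homeomorphism_moebius_class[OF U] .
    show "homeomorphism (?W U) (?\<phi> U ` ?W U) (?\<phi> U) (inv_into (?W U) (?\<phi> U))"
    proof (rule homeomorphismI)
      show "continuous_on (?W U) (?\<phi> U)"
        unfolding map_prod_def case_prod_unfold
        by (intro continuous_intros continuous_on_compose2[OF homeomorphism_cont2[OF h]]) auto
      have "continuous_on (U \<times> UNIV) (\<lambda>x. (moebius_class (fst x), snd x :: complex))"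
        by (intro continuous_intros continuous_on_compose2[OF continuous_moebius_class[of UNIV]]) auto
      then show "continuous_on (?\<phi> U ` ?W U) (inv_into (?W U) (?\<phi> U))"
        unfolding im[OF U(2)] by (rule continuous_on_eq) (use inv U in auto)
      show "?\<phi> U ` ?W U \<subseteq> ?\<phi> U ` ?W U" ..
      show "inv_into (?W U) (?\<phi> U) ` ?\<phi> U ` ?W U \<subseteq> ?W U"
        by (rule image_subsetI) (rule inv_into_into)
      show "inv_into (?W U) (?\<phi> U) (?\<phi> U p) = p" if "p \<in> ?W U" for p
        using inj that by (rule inv_into_f_f)
      show "?\<phi> U (inv_into (?W U) (?\<phi> U) q) = q" if "q \<in> ?\<phi> U ` ?W U" for q
        using that by (rule f_inv_into_f)
    qed
  qed
  have trans: "smooth_on (?\<phi> U ` (?W U \<inter> ?W V)) (?\<phi> V \<circ> inv_into (?W U) (?\<phi> U))"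
    if U: "open U" "inj_on moebius_class U" and V: "open V" "inj_on moebius_class V" for U V
    unfolding smooth_on_def
  proof (intro allI, rule differentiable_times_locally)
    fix k p assume p: "p \<in> ?\<phi> U ` (?W U \<inter> ?W V)"
    then obtain m z where m: "p = (inv_into U moebius_class m, z)"
        "m \<in> moebius_class ` U" "m \<in> moebius_class ` V"
      by auto
    obtain x where x: "p = (x, z)" "x \<in> U" "moebius_class x \<in> moebius_class ` V"
      using m inv_into_into[OF m(2)] f_inv_into_f[OF m(2)] by metis
    then obtain n where n: "moebius_action n x \<in> V"
      by (auto simp: moebius_class_eq_iff)
    obtain L where L: "bounded_linear L" "moebius_action n = (\<lambda>p. L p + (0, of_int n))"
      using bounded_linear_moebius_action by blast
    define T where "T = (U \<inter> moebius_action n -` V) \<times> (UNIV :: complex set)"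
    have "open (moebius_action n -` V)"
      using V(1) continuous_moebius_action open_vimage by blast
    then have T: "open T" "p \<in> T"
      using U(1) x n by (auto simp: T_def open_Times open_Int)
    have eq: "(L (fst q), snd q) + ((0, of_int n), 0) = (?\<phi> V \<circ> inv_into (?W U) (?\<phi> U)) q"
      if q: "q \<in> T" for q
    proof -
      obtain a w where a: "q = (a, w)" "a \<in> U" "moebius_action n a \<in> V"
        using q by (auto simp: T_def)
      have "moebius_class a = moebius_class (moebius_action n a)"
        by (auto simp: moebius_class_eq_iff)
      then have "inv_into V moebius_class (moebius_class a) = moebius_action n a"
        using a V(2) by (simp add: inv_into_f_f)
      then show ?thesis using a inv[OF U(2)] L(2) by simp
    qed
    have "bounded_linear (\<lambda>q. (L (fst q), snd q :: complex))"
      by (intro bounded_linear_Pair bounded_linear_compose[OF L(1)] bounded_linear_fst bounded_linear_snd)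
    then have "differentiable_times k T (\<lambda>q. (L (fst q), snd q) + ((0, of_int n), 0))"
      by (rule differentiable_times_affine)
    then have "differentiable_times k T (?\<phi> V \<circ> inv_into (?W U) (?\<phi> U))"
      by (rule differentiable_times_cong[OF T(1), rotated]) (rule eq)
    with T show "\<exists>T. open T \<and> p \<in> T \<and>
        differentiable_times k T (?\<phi> V \<circ> inv_into (?W U) (?\<phi> U))"
      by blast
  qed
  have chartE: "\<exists>U. open U \<and> inj_on moebius_class U \<and> W = ?W U \<and> \<phi> = ?\<phi> U"
    if c: "(W, \<phi>) \<in> moebius_C_atlas" for W \<phi>
  proof -
    obtain U where U: "(W, \<phi>) = (?W U, ?\<phi> U)" "open U" "inj_on moebius_class U"
      using c unfolding atlas by (elim CollectE exE conjE)
    show ?thesis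
      using U by (intro exI[of _ U] conjI) (simp_all only: prod.inject)
  qed
  show ?thesis
    unfolding smooth_atlas_def
  proof (intro conjI)
    show "\<forall>(U, \<phi>)\<in>moebius_C_atlas.
        open U \<and> open (\<phi> ` U) \<and> homeomorphism U (\<phi> ` U) \<phi> (inv_into U \<phi>)"
    proof (intro ballI case_prodI2)
      fix c W \<phi> assume "c \<in> moebius_C_atlas" "c = (W, \<phi>)"
      then obtain U where U: "open U" "inj_on moebius_class U" and eq: "W = ?W U" "\<phi> = ?\<phi> U"
        using chartE by metis
      show "open W \<and> open (\<phi> ` W) \<and> homeomorphism W (\<phi> ` W) \<phi> (inv_into W \<phi>)"
        unfolding eq using U by (rule homeo)
    qed
    show "\<forall>(U, \<phi>)\<in>moebius_C_atlas. \<forall>(V, \<psi>)\<in>moebius_C_atlas.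
        smooth_on (\<phi> ` (U \<inter> V)) (\<psi> \<circ> inv_into U \<phi>)"
    proof (intro ballI case_prodI2)
      fix c W \<phi> d W' \<psi>
      assume *: "c \<in> moebius_C_atlas" "c = (W, \<phi>)" "d \<in> moebius_C_atlas" "d = (W', \<psi>)"
      obtain U where U: "open U" "inj_on moebius_class U" and eq: "W = ?W U" "\<phi> = ?\<phi> U"
        using chartE * by metis
      obtain V where V: "open V" "inj_on moebius_class V" and eq': "W' = ?W V" "\<psi> = ?\<phi> V"
        using chartE * by metis
      show "smooth_on (\<phi> ` (W \<inter> W')) (\<psi> \<circ> inv_into W \<phi>)"
        unfolding eq eq' using U V by (rule trans)
    qed
  qed (rule cover)
qed


section \<open>The family of maps\<close>

lemma cis_pi_of_int: "cis (pi * of_int n) = (-1) powi n"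
  by (metis cis_pi cis_power_int mult.commute)

lift_definition moebius_part :: "real \<Rightarrow> moebius \<Rightarrow> complex"
  is "\<lambda>\<epsilon> (r, s). of_real r * cis (pi * s) + of_real \<epsilon> * cis (4 * pi * s)"
proof -
  fix \<epsilon> :: real and p q :: "real \<times> real"
  assume "moebius_rel p q"
  then obtain n where q: "q = moebius_action n p"
    by (auto simp: moebius_rel_def)
  obtain r s where p: "p = (r, s)" by fastforce
  have 1: "cis (pi * (s + of_int n)) = (-1) powi n * cis (pi * s)"
    by (simp add: distrib_left cis_pi_of_int flip: cis_mult)
  have "4 * pi * (s + of_int n) = 4 * pi * s + 2 * pi * of_int (2 * n)"
    by (simp add: algebra_simps)
  then have 2: "cis (4 * pi * (s + of_int n)) = cis (4 * pi * s)"
    by (simp only: cis_mult [symmetric] cis_multiple_2pi [OF Ints_of_int] mult_1_right)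
  have 3: "((-1::complex) powi n) * (-1) powi n = 1"
    by (simp flip: power_int_mult_distrib)
  have "of_real ((-1) powi n * r) * cis (pi * (s + of_int n)) =
      ((-1) powi n * (-1) powi n) * (of_real r * cis (pi * s))"
    unfolding 1 by (simp add: of_real_power_int mult_ac)
  then have "of_real ((-1) powi n * r) * cis (pi * (s + of_int n)) = of_real r * cis (pi * s)"
    unfolding 3 by simp
  then show "(case p of (r, s) \<Rightarrow> of_real r * cis (pi * s) + of_real \<epsilon> * cis (4 * pi * s)) =
      (case q of (r, s) \<Rightarrow> of_real r * cis (pi * s) + of_real \<epsilon> * cis (4 * pi * s))"
    by (simp only: p q moebius_action_def prod.case 2)
qed

definition F_map :: "real \<Rightarrow> moebius \<times> complex \<Rightarrow> complex"
  where "F_map \<epsilon> = (\<lambda>(m, z). moebius_part \<epsilon> m + z^2)"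

lemma F_map_class:
  "F_map \<epsilon> (moebius_class (r, s), z) =
     of_real r * cis (pi * s) + z^2 + of_real \<epsilon> * cis (4 * pi * s)"
  by (simp add: F_map_def moebius_part.abs_eq)

end

theory Submission
  imports Defs
begin

text \<open>With \<open>\<phi> = \<pi> s\<close> and \<open>z = e\<^sup>i\<^sup>\<phi>\<^sup>/\<^sup>2 (a + i b)\<close> the map reads, on the cover,
  \<open>F = e\<^sup>i\<^sup>\<phi> (R + i (2 a b + \<epsilon> sin 3\<phi>))\<close>. Its critical points are \<open>z = 0\<close>, \<open>r = - 4 \<epsilon> cos 3\<phi>\<close>, and its
  critical values form the deltoid \<open>- \<epsilon> (e\<^sup>4\<^sup>i\<^sup>\<phi> + 2 e\<^sup>-\<^sup>2\<^sup>i\<^sup>\<phi>)\<close>, for every \<open>\<epsilon> > 0\<close>. The quantity \<open>2 a b\<close>,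
  suitably scaled, is a cubic polynomial in \<open>tan \<phi>\<close> with coefficients depending on the value of \<open>F\<close>
  only, so no preparation theorem is needed: depressing this cubic gives the form
  \<open>(t, x\<^sup>3 + t x + y\<^sup>2 - z\<^sup>2)\<close> on explicit domains, one around each cusp, that cover all critical points.

  Modulo the image of \<open>dF\<close>, a vector field \<open>w\<close> along \<open>F\<close> is determined by \<open>Im (e\<^sup>-\<^sup>i\<^sup>\<phi> w)\<close> on the critical
  circle, by Hadamard's lemma. The vector field \<open>Y\<close> on the plane has to match this function along the
  deltoid, which is possible near a cusp by Whitney's theorem on even functions. The three solutions
  are glued by a partition of unity.\<close>

section \<open>Calculus of smooth maps\<close>

text \<open>In the frame rotated by pi s0 write F = u + i v and \<tau> = tan \<sigma>. The equation
  Im (e^(-i \<sigma>) F) = 2 a b + \<epsilon> sin 3\<sigma>, divided by cos^3 \<sigma>, reads k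
  \<tau>^3 + v \<tau>^2 - (u + 3 \<epsilon>) \<tau> + v = 2 a b / cos^3 \<sigma> with k = \<epsilon>
  - u. It is a cubic with positive leading coefficient only on the half-plane u < \<epsilon>, and
  the term \<epsilon> sin 3\<sigma> keeps its form only under rotations by multiples of 2 pi / 3.
  These rotations give three half-planes, one about each cusp; they cover the plane because the
  three unit vectors sum to 0. The quadratic and the constant coefficient coincide, so that
  recovering (u, v) from the depressed cubic is again a cubic equation, solvable by trigonometry.
  The obstacle to stability sits at the cusps: the critical curve is mapped there with velocity 0,
  so a smooth function on it need not be a smooth function of the critical value. The two components
  of Y absorb its two parities. The twist of the band is handled by working on the universal cover
  and tracking the signs (-1)^n of the deck transformations.\<close>

lemma differentiable_times_SucI:
  assumes "open S" "\<And>x. x \<in> S \<Longrightarrow> (f has_derivative f' x) (at x)"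
    "\<And>v. differentiable_times k S (\<lambda>x. f' x v)"
  shows "differentiable_times (Suc k) S f"
  unfolding differentiable_times.simps
proof (intro conjI ballI allI)
  fix x assume "x \<in> S"
  then show "f differentiable at x" using assms(2) differentiable_def by blast
next
  fix v
  \<comment> \<open>The definition refers to \<open>frechet_derivative\<close>; uniqueness of
    derivatives identifies it with the given \<open>f'\<close>, so explicit formulas can be used
    from here on.\<close>
  show "differentiable_times k S (\<lambda>x. frechet_derivative f (at x) v)"
    by (rule differentiable_times_cong[OF assms(1) _ assms(3)[of v]])
      (metis assms(2) frechet_derivative_at)
qed

lemma differentiable_times_Suc_has_derivative:
  "differentiable_times (Suc k) S f \<Longrightarrow> x \<in> S \<Longrightarrow>
    (f has_derivative frechet_derivative f (at x)) (at x)"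
  by (simp add: frechet_derivative_works)

lemma differentiable_times_SucD: "differentiable_times (Suc k) S f \<Longrightarrow> differentiable_times k S f"
proof (induction k arbitrary: f)
  case 0
  then show ?case
    using continuous_at_imp_continuous_on differentiable_imp_continuous_within by fastforce
next
  case (Suc k)
  then show ?case by (metis differentiable_times.simps(2))
qed

lemma differentiable_times_subset:
  "differentiable_times k S f \<Longrightarrow> T \<subseteq> S \<Longrightarrow> differentiable_times k T f"
  by (induction k arbitrary: f) (auto intro: continuous_on_subset)

lemma differentiable_times_linear:
  assumes "open S" "bounded_linear L" "differentiable_times k S f"
  shows "differentiable_times k S (\<lambda>x. L (f x))"
  using assms(3)
proof (induction k arbitrary: f)
  case 0
  then show ?case
    using assms(2) by (auto intro: linear_continuous_on_compose bounded_linear.linear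
        bounded_linear.continuous_on)
next
  case (Suc k)
  show ?case
  proof (rule differentiable_times_SucI[OF assms(1)])
    show "((\<lambda>x. L (f x)) has_derivative (\<lambda>v. L (frechet_derivative f (at x) v))) (at x)"
      if "x \<in> S" for x
      using bounded_linear.has_derivative[OF assms(2)
          differentiable_times_Suc_has_derivative[OF Suc.prems that]] .
    show "differentiable_times k S (\<lambda>x. L (frechet_derivative f (at x) v))" for v
      using Suc by auto
  qed
qed

lemma differentiable_times_add:
  assumes "open S" "differentiable_times k S f" "differentiable_times k S g"
  shows "differentiable_times k S (\<lambda>x. f x + g x)"
  using assms(2,3)
proof (induction k arbitrary: f g)
  case 0
  then show ?case by (auto intro: continuous_intros)
next
  case (Suc k)
  show ?case
  proof (rule differentiable_times_SucI[OF assms(1)])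
    show "((\<lambda>x. f x + g x) has_derivative
        (\<lambda>v. frechet_derivative f (at x) v + frechet_derivative g (at x) v)) (at x)"
      if "x \<in> S" for x
      by (intro has_derivative_add differentiable_times_Suc_has_derivative[OF _ that]) (rule Suc.prems)+
    show "differentiable_times k S
        (\<lambda>x. frechet_derivative f (at x) v + frechet_derivative g (at x) v)" for v
      using Suc by auto
  qed
qed

lemma differentiable_times_sum:
  assumes "open S" "\<And>i. i \<in> I \<Longrightarrow> differentiable_times k S (f i)"
  shows "differentiable_times k S (\<lambda>x. \<Sum>i\<in>I. f i x)"
  using assms(2)
  by (induction I rule: infinite_finite_induct)
    (auto intro: differentiable_times_const differentiable_times_add[OF assms(1)])

lemma differentiable_times_bilinear:
  assumes "open S" "bounded_bilinear B" "differentiable_times k S f" "differentiable_times k S g"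
  shows "differentiable_times k S (\<lambda>x. B (f x) (g x))"
  using assms(3,4)
proof (induction k arbitrary: f g)
  case 0
  then show ?case using bounded_bilinear.continuous_on[OF assms(2)] by auto
next
  case (Suc k)
  show ?case
  proof (rule differentiable_times_SucI[OF assms(1)])
    show "((\<lambda>x. B (f x) (g x)) has_derivative
        (\<lambda>v. B (f x) (frechet_derivative g (at x) v) + B (frechet_derivative f (at x) v) (g x))) (at x)"
      if "x \<in> S" for x
      by (intro bounded_bilinear.FDERIV[OF assms(2)] differentiable_times_Suc_has_derivative[OF _ that])
        (rule Suc.prems)+
    show "differentiable_times k S
        (\<lambda>x. B (f x) (frechet_derivative g (at x) v) + B (frechet_derivative f (at x) v) (g x))" for v
      using Suc.prems differentiable_times_SucD[OF Suc.prems(1)] differentiable_times_SucD[OF Suc.prems(2)]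
      by (intro differentiable_times_add[OF assms(1)] Suc.IH) simp_all
  qed
qed

lemma differentiable_times_compose:
  fixes f :: "'a::euclidean_space \<Rightarrow> 'b::euclidean_space"
  assumes "open S" "open T" "f ` S \<subseteq> T" "differentiable_times k S f" "differentiable_times k T g"
  shows "differentiable_times k S (\<lambda>x. g (f x))"
  using assms(4,5)
proof (induction k arbitrary: g)
  case 0
  then show ?case using assms(3) continuous_on_compose2 by auto
next
  case (Suc k)
  \<comment> \<open>The derivative of the composite depends on \<open>x\<close> through both
    factors. Expanding the inner derivative in the basis leaves products of scalars with composites
    of \<open>f\<close> and one fixed partial derivative of \<open>g\<close>, to which the induction
    hypothesis applies.\<close>
  let ?D = "\<lambda>x v. \<Sum>b\<in>Basis. (frechet_derivative f (at x) v \<bullet> b) *\<^sub>R frechet_derivative g (at (f x)) b"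
  show ?case
  proof (rule differentiable_times_SucI[OF assms(1)])
    fix x assume "x \<in> S"
    then have fx: "f x \<in> T" using assms(3) by auto
    have D: "(g has_derivative frechet_derivative g (at (f x))) (at (f x))"
      by (rule differentiable_times_Suc_has_derivative[OF Suc.prems(2) fx])
    have "frechet_derivative g (at (f x)) w = (\<Sum>b\<in>Basis. (w \<bullet> b) *\<^sub>R frechet_derivative g (at (f x)) b)" for w
    proof -
      have lin: "linear (frechet_derivative g (at (f x)))" using D by (rule has_derivative_linear)
      have "frechet_derivative g (at (f x)) w =
          frechet_derivative g (at (f x)) (\<Sum>b\<in>Basis. (w \<bullet> b) *\<^sub>R b)"
        by (simp add: euclidean_representation)
      then show ?thesis by (simp only: linear_sum[OF lin] linear_scale[OF lin])
    qed
    then have "?D x = (\<lambda>v. frechet_derivative g (at (f x)) (frechet_derivative f (at x) v))" by metis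
    then show "((\<lambda>x. g (f x)) has_derivative ?D x) (at x)"
      using has_derivative_compose[OF differentiable_times_Suc_has_derivative[OF Suc.prems(1) \<open>x \<in> S\<close>] D]
      by simp
  next
    fix v
    have f': "differentiable_times k S f" using Suc.prems(1) by (rule differentiable_times_SucD)
    show "differentiable_times k S (\<lambda>x. ?D x v)"
      using Suc.prems
      by (intro differentiable_times_sum[OF assms(1)]
          differentiable_times_bilinear[OF assms(1) bounded_bilinear_scaleR]
          differentiable_times_linear[OF assms(1) bounded_linear_inner_left] Suc.IH f') auto
  qed
qed

section \<open>Closure properties of \<open>smooth_on\<close>\<close>

named_theorems smooth_intros

lemma smooth_on_imp_differentiable_times: "smooth_on S f \<Longrightarrow> differentiable_times k S f"
  by (simp add: smooth_on_def)

lemma smooth_on_has_derivative: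
  "smooth_on S f \<Longrightarrow> x \<in> S \<Longrightarrow> (f has_derivative frechet_derivative f (at x)) (at x)"
  by (rule differentiable_times_Suc_has_derivative[of 0]) (simp_all only: smooth_on_def)

lemma smooth_on_derivative:
  "smooth_on S f \<Longrightarrow> smooth_on S (\<lambda>x. frechet_derivative f (at x) v)"
  by (metis differentiable_times.simps(2) smooth_on_def)

lemma smooth_on_continuous_on: "smooth_on S f \<Longrightarrow> continuous_on S f"
  by (metis differentiable_times.simps(1) smooth_on_def)

lemma smooth_on_subset: "smooth_on S f \<Longrightarrow> T \<subseteq> S \<Longrightarrow> smooth_on T f"
  unfolding smooth_on_def using differentiable_times_subset by blast

lemma smooth_on_cong:
  assumes "smooth_on S f" "open S" "\<And>x. x \<in> S \<Longrightarrow> f x = g x" shows "smooth_on S g"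
  using assms differentiable_times_cong unfolding smooth_on_def by blast

lemma smooth_on_locally:
  assumes "\<And>x. x \<in> S \<Longrightarrow> \<exists>T. open T \<and> x \<in> T \<and> smooth_on T f"
  shows "smooth_on S f"
  unfolding smooth_on_def
  by (intro allI differentiable_times_locally) (use assms in \<open>auto simp: smooth_on_def\<close>)

lemma smooth_on_const [smooth_intros]: "smooth_on S (\<lambda>_. c)"
  by (simp add: smooth_on_def differentiable_times_const)

lemma smooth_on_bounded_linear:
  assumes "bounded_linear L" shows "smooth_on S L"
  using differentiable_times_affine[OF assms, of _ S 0] by (simp add: smooth_on_def)

lemma smooth_on_id [smooth_intros]: "smooth_on S (\<lambda>x. x)"
  by (rule smooth_on_bounded_linear) (rule bounded_linear_ident)

context
  fixes S :: "'a::euclidean_space set"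
  assumes S: "open S"
begin

lemma smooth_on_linear:
  "bounded_linear L \<Longrightarrow> smooth_on S f \<Longrightarrow> smooth_on S (\<lambda>x. L (f x))"
  unfolding smooth_on_def using differentiable_times_linear[OF S, where f = f and L = L] by simp

lemma smooth_on_bilinear:
  "bounded_bilinear B \<Longrightarrow> smooth_on S f \<Longrightarrow> smooth_on S g \<Longrightarrow> smooth_on S (\<lambda>x. B (f x) (g x))"
  unfolding smooth_on_def
  using differentiable_times_bilinear[OF S, where f = f and g = g and B = B] by simp

lemma smooth_on_add: "smooth_on S f \<Longrightarrow> smooth_on S g \<Longrightarrow> smooth_on S (\<lambda>x. f x + g x)"
  unfolding smooth_on_def using differentiable_times_add[OF S, where f = f and g = g] by simp

lemma smooth_on_sum:
  "(\<And>i. i \<in> I \<Longrightarrow> smooth_on S (f i)) \<Longrightarrow> smooth_on S (\<lambda>x. \<Sum>i\<in>I. f i x)"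
  unfolding smooth_on_def using differentiable_times_sum[OF S, where f = f and I = I] by simp

lemma smooth_on_compose:
  "smooth_on T g \<Longrightarrow> smooth_on S f \<Longrightarrow> open T \<Longrightarrow> f ` S \<subseteq> T \<Longrightarrow> smooth_on S (\<lambda>x. g (f x))"
  unfolding smooth_on_def using differentiable_times_compose[OF S, where f = f and g = g and T = T]
  by simp

lemma smooth_on_uminus: "smooth_on S f \<Longrightarrow> smooth_on S (\<lambda>x. - f x)"
  by (rule smooth_on_linear[OF bounded_linear_minus[OF bounded_linear_ident]])

lemma smooth_on_diff: "smooth_on S f \<Longrightarrow> smooth_on S g \<Longrightarrow> smooth_on S (\<lambda>x. f x - g x)"
  using smooth_on_add[of f "\<lambda>x. - g x"] smooth_on_uminus[of g] by simp

lemma smooth_on_scaleR: "smooth_on S f \<Longrightarrow> smooth_on S g \<Longrightarrow> smooth_on S (\<lambda>x. f x *\<^sub>R g x)"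
  by (rule smooth_on_bilinear[OF bounded_bilinear_scaleR])

lemma smooth_on_mult:
  fixes f g :: "'a \<Rightarrow> 'b::{euclidean_space, real_normed_algebra}"
  shows "smooth_on S f \<Longrightarrow> smooth_on S g \<Longrightarrow> smooth_on S (\<lambda>x. f x * g x)"
  by (rule smooth_on_bilinear[OF bounded_bilinear_mult])

lemma smooth_on_power:
  fixes f :: "'a \<Rightarrow> 'b::{euclidean_space, real_normed_algebra_1}"
  shows "smooth_on S f \<Longrightarrow> smooth_on S (\<lambda>x. f x ^ n)"
  by (induction n) (auto intro: smooth_on_const smooth_on_mult)

lemma smooth_on_fst: "smooth_on S f \<Longrightarrow> smooth_on S (\<lambda>x. fst (f x))"
  by (rule smooth_on_linear[OF bounded_linear_fst])

lemma smooth_on_snd: "smooth_on S f \<Longrightarrow> smooth_on S (\<lambda>x. snd (f x))"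
  by (rule smooth_on_linear[OF bounded_linear_snd])

lemma smooth_on_Re: "smooth_on S f \<Longrightarrow> smooth_on S (\<lambda>x. Re (f x))"
  by (rule smooth_on_linear[OF bounded_linear_Re])

lemma smooth_on_Im: "smooth_on S f \<Longrightarrow> smooth_on S (\<lambda>x. Im (f x))"
  by (rule smooth_on_linear[OF bounded_linear_Im])

lemma smooth_on_of_real: "smooth_on S f \<Longrightarrow> smooth_on S (\<lambda>x. complex_of_real (f x))"
  by (rule smooth_on_linear[OF bounded_linear_of_real])

lemma smooth_on_Pair:
  assumes "smooth_on S f" "smooth_on S g" shows "smooth_on S (\<lambda>x. (f x, g x))"
proof -
  have "smooth_on S (\<lambda>x. (f x, 0) + (0, g x))"
    by (intro smooth_on_add smooth_on_linear[OF _ assms(1), of "\<lambda>y. (y, 0)"]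
        smooth_on_linear[OF _ assms(2), of "\<lambda>y. (0, y)"] bounded_linear_Pair
        bounded_linear_ident bounded_linear_zero)
  then show ?thesis by simp
qed

lemma smooth_on_Complex:
  assumes "smooth_on S f" "smooth_on S g" shows "smooth_on S (\<lambda>x. Complex (f x) (g x))"
  unfolding Complex_eq
  by (intro smooth_on_add smooth_on_mult smooth_on_const smooth_on_of_real assms)

end

section \<open>Functions of one real variable\<close>

lemma differentiable_times_Suc_real:
  fixes f :: "real \<Rightarrow> real"
  assumes "open S" "\<And>x. x \<in> S \<Longrightarrow> (f has_real_derivative g x) (at x)" "differentiable_times k S g"
  shows "differentiable_times (Suc k) S f"
  by (rule differentiable_times_SucI[OF assms(1)
        assms(2)[unfolded has_field_derivative_def] differentiable_times_bilinear[OF assms(1)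
            bounded_bilinear_mult assms(3) differentiable_times_const]])

lemma smooth_on_real_derivative:
  fixes f :: "real \<Rightarrow> real"
  assumes "smooth_on S f"
  obtains g where "smooth_on S g" "\<And>x. x \<in> S \<Longrightarrow> (f has_real_derivative g x) (at x)"
proof
  show "smooth_on S (\<lambda>x. frechet_derivative f (at x) 1)"
    using assms by (rule smooth_on_derivative)
  fix x assume "x \<in> S"
  then have D: "(f has_derivative frechet_derivative f (at x)) (at x)"
    using smooth_on_has_derivative[OF assms] by blast
  have "frechet_derivative f (at x) v = frechet_derivative f (at x) 1 * v" for v
    using linear_scale[OF has_derivative_linear[OF D], of v 1] by (simp add: mult.commute)
  then have "frechet_derivative f (at x) = (*) (frechet_derivative f (at x) 1)" by (rule ext)
  with D show "(f has_real_derivative frechet_derivative f (at x) 1) (at x)"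
    by (simp add: has_field_derivative_def)
qed

lemma smooth_on_realI:
  fixes f :: "real \<Rightarrow> real"
  assumes "open S" "\<And>x. x \<in> S \<Longrightarrow> (f has_real_derivative g x) (at x)" "smooth_on S g"
  shows "smooth_on S f"
  unfolding smooth_on_def
proof
  fix k
  have "differentiable_times (Suc k) S f"
    by (rule differentiable_times_Suc_real[OF assms(1,2)]) (use assms(3) in \<open>auto simp: smooth_on_def\<close>)
  then show "differentiable_times k S f" by (rule differentiable_times_SucD)
qed

text \<open>A family closed under differentiation consists of smooth functions. This replaces
  formulas for the n-th derivative: below it suffices to exhibit such a family for sine and cosine,
  for p(1/x) exp(-1/x), for flat functions of a square root and for termwise derivatives of a
  series.\<close>

lemma smooth_on_real_coinduct:
  fixes f :: "real \<Rightarrow> real"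
  assumes "open S" "f \<in> X"
    and "\<And>f. f \<in> X \<Longrightarrow> \<exists>g\<in>X. \<forall>x\<in>S. (f has_real_derivative g x) (at x)"
  shows "smooth_on S f"
proof -
  have "\<forall>f\<in>X. differentiable_times k S f" for k
  proof (induction k)
    case 0
    show ?case
      unfolding differentiable_times.simps
      by (meson DERIV_isCont assms(3) continuous_at_imp_continuous_on)
  next
    case (Suc k)
    then show ?case using assms(3) differentiable_times_Suc_real[OF assms(1)] by metis
  qed
  then show ?thesis using assms(2) by (simp add: smooth_on_def)
qed

lemma smooth_on_sin_cos: "smooth_on UNIV (sin :: real \<Rightarrow> real)" "smooth_on UNIV (cos :: real \<Rightarrow> real)"
proof -
  let ?X = "(\<lambda>(a, b) x :: real. a * sin x + b * cos x) ` UNIV"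
  have *: "(\<lambda>x. a * sin x + b * cos x) \<in> ?X" for a b by (rule image_eqI[of _ _ "(a, b)"]) auto
  have "smooth_on UNIV f" if "f \<in> ?X" for f
  proof (rule smooth_on_real_coinduct[OF open_UNIV that])
    fix f assume "f \<in> ?X"
    then obtain a b where f: "f = (\<lambda>x. a * sin x + b * cos x)" by auto
    show "\<exists>g\<in>?X. \<forall>x\<in>UNIV. (f has_real_derivative g x) (at x)"
      unfolding f by (rule bexI[OF _ *[of "- b" a]]) (auto intro!: derivative_eq_intros)
  qed
  from this[OF *[of 1 0]] this[OF *[of 0 1]]
  show "smooth_on UNIV (sin :: real \<Rightarrow> real)" "smooth_on UNIV (cos :: real \<Rightarrow> real)" by simp_all
qed

text \<open>The derivative is a polynomial in the function itself, so the induction on the order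
  closes.\<close>

lemma smooth_on_inverse_real: "smooth_on (- {0}) (inverse :: real \<Rightarrow> real)"
  unfolding smooth_on_def
proof
  fix k
  have o: "open (- {0::real})" by auto
  show "differentiable_times k (- {0}) (inverse :: real \<Rightarrow> real)"
  proof (induction k)
    case (Suc k)
    show ?case
      by (rule differentiable_times_Suc_real[OF o, where g = "\<lambda>x. - (inverse x * inverse x)"])
        (auto intro!: derivative_eq_intros differentiable_times_linear[OF o bounded_linear_minus[OF bounded_linear_ident]]
          differentiable_times_bilinear[OF o bounded_bilinear_mult] Suc)
  qed (auto intro!: continuous_intros)
qed

lemma smooth_on_sqrt_real: "smooth_on {0<..} sqrt"
  unfolding smooth_on_def
proof
  fix k
  have o: "open {0::real<..}" by auto
  show "differentiable_times k {0<..} sqrt"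
  proof (induction k)
    case (Suc k)
    show ?case
    proof (rule differentiable_times_Suc_real[OF o, where g = "\<lambda>x. inverse (sqrt x) * (1 / 2)"])
      show "differentiable_times k {0<..} (\<lambda>x. inverse (sqrt x) * (1 / 2))"
        by (intro differentiable_times_bilinear[OF o bounded_bilinear_mult] differentiable_times_const
            differentiable_times_compose[OF o _ _ Suc smooth_on_imp_differentiable_times[OF smooth_on_inverse_real]]) auto
    qed (auto intro!: derivative_eq_intros)
  qed (auto intro!: continuous_intros)
qed

context
  fixes S :: "'a::euclidean_space set"
  assumes S: "open S"
begin

lemma smooth_on_sin: "smooth_on S f \<Longrightarrow> smooth_on S (\<lambda>x. sin (f x :: real))"
  by (rule smooth_on_compose[OF S smooth_on_sin_cos(1)]) auto

lemma smooth_on_cos: "smooth_on S f \<Longrightarrow> smooth_on S (\<lambda>x. cos (f x :: real))"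
  by (rule smooth_on_compose[OF S smooth_on_sin_cos(2)]) auto

lemma smooth_on_cis: "smooth_on S f \<Longrightarrow> smooth_on S (\<lambda>x. cis (f x))"
  unfolding cis.code by (intro smooth_on_Complex[OF S] smooth_on_sin smooth_on_cos)

lemma smooth_on_sqrt:
  "smooth_on S f \<Longrightarrow> (\<And>x. x \<in> S \<Longrightarrow> f x > 0) \<Longrightarrow> smooth_on S (\<lambda>x. sqrt (f x))"
  by (rule smooth_on_compose[OF S smooth_on_sqrt_real]) auto

lemma smooth_on_divide:
  assumes "smooth_on S f" "smooth_on S g" "\<And>x. x \<in> S \<Longrightarrow> g x \<noteq> 0"
  shows "smooth_on S (\<lambda>x. f x / g x :: real)"
  unfolding divide_inverse
  by (intro smooth_on_mult[OF S] assms(1) smooth_on_compose[OF S smooth_on_inverse_real assms(2)])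
    (use assms(3) in auto)

end

lemmas [smooth_intros] = smooth_on_add smooth_on_diff smooth_on_uminus smooth_on_mult
  smooth_on_power smooth_on_scaleR smooth_on_fst smooth_on_snd smooth_on_Re smooth_on_Im
  smooth_on_of_real smooth_on_Pair smooth_on_Complex smooth_on_sin smooth_on_cos smooth_on_cis
  smooth_on_sqrt smooth_on_divide

lemma smooth_on_arctan_real: "smooth_on UNIV arctan"
proof (rule smooth_on_realI[where g = "\<lambda>x. 1 / (1 + x\<^sup>2)"])
  have "1 + x\<^sup>2 \<noteq> 0" for x :: real by (metis add_nonneg_eq_0_iff one_neq_zero zero_le_one zero_le_power2)
  then show "smooth_on UNIV (\<lambda>x::real. 1 / (1 + x\<^sup>2))"
    by (intro smooth_intros) auto
qed (auto intro!: derivative_eq_intros simp: divide_inverse)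

lemma smooth_on_arcsin_real: "smooth_on {-1<..<1} arcsin"
proof (rule smooth_on_realI[where g = "\<lambda>x. 1 / sqrt (1 - x\<^sup>2)"])
  have "x\<^sup>2 < 1" if "-1 < x" "x < 1" for x :: real
    using that abs_square_less_1[of x] by auto
  then show "smooth_on {-1<..<1} (\<lambda>x::real. 1 / sqrt (1 - x\<^sup>2))"
    by (intro smooth_intros) (auto simp: less_imp_neq)
qed (auto intro!: derivative_eq_intros simp: divide_inverse)

lemma smooth_on_arctan [smooth_intros]:
  "open S \<Longrightarrow> smooth_on S f \<Longrightarrow> smooth_on S (\<lambda>x. arctan (f x))"
  by (rule smooth_on_compose[OF _ smooth_on_arctan_real, of S f]) auto

lemma smooth_on_arcsin [smooth_intros]:
  "open S \<Longrightarrow> smooth_on S f \<Longrightarrow> (\<And>x. x \<in> S \<Longrightarrow> \<bar>f x\<bar> < 1) \<Longrightarrow> smooth_on S (\<lambda>x. arcsin (f x))"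
  by (rule smooth_on_compose[OF _ smooth_on_arcsin_real, of S f]) (force simp: abs_less_iff)+

lemma smooth_on_tan [smooth_intros]:
  "open S \<Longrightarrow> smooth_on S f \<Longrightarrow> (\<And>x. x \<in> S \<Longrightarrow> cos (f x) \<noteq> 0) \<Longrightarrow> smooth_on S (\<lambda>x. tan (f x :: real))"
  unfolding tan_def by (intro smooth_intros)

section \<open>Hadamard's lemma\<close>

text \<open>Differentiation under the integral sign turns the integrand \<open>q\<close> into a
  directional derivative of \<open>q\<close>, which is again smooth. Hence the induction on the
  order has to range over all integrands.\<close>

lemma smooth_on_integral:
  fixes q :: "real \<times> 'a::euclidean_space \<Rightarrow> 'b::euclidean_space"
  assumes "smooth_on UNIV q"
  shows "smooth_on UNIV (\<lambda>x. integral {0..1} (\<lambda>l. q (l, x)))"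
proof -
  let ?D = "\<lambda>q v p. frechet_derivative q (at p) (0, v)"
  have D: "((\<lambda>x. integral {0..1} (\<lambda>l. q (l, x))) has_derivative
      (\<lambda>v. integral {0..1} (\<lambda>l. ?D q v (l, x)))) (at x)"
    if q: "smooth_on UNIV q" for q :: "real \<times> 'a \<Rightarrow> 'b" and x
  proof -
    have q': "(q has_derivative frechet_derivative q (at p)) (at p)" for p
      using smooth_on_has_derivative[OF q] by simp
    then have bl: "bounded_linear (frechet_derivative q (at p))" for p
      by (rule has_derivative_bounded_linear)
    have bl': "bounded_linear (\<lambda>v. ?D q v p)" for p
      by (intro bounded_linear_compose[OF bl] bounded_linear_Pair bounded_linear_intros)
    \<comment> \<open>The Leibniz rule asks for a derivative that is continuous in operator norm; in
      finite dimension this can be tested on basis vectors.\<close>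
    define B where "B x l = Blinfun (\<lambda>v. ?D q v (l, x))" for x l
    have B: "blinfun_apply (B x l) = (\<lambda>v. ?D q v (l, x))" for x l
      unfolding B_def by (rule bounded_linear_Blinfun_apply[OF bl'])
    have cD: "continuous_on UNIV (?D q v)" for v
      by (intro smooth_on_continuous_on smooth_on_derivative q)
    have cB: "continuous_on S (\<lambda>(x, l). B x l)" for S
      unfolding case_prod_unfold
    proof (rule continuous_on_blinfun_componentwise)
      fix v :: 'a assume "v \<in> Basis"
      show "continuous_on S (\<lambda>p. blinfun_apply (B (fst p) (snd p)) v)"
        unfolding B by (rule continuous_on_compose2[OF cD]) (auto intro!: continuous_intros)
    qed
    have "((\<lambda>x. integral (cbox 0 1) (\<lambda>l. q (l, x))) has_derivative
        integral (cbox 0 1) (B x)) (at x within UNIV)"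
    proof (rule leibniz_rule)
      show "((\<lambda>x. q (t, x)) has_derivative blinfun_apply (B x t)) (at x within UNIV)" for x t
        unfolding B by (rule has_derivative_compose[OF _ q', of "\<lambda>x. (t, x)"])
          (auto intro!: derivative_eq_intros)
      show "(\<lambda>l. q (l, x)) integrable_on cbox 0 1" for x
        by (intro integrable_continuous continuous_on_compose2[OF smooth_on_continuous_on[OF q]])
          (auto intro!: continuous_intros)
    qed (use cB in auto)
    moreover have "blinfun_apply (integral (cbox 0 1) (B x)) v = integral (cbox 0 1) (\<lambda>l. ?D q v (l, x))" for v
    proof (subst blinfun_apply_integral)
      show "B x integrable_on cbox 0 1"
        by (intro integrable_continuous
            continuous_on_compose2[OF cB[of UNIV], of _ "\<lambda>l. (x, l)", simplified])
          (auto intro!: continuous_intros)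
    qed (simp add: B)
    then have "blinfun_apply (integral (cbox 0 1) (B x)) = (\<lambda>v. integral (cbox 0 1) (\<lambda>l. ?D q v (l, x)))"
      by (rule ext)
    ultimately show ?thesis by simp
  qed
  have "differentiable_times k UNIV (\<lambda>x. integral {0..1} (\<lambda>l. q (l, x)))"
    if "smooth_on UNIV q" for k and q :: "real \<times> 'a \<Rightarrow> 'b"
    using that
  proof (induction k arbitrary: q)
    case 0
    then show ?case
      using D[OF 0] by (auto intro!: continuous_at_imp_continuous_on has_derivative_continuous)
  next
    case (Suc k)
    show ?case
      by (rule differentiable_times_SucI[OF open_UNIV D[OF Suc.prems]])
        (rule Suc.IH[OF smooth_on_derivative[OF Suc.prems]])
  qed
  then show ?thesis using assms by (simp add: smooth_on_def)
qed

text \<open>The coefficient of the \<open>b\<close>-component of \<open>h\<close> in f(a + h) -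
  f(a), from the fundamental theorem of calculus on the segment. The base point is an argument
  because it will later run along the critical curve; smoothness is therefore needed in
  \<open>a\<close> and \<open>h\<close> jointly.\<close>

definition Hadamard_quotient ::
    "('a::euclidean_space \<Rightarrow> 'b::euclidean_space) \<Rightarrow> 'a \<Rightarrow> 'a \<Rightarrow> 'a \<Rightarrow> 'b"
  where "Hadamard_quotient f b a h = integral {0..1} (\<lambda>l. frechet_derivative f (at (a + l *\<^sub>R h)) b)"

lemma smooth_on_Hadamard_quotient:
  fixes f :: "'a::euclidean_space \<Rightarrow> 'b::euclidean_space" and g h :: "'c::euclidean_space \<Rightarrow> 'a"
  assumes f: "smooth_on UNIV f" and S: "open S" and g: "smooth_on S g" and h: "smooth_on S h"
  shows "smooth_on S (\<lambda>x. Hadamard_quotient f b (g x) (h x))"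
proof -
  let ?q = "\<lambda>p :: real \<times> ('a \<times> 'a). frechet_derivative f (at (fst (snd p) + fst p *\<^sub>R snd (snd p))) b"
  have "smooth_on UNIV ?q"
    by (intro smooth_on_compose[OF open_UNIV smooth_on_derivative[OF f]])
      (auto intro!: smooth_intros)
  then have "smooth_on UNIV (\<lambda>p. integral {0..1} (\<lambda>l. ?q (l, p)))" by (rule smooth_on_integral)
  then have "smooth_on S (\<lambda>x. integral {0..1} (\<lambda>l. ?q (l, (g x, h x))))"
    by (rule smooth_on_compose[OF S, where T = UNIV]) (auto intro!: smooth_intros S g h)
  then show ?thesis by (simp add: Hadamard_quotient_def)
qed

lemma Hadamard:
  fixes f :: "'a::euclidean_space \<Rightarrow> 'b::euclidean_space"
  assumes f: "smooth_on UNIV f"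
  shows "f (a + h) = f a + (\<Sum>b\<in>Basis. (h \<bullet> b) *\<^sub>R Hadamard_quotient f b a h)"
proof -
  have f': "(f has_derivative frechet_derivative f (at p)) (at p)" for p
    using smooth_on_has_derivative[OF f] by simp
  have lin: "linear (frechet_derivative f (at p))" for p
    using f' by (rule has_derivative_linear)
  have "((\<lambda>l. f (a + l *\<^sub>R h)) has_vector_derivative frechet_derivative f (at (a + l *\<^sub>R h)) h) (at l within {0..1})" for l
    unfolding has_vector_derivative_def
    by (rule has_derivative_eq_rhs[OF has_derivative_compose[OF _ f']])
      (auto intro!: derivative_eq_intros simp: linear_scale[OF lin])
  then have "((\<lambda>l. frechet_derivative f (at (a + l *\<^sub>R h)) h) has_integral
      f (a + 1 *\<^sub>R h) - f (a + 0 *\<^sub>R h)) {0..1}"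
    by (intro fundamental_theorem_of_calculus) auto
  moreover have "frechet_derivative f (at p) h = (\<Sum>b\<in>Basis. (h \<bullet> b) *\<^sub>R frechet_derivative f (at p) b)" for p
  proof -
    have "frechet_derivative f (at p) h = frechet_derivative f (at p) (\<Sum>b\<in>Basis. (h \<bullet> b) *\<^sub>R b)"
      by (simp add: euclidean_representation)
    then show ?thesis by (simp only: linear_sum[OF lin] linear_scale[OF lin])
  qed
  ultimately have 1: "((\<lambda>l. \<Sum>b\<in>Basis. (h \<bullet> b) *\<^sub>R frechet_derivative f (at (a + l *\<^sub>R h)) b) has_integral
      f (a + h) - f a) {0..1}"
    by simp
  have "((\<lambda>l. \<Sum>b\<in>Basis. (h \<bullet> b) *\<^sub>R frechet_derivative f (at (a + l *\<^sub>R h)) b) has_integral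
      (\<Sum>b\<in>Basis. (h \<bullet> b) *\<^sub>R Hadamard_quotient f b a h)) {0..1}"
    unfolding Hadamard_quotient_def
    by (intro has_integral_sum finite_Basis has_integral_cmul integrable_integral
        integrable_continuous_interval continuous_on_compose2[OF smooth_on_continuous_on[OF smooth_on_derivative[OF f]]])
      (auto intro!: continuous_intros)
  with 1 have "f (a + h) - f a = (\<Sum>b\<in>Basis. (h \<bullet> b) *\<^sub>R Hadamard_quotient f b a h)"
    by (rule has_integral_unique)
  then show ?thesis by (simp add: algebra_simps)
qed

lemma Hadamard_real:
  fixes f :: "real \<Rightarrow> real"
  assumes "smooth_on UNIV f"
  obtains g where "smooth_on UNIV g" "\<And>t. f t = f 0 + t * g t"
proof
  show "smooth_on UNIV (\<lambda>t. Hadamard_quotient f 1 0 t)"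
    by (intro smooth_on_Hadamard_quotient assms open_UNIV smooth_on_const smooth_on_id)
  show "f t = f 0 + t * Hadamard_quotient f 1 0 t" for t using Hadamard[OF assms, of 0 t] by simp
qed

text \<open>One coefficient sequence serves every order \<open>N\<close>: the j-th coefficient is
  the value at 0 of the j-th iterated Hadamard quotient, and the N-th iterate is the
  remainder.\<close>

lemma smooth_Taylor:
  fixes f :: "real \<Rightarrow> real"
  assumes "smooth_on UNIV f"
  obtains a where "\<And>N. \<exists>g. smooth_on UNIV g \<and> (\<forall>t. f t = (\<Sum>j<N. a j * t ^ j) + t ^ N * g t)"
proof -
  let ?P = "\<lambda>f g. smooth_on UNIV (g :: real \<Rightarrow> real) \<and> (\<forall>t. f t = f 0 + t * g t)"
  define H where "H f = (SOME g. ?P f g)" for f :: "real \<Rightarrow> real"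
  have H: "?P f (H f)" if f: "smooth_on UNIV f" for f
  proof -
    obtain g where "smooth_on UNIV g" "\<And>t. f t = f 0 + t * g t" using Hadamard_real[OF f] by metis
    then have "?P f g" by blast
    then show ?thesis unfolding H_def by (rule someI[of "?P f"])
  qed
  have "smooth_on UNIV ((H ^^ N) f) \<and> (\<forall>t. f t = (\<Sum>j<N. (H ^^ j) f 0 * t ^ j) + t ^ N * (H ^^ N) f t)" for N
  proof (induction N)
    case (Suc N)
    then have IH: "smooth_on UNIV ((H ^^ N) f)"
        "\<And>t. f t = (\<Sum>j<N. (H ^^ j) f 0 * t ^ j) + t ^ N * (H ^^ N) f t"
      by blast+
    have "(H ^^ N) f t = (H ^^ N) f 0 + t * (H ^^ Suc N) f t" for t
      using H[OF IH(1)] by (metis comp_apply funpow.simps(2))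
    then have "t ^ N * (H ^^ N) f t = t ^ N * ((H ^^ N) f 0 + t * (H ^^ Suc N) f t)" for t
      by metis
    with IH(2) have "f t = (\<Sum>j<N. (H ^^ j) f 0 * t ^ j) + t ^ N * ((H ^^ N) f 0 + t * (H ^^ Suc N) f t)" for t
      by metis
    then have "f t = (\<Sum>j<Suc N. (H ^^ j) f 0 * t ^ j) + t ^ Suc N * (H ^^ Suc N) f t" for t
      by (simp only: sum.lessThan_Suc power_Suc distrib_left mult_ac add_ac)
    moreover have "smooth_on UNIV ((H ^^ Suc N) f)" using H[OF IH(1)] by simp
    ultimately show ?case by blast
  qed (use assms in simp)
  then show thesis using that[of "\<lambda>j. (H ^^ j) f 0"] by blast
qed

section \<open>Whitney's theorem on even functions\<close>

text \<open>Flatness is expressed by smooth divisibility by every power of \<open>t\<close> instead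
  of vanishing derivatives; dividing by \<open>t\<close> and substituting a square root then become
  algebra on the quotients.\<close>

definition flat_at_0 :: "(real \<Rightarrow> real) \<Rightarrow> bool"
  where "flat_at_0 f \<longleftrightarrow> (\<forall>N. \<exists>g. smooth_on UNIV g \<and> (\<forall>t. f t = t ^ N * g t))"

lemma flat_at_0_smooth: "flat_at_0 f \<Longrightarrow> smooth_on UNIV f"
proof -
  assume "flat_at_0 f"
  then obtain g where "smooth_on UNIV g" "\<And>t. f t = t ^ 0 * g t" unfolding flat_at_0_def by blast
  moreover from this have "f = g" by auto
  ultimately show ?thesis by simp
qed

lemma flat_at_0_zero: "flat_at_0 f \<Longrightarrow> f 0 = 0"
  unfolding flat_at_0_def by (metis mult_eq_0_iff power_one_right)

lemma flat_at_0_add: "flat_at_0 f \<Longrightarrow> flat_at_0 g \<Longrightarrow> flat_at_0 (\<lambda>t. f t + g t)"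
  unfolding flat_at_0_def
proof
  fix N
  assume "\<forall>N. \<exists>h. smooth_on UNIV h \<and> (\<forall>t. f t = t ^ N * h t)"
    "\<forall>N. \<exists>h. smooth_on UNIV h \<and> (\<forall>t. g t = t ^ N * h t)"
  then obtain h k where "smooth_on UNIV h" "smooth_on UNIV k"
    and eq: "\<And>t. f t = t ^ N * h t" "\<And>t. g t = t ^ N * k t"
    by metis
  then have "smooth_on UNIV (\<lambda>t. h t + k t)" by (intro smooth_on_add open_UNIV)
  moreover have "f t + g t = t ^ N * (h t + k t)" for t by (simp add: eq distrib_left)
  ultimately show "\<exists>h. smooth_on UNIV h \<and> (\<forall>t. f t + g t = t ^ N * h t)" by auto
qed

lemma flat_at_0_cmult:
  assumes "flat_at_0 f" shows "flat_at_0 (\<lambda>t. c * f t)"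
  unfolding flat_at_0_def
proof
  fix N
  obtain g where "smooth_on UNIV g" "\<And>t. f t = t ^ N * g t"
    using assms unfolding flat_at_0_def by blast
  then show "\<exists>g. smooth_on UNIV g \<and> (\<forall>t. c * f t = t ^ N * g t)"
    by (intro exI[of _ "\<lambda>t. c * g t"]) (auto intro!: smooth_intros)
qed

lemma flat_at_0_reflect:
  assumes "flat_at_0 f" shows "flat_at_0 (\<lambda>t. f (- t))"
  unfolding flat_at_0_def
proof
  fix N
  obtain g where g: "smooth_on UNIV g" "\<And>t. f t = t ^ N * g t"
    using assms unfolding flat_at_0_def by blast
  have "smooth_on UNIV (\<lambda>t. g (- t))"
    by (rule smooth_on_compose[OF open_UNIV g(1)]) (auto intro!: smooth_intros)
  then have "smooth_on UNIV (\<lambda>t. (-1) ^ N * g (- t))" by (intro smooth_intros open_UNIV)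
  moreover have "f (- t) = t ^ N * ((-1) ^ N * g (- t))" for t
    by (simp add: g(2) flip: power_mult_distrib mult.assoc)
  ultimately show "\<exists>g. smooth_on UNIV g \<and> (\<forall>t. f (- t) = t ^ N * g t)" by auto
qed

lemma continuous_eq_off_0:
  fixes f g :: "real \<Rightarrow> real"
  assumes "continuous_on UNIV f" "continuous_on UNIV g" "\<And>t. t \<noteq> 0 \<Longrightarrow> f t = g t"
  shows "f t = g t"
proof (cases "t = 0")
  case True
  have "(f \<longlongrightarrow> f 0) (at 0)" "(g \<longlongrightarrow> g 0) (at 0)"
    using assms(1,2) by (auto simp: continuous_on_eq_continuous_at isCont_def)
  moreover have "eventually (\<lambda>t. f t = g t) (at 0)"
    using assms(3) by (auto simp: eventually_at_filter)
  ultimately have "(g \<longlongrightarrow> f 0) (at 0)" using tendsto_cong by blast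
  then have "f 0 = g 0" using \<open>(g \<longlongrightarrow> g 0) (at 0)\<close> by (rule LIM_unique)
  then show ?thesis using True by simp
qed (rule assms(3))

text \<open>The quotient g and the quotient h of order N + 1 satisfy t g = t^(N+1) h, so g = t^N h
  off 0, and at 0 by continuity.\<close>

lemma flat_at_0_divide:
  assumes "flat_at_0 f" obtains g where "flat_at_0 g" "\<And>t. f t = t * g t"
proof -
  obtain g where g: "smooth_on UNIV g" "\<And>t. f t = t ^ 1 * g t"
    using assms unfolding flat_at_0_def by blast
  have "flat_at_0 g"
    unfolding flat_at_0_def
  proof
    fix N
    obtain h where h: "smooth_on UNIV h" "\<And>t. f t = t ^ Suc N * h t"
      using assms unfolding flat_at_0_def by blast
    have "g t = t ^ N * h t" for t
    proof (rule continuous_eq_off_0[of g "\<lambda>t. t ^ N * h t"])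
      show "continuous_on UNIV (\<lambda>t. t ^ N * h t)"
        by (intro continuous_intros smooth_on_continuous_on h(1))
      show "g t = t ^ N * h t" if "t \<noteq> 0" for t
        using that g(2)[of t] h(2)[of t] by simp
    qed (intro smooth_on_continuous_on g(1))
    with h(1) show "\<exists>h. smooth_on UNIV h \<and> (\<forall>t. g t = t ^ N * h t)" by blast
  qed
  then show thesis using that g(2) by simp
qed

lemma flat_at_0_deriv:
  assumes "flat_at_0 f"
  obtains g where "flat_at_0 g" "\<And>t. (f has_real_derivative g t) (at t)"
proof -
  obtain g where g: "\<And>t. (f has_real_derivative g t) (at t)"
    using smooth_on_real_derivative[OF flat_at_0_smooth[OF assms]] by (metis UNIV_I)
  have "flat_at_0 g"
    unfolding flat_at_0_def
  proof
    fix N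
    obtain h where h: "smooth_on UNIV h" "\<And>t. f t = t ^ Suc N * h t"
      using assms unfolding flat_at_0_def by blast
    obtain h' where h': "smooth_on UNIV h'" "\<And>t. (h has_real_derivative h' t) (at t)"
      using smooth_on_real_derivative[OF h(1)] by (metis UNIV_I)
    have "((\<lambda>t. t ^ Suc N * h t) has_real_derivative t ^ N * (real (Suc N) * h t + t * h' t)) (at t)" for t
      by (rule derivative_eq_intros refl h'(2))+ (simp add: algebra_simps)
    then have "g t = t ^ N * (real (Suc N) * h t + t * h' t)" for t
      using DERIV_unique g h(2) by (metis (no_types, lifting) ext)
    moreover have "smooth_on UNIV (\<lambda>t. real (Suc N) * h t + t * h' t)"
      using h(1) h'(1) by (intro smooth_intros) auto
    ultimately show "\<exists>h. smooth_on UNIV h \<and> (\<forall>t. g t = t ^ N * h t)" by blast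
  qed
  then show thesis using that g by blast
qed

text \<open>Writing f'(t) = t g(t) with g flat, the derivative of f(sqrt u) is g(sqrt u) / 2: the
  singular factor 1 / sqrt u cancels and the family is closed under differentiation.\<close>

lemma smooth_on_flat_sqrt:
  assumes "flat_at_0 f"
  shows "smooth_on UNIV (\<lambda>u. if u > 0 then f (sqrt u) else 0)"
proof -
  let ?e = "\<lambda>f u. if u > (0::real) then f (sqrt u) else (0::real)"
  show ?thesis
  proof (rule smooth_on_real_coinduct[OF open_UNIV, where X = "?e ` Collect flat_at_0"])
    show "?e f \<in> ?e ` Collect flat_at_0" using assms by blast
    fix F assume "F \<in> ?e ` Collect flat_at_0"
    then obtain f where F: "F = ?e f" and f: "flat_at_0 f" by blast
    obtain f' where f': "flat_at_0 f'" "\<And>t. (f has_real_derivative f' t) (at t)"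
      using flat_at_0_deriv[OF f] by metis
    obtain g where g: "flat_at_0 g" "\<And>t. f' t = t * g t" using flat_at_0_divide[OF f'(1)] by metis
    have "(?e f has_real_derivative ?e (\<lambda>t. 1 / 2 * g t) u) (at u)" for u
    proof (rule linorder_cases[of u 0])
      assume u: "u < 0"
      have "((\<lambda>_. 0) has_real_derivative 0) (at u)" by simp
      then have "(?e f has_real_derivative 0) (at u)"
        by (rule has_field_derivative_transform_within_open[where S = "{..<0}"]) (use u in auto)
      then show ?thesis using u by simp
    next
      assume u: "0 < u"
      have "((\<lambda>u. f (sqrt u)) has_real_derivative f' (sqrt u) * (inverse (sqrt u) / 2)) (at u)"
        using u by (intro DERIV_chain2[OF f'(2)] DERIV_real_sqrt)
      then have "(?e f has_real_derivative f' (sqrt u) * (inverse (sqrt u) / 2)) (at u)"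
        by (rule has_field_derivative_transform_within_open[where S = "{0<..}"]) (use u in auto)
      moreover have "f' (sqrt u) * (inverse (sqrt u) / 2) = 1 / 2 * g (sqrt u)"
        using u by (simp add: g(2))
      ultimately show ?thesis using u by simp
    next
      assume u: "u = 0"
      \<comment> \<open>The fourth power gives f(sqrt u) = u^2 h(sqrt u), so the difference quotient
        at 0 is u h(sqrt u), which tends to 0. The maximum with 0 makes the comparison function
        continuous on the whole line.\<close>
      obtain h where h: "smooth_on UNIV h" "\<And>t. f t = t ^ 4 * h t"
        using f unfolding flat_at_0_def by blast
      have "continuous_on UNIV (\<lambda>x. max x 0 * h (sqrt (max x 0)))"
        by (intro continuous_intros continuous_on_compose2[OF smooth_on_continuous_on[OF h(1)]]) auto
      then have "((\<lambda>x. max x 0 * h (sqrt (max x 0))) \<longlongrightarrow> 0) (at 0)"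
        by (auto simp: continuous_on_eq_continuous_at isCont_def dest: spec[of _ 0])
      moreover have "eventually (\<lambda>x. max x 0 * h (sqrt (max x 0)) = (?e f (0 + x) - ?e f 0) / x) (at 0)"
      proof -
        have "max x 0 * h (sqrt (max x 0)) = (?e f (0 + x) - ?e f 0) / x" if "x \<noteq> 0" for x
        proof (cases "x > 0")
          case True
          have "sqrt x ^ 4 = (sqrt x ^ 2) ^ 2" by (simp flip: power_mult)
          with True show ?thesis by (simp add: h(2) power2_eq_square)
        qed (use that in simp)
        then show ?thesis by (simp add: eventually_at_filter)
      qed
      ultimately have "((\<lambda>x. (?e f (0 + x) - ?e f 0) / x) \<longlongrightarrow> 0) (at 0)"
        using tendsto_cong by fast
      then show ?thesis unfolding u DERIV_def by simp
    qed
    moreover have "?e (\<lambda>t. 1 / 2 * g t) \<in> ?e ` Collect flat_at_0"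
      by (intro imageI CollectI flat_at_0_cmult g(1))
    ultimately show "\<exists>G\<in>?e ` Collect flat_at_0. \<forall>u\<in>UNIV. (F has_real_derivative G u) (at u)"
      unfolding F by (intro bexI[of _ "?e (\<lambda>t. 1 / 2 * g t)"]) simp_all
  qed
qed

lemma flat_at_0_vanishing:
  assumes "smooth_on UNIV f" "d > 0" "\<And>t. \<bar>t\<bar> < d \<Longrightarrow> f t = 0"
  shows "flat_at_0 f"
  unfolding flat_at_0_def
proof
  fix N
  have "smooth_on UNIV (\<lambda>t. f t / t ^ N)"
  proof (rule smooth_on_locally)
    fix t :: real
    show "\<exists>T. open T \<and> t \<in> T \<and> smooth_on T (\<lambda>t. f t / t ^ N)"
    proof (cases "t = 0")
      case True
      have "smooth_on {-d<..<d} (\<lambda>t. f t / t ^ N)"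
        by (rule smooth_on_cong[OF smooth_on_const[of _ 0]]) (auto simp: assms(3) abs_less_iff)
      then show ?thesis using True assms(2) by (intro exI[of _ "{-d<..<d}"]) auto
    next
      case False
      have "smooth_on (- {0}) (\<lambda>t. f t / t ^ N)"
        by (intro smooth_intros smooth_on_subset[OF assms(1)]) auto
      then show ?thesis using False by (intro exI[of _ "- {0}"]) auto
    qed
  qed
  moreover have "f t = t ^ N * (f t / t ^ N)" for t
    using assms(2) assms(3)[of 0] by (cases "t = 0") auto
  ultimately show "\<exists>g. smooth_on UNIV g \<and> (\<forall>t. f t = t ^ N * g t)" by blast
qed

section \<open>A smooth function supported on a half-line\<close>

definition exp_bump :: "real \<Rightarrow> real"
  where "exp_bump x = (if x > 0 then exp (- inverse x) else 0)"

lemma exp_bump_pos: "x > 0 \<Longrightarrow> exp_bump x > 0"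
  and exp_bump_zero: "x \<le> 0 \<Longrightarrow> exp_bump x = 0"
  and exp_bump_nonneg: "exp_bump x \<ge> 0"
  by (simp_all add: exp_bump_def)

lemma smooth_on_exp_bump_UNIV: "smooth_on UNIV exp_bump"
proof -
  let ?e = "\<lambda>p x. if x > (0::real) then poly p (inverse x) * exp (- inverse x) else (0::real)"
  have lim: "((\<lambda>x. poly p x / exp x) \<longlongrightarrow> 0) at_top" for p :: "real poly"
  proof -
    have "((\<lambda>x. \<Sum>i\<le>degree p. coeff p i * (x ^ i / exp x)) \<longlongrightarrow> (\<Sum>i\<le>degree p. coeff p i * 0)) at_top"
      by (intro tendsto_sum tendsto_mult tendsto_const tendsto_power_div_exp_0)
    then show ?thesis by (simp add: poly_altdef sum_divide_distrib)
  qed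
  have "smooth_on UNIV (?e 1)"
  proof (rule smooth_on_real_coinduct[OF open_UNIV, where X = "range ?e"])
    show "?e 1 \<in> range ?e" by blast
    fix F assume "F \<in> range ?e"
    then obtain p where F: "F = ?e p" by blast
    \<comment> \<open>With y = 1/x, the derivative of p(y) exp(-y) in x is y^2 (p(y) - p'(y))
      exp(-y).\<close>
    define q where "q = [:0, 0, 1:] * (p - pderiv p)"
    have "(?e p has_real_derivative ?e q u) (at u)" for u
    proof (rule linorder_cases[of u 0])
      assume u: "u < 0"
      have "((\<lambda>_. 0) has_real_derivative 0) (at u)" by simp
      then have "(?e p has_real_derivative 0) (at u)"
        by (rule has_field_derivative_transform_within_open[where S = "{..<0}"]) (use u in auto)
      then show ?thesis using u by simp
    next
      assume u: "0 < u"
      have 1: "(inverse has_real_derivative - (inverse u * inverse u)) (at u)"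
        using u by (auto intro!: derivative_eq_intros)
      have "((\<lambda>x. poly p (inverse x) * exp (- inverse x)) has_real_derivative
          poly q (inverse u) * exp (- inverse u)) (at u)"
        by (rule derivative_eq_intros DERIV_chain2[OF poly_DERIV] 1 refl)+
          (simp add: q_def algebra_simps)
      then have "(?e p has_real_derivative poly q (inverse u) * exp (- inverse u)) (at u)"
        by (rule has_field_derivative_transform_within_open[where S = "{0<..}"]) (use u in auto)
      then show ?thesis using u by simp
    next
      assume u: "u = 0"
      have "((\<lambda>x. ?e p x / x) \<longlongrightarrow> 0) (at_right 0)"
      proof -
        have "((\<lambda>x. poly (pCons 0 p) (inverse x) / exp (inverse x)) \<longlongrightarrow> 0) (at_right 0)"
          by (rule filterlim_compose[OF lim filterlim_inverse_at_top_right])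
        moreover have "eventually (\<lambda>x. poly (pCons 0 p) (inverse x) / exp (inverse x) = ?e p x / x) (at_right 0)"
          unfolding eventually_at_filter
          by (rule always_eventually) (auto simp: exp_minus field_simps)
        ultimately show ?thesis using tendsto_cong by fast
      qed
      moreover have "((\<lambda>x. ?e p x / x) \<longlongrightarrow> 0) (at_left 0)"
      proof (rule tendsto_eventually)
        show "eventually (\<lambda>x. ?e p x / x = 0) (at_left 0)"
          unfolding eventually_at_filter by (rule always_eventually) auto
      qed
      ultimately have "((\<lambda>x. ?e p x / x) \<longlongrightarrow> 0) (at 0)"
        by (simp add: filterlim_at_split)
      then show ?thesis unfolding u DERIV_def
        by (simp only: add_0 less_irrefl if_False diff_0_right)
    qed
    then show "\<exists>G\<in>range ?e. \<forall>u\<in>UNIV. (F has_real_derivative G u) (at u)"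
      unfolding F by (intro bexI[of _ "?e q"]) simp_all
  qed
  moreover have "?e 1 = exp_bump" by (auto simp: exp_bump_def)
  ultimately show ?thesis by simp
qed

lemma smooth_on_exp_bump [smooth_intros]:
  "open S \<Longrightarrow> smooth_on S f \<Longrightarrow> smooth_on S (\<lambda>x. exp_bump (f x))"
  by (rule smooth_on_compose[OF _ smooth_on_exp_bump_UNIV]) auto

section \<open>Prescribed Taylor coefficients\<close>

lemma smooth_derivative_sequence:
  fixes f :: "real \<Rightarrow> real"
  assumes "smooth_on UNIV f"
  obtains D where "D 0 = f" "\<And>k. smooth_on UNIV (D k)"
    "\<And>k x. (D k has_real_derivative D (Suc k) x) (at x)"
proof
  let ?D = "\<lambda>k. (deriv ^^ k) f"
  have step: "smooth_on UNIV (deriv g) \<and> (\<forall>x. (g has_real_derivative deriv g x) (at x))"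
    if g: "smooth_on UNIV g" for g :: "real \<Rightarrow> real"
  proof -
    obtain g' where g': "smooth_on UNIV g'" "\<And>x. (g has_real_derivative g' x) (at x)"
      using smooth_on_real_derivative[OF g] by (metis UNIV_I)
    then have "deriv g = g'" by (intro ext DERIV_imp_deriv)
    with g' show ?thesis by simp
  qed
  show "?D 0 = f" by simp
  show sm: "smooth_on UNIV (?D k)" for k
    by (induction k) (use assms step in auto)
  show "(?D k has_real_derivative ?D (Suc k) x) (at x)" for k x
    using step[OF sm[of k]] by simp
qed

text \<open>The series \<open>\<Sum>j. a\<^sub>j t\<^sup>j cut(l\<^sub>j t)\<close> with a cutoff and \<open>l\<^sub>j\<close> growing fast enough
  converges together with all its derivatives.\<close>

lemma Borel:
  fixes a :: "nat \<Rightarrow> real"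
  obtains f where "\<And>N. \<exists>g. smooth_on UNIV g \<and> (\<forall>t. f t = (\<Sum>j<N. a j * t ^ j) + t ^ N * g t)"
proof -
  \<comment> \<open>Equal to 1 for \<bar>x\<bar> \<le> 1 and to 0 for \<bar>x\<bar> > 2. The
    arguments 4 - x^2 and x^2 - 1 are never both nonpositive, so the denominator is
    positive.\<close>
  define cut where "cut x = exp_bump (4 - x\<^sup>2) / (exp_bump (4 - x\<^sup>2) + exp_bump (x\<^sup>2 - 1))" for x
  have den: "exp_bump (4 - x\<^sup>2) + exp_bump (x\<^sup>2 - 1) > 0" for x
    using exp_bump_nonneg[of "4 - x\<^sup>2"] exp_bump_nonneg[of "x\<^sup>2 - 1"]
      exp_bump_pos[of "4 - x\<^sup>2"] exp_bump_pos[of "x\<^sup>2 - 1"]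
    by (cases "x\<^sup>2 < 4") linarith+
  have cut: "smooth_on UNIV cut"
    unfolding cut_def using den by (intro smooth_intros open_UNIV) (metis less_irrefl)
  have cut_1: "cut x = 1" if "\<bar>x\<bar> \<le> 1" for x
  proof -
    have "x\<^sup>2 \<le> 1" using that by (simp add: abs_square_le_1)
    then show ?thesis
      using exp_bump_zero[of "x\<^sup>2 - 1"] exp_bump_pos[of "4 - x\<^sup>2"] by (simp add: cut_def)
  qed
  have cut_0: "cut x = 0" if "2 < \<bar>x\<bar>" for x
  proof -
    have "2\<^sup>2 < \<bar>x\<bar>\<^sup>2" using that by (intro power_strict_mono) auto
    then show ?thesis using exp_bump_zero[of "4 - x\<^sup>2"] by (simp add: cut_def)
  qed
  have "\<forall>j. \<exists>D. D 0 = (\<lambda>x. x ^ j * cut x) \<and> (\<forall>k. smooth_on UNIV (D k)) \<and>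
      (\<forall>k x. (D k has_real_derivative D (Suc k) x) (at x))"
  proof
    fix j
    have "smooth_on UNIV (\<lambda>x. x ^ j * cut x)" using cut by (intro smooth_intros open_UNIV)
    then show "\<exists>D. D 0 = (\<lambda>x. x ^ j * cut x) \<and> (\<forall>k. smooth_on UNIV (D k)) \<and>
      (\<forall>k x. (D k has_real_derivative D (Suc k) x) (at x))"
      by (rule smooth_derivative_sequence) blast
  qed
  then obtain D where D0: "\<And>j x. D j 0 x = x ^ j * cut x"
    and D_smooth: "\<And>j k. smooth_on UNIV (D j k)"
    and D_deriv: "\<And>j k x. (D j k has_real_derivative D j (Suc k) x) (at x)"
    by metis
  have D_supp: "D j k x = 0" if "2 < \<bar>x\<bar>" for j k x
    using that
  proof (induction k arbitrary: x)
    case 0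
    then show ?case by (simp add: D0 cut_0)
  next
    case (Suc k)
    have "open {x::real. 2 < \<bar>x\<bar>}" by (intro open_Collect_less continuous_intros)
    then have "((\<lambda>_. 0) has_real_derivative D j (Suc k) x) (at x)"
      by (rule has_field_derivative_transform_within_open[OF D_deriv]) (use Suc in auto)
    then show ?case using DERIV_const DERIV_unique by metis
  qed
  have "\<exists>C\<ge>0. \<forall>x. \<bar>D j k x\<bar> \<le> C" for j k
  proof -
    have "compact (D j k ` {-2..2})"
      by (intro compact_continuous_image smooth_on_continuous_on smooth_on_subset[OF D_smooth]) auto
    then obtain C where C: "\<And>x. x \<in> {-2..2} \<Longrightarrow> \<bar>D j k x\<bar> \<le> C"
      using compact_imp_bounded bounded_real by (metis (no_types, lifting) image_eqI)
    have "\<bar>D j k x\<bar> \<le> max C 0" for x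
      using C[of x] D_supp[of x j k] by (cases "x \<in> {-2..2}") auto
    then show ?thesis by (intro exI[of _ "max C 0"]) auto
  qed
  then obtain C where C0: "\<And>j k. C j k \<ge> 0" and C: "\<And>j k x. \<bar>D j k x\<bar> \<le> C j k"
    by metis
  \<comment> \<open>Large enough that \<open>\<bar>a i\<bar> * C j k / l i\<close> is at most 2^(-i)
    for all j, k \<le> i; the summand 1 gives \<open>l i\<close> \<ge> 1, so that powers of
    \<open>l i\<close> increase with the exponent.\<close>
  define l where "l i = 1 + 2 ^ i * \<bar>a i\<bar> * (\<Sum>j\<le>i. \<Sum>k\<le>i. C j k)" for i
  have CC: "C j k \<le> (\<Sum>j\<le>i. \<Sum>k\<le>i. C j k)" "0 \<le> (\<Sum>j\<le>i. \<Sum>k\<le>i. C j k)" if "j \<le> i" "k \<le> i" for i j k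
  proof -
    have "C j k \<le> (\<Sum>k\<le>i. C j k)" by (rule member_le_sum) (use that C0 in auto)
    also have "\<dots> \<le> (\<Sum>j\<le>i. \<Sum>k\<le>i. C j k)"
      by (rule member_le_sum[of j "{..i}" "\<lambda>j. \<Sum>k\<le>i. C j k"]) (use that C0 in \<open>auto intro: sum_nonneg\<close>)
    finally show "C j k \<le> (\<Sum>j\<le>i. \<Sum>k\<le>i. C j k)" .
    then show "0 \<le> (\<Sum>j\<le>i. \<Sum>k\<le>i. C j k)" using C0[of j k] by linarith
  qed
  have l1: "l i \<ge> 1" for i
    unfolding l_def using CC(2)[of 0 i 0] by simp
  have lC: "\<bar>a i\<bar> * C j k / l i \<le> (1 / 2) ^ i" if "j \<le> i" "k \<le> i" for i j k
  proof -
    have "2 ^ i * \<bar>a i\<bar> * C j k \<le> 2 ^ i * \<bar>a i\<bar> * (\<Sum>j\<le>i. \<Sum>k\<le>i. C j k)"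
      by (intro mult_left_mono CC that) auto
    also have "\<dots> \<le> l i" by (simp add: l_def)
    finally show ?thesis using l1[of i] by (simp add: field_simps power_one_over)
  qed
  \<comment> \<open>The k-th derivative of the j-th term of the series with coefficients and scales
    shifted by \<open>m\<close>. For j > k the factor l^k / l^j is at most 1 / l, which the choice
    of \<open>l\<close> turns into a geometric bound. The shift is what allows the recursion B_m(t)
    = a_m cut(l_m t) + t B_(m+1)(t).\<close>
  define T where "T m k j t = a (j + m) * (l (j + m) ^ k / l (j + m) ^ j) * D j k (l (j + m) * t)" for m k j t
  have T_deriv: "(T m k j has_real_derivative T m (Suc k) j t) (at t)" for m k j t
  proof -
    have "((\<lambda>t. D j k (l (j + m) * t)) has_real_derivative D j (Suc k) (l (j + m) * t) * l (j + m)) (at t)"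
      by (rule DERIV_chain2[OF D_deriv]) (auto intro!: derivative_eq_intros)
    from DERIV_cmult[OF this, of "a (j + m) * (l (j + m) ^ k / l (j + m) ^ j)"]
    show ?thesis unfolding T_def by (simp add: mult_ac)
  qed
  have T_bound: "\<bar>T m k j t\<bar> \<le> (1 / 2) ^ j" if "k < j" for m k j t
  proof -
    let ?l = "l (j + m)"
    have "?l ^ k / ?l ^ j \<le> 1 / ?l"
    proof -
      have "?l ^ Suc k \<le> ?l ^ j" using that l1 by (intro power_increasing) auto
      then show ?thesis using l1[of "j + m"] by (simp add: field_simps)
    qed
    moreover have "\<bar>T m k j t\<bar> = \<bar>a (j + m)\<bar> * (?l ^ k / ?l ^ j) * \<bar>D j k (?l * t)\<bar>"
      unfolding T_def abs_mult using l1[of "j + m"] by simp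
    moreover have "\<bar>a (j + m)\<bar> * (?l ^ k / ?l ^ j) * \<bar>D j k (?l * t)\<bar> \<le> \<bar>a (j + m)\<bar> * (1 / ?l) * C j k"
      if "?l ^ k / ?l ^ j \<le> 1 / ?l"
      using l1[of "j + m"] that by (intro mult_mono C mult_nonneg_nonneg) auto
    ultimately have "\<bar>T m k j t\<bar> \<le> \<bar>a (j + m)\<bar> * (1 / ?l) * C j k" by simp
    also have "\<dots> \<le> (1 / 2) ^ (j + m)" using lC[of j "j + m" k] that by simp
    also have "\<dots> \<le> (1 / 2) ^ j" by (intro power_decreasing) auto
    finally show ?thesis .
  qed
  have T_ev: "eventually (\<lambda>j. \<forall>t\<in>UNIV. norm (T m k j t) \<le> (1 / 2) ^ j) sequentially" for m k
    using T_bound by (intro eventually_sequentiallyI[of "Suc k"]) auto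
  have half: "summable (\<lambda>j. (1 / 2 :: real) ^ j)" by (intro summable_geometric) auto
  have T_unif: "uniformly_convergent_on UNIV (\<lambda>n t. \<Sum>j<n. T m k j t)" for m k
    using Weierstrass_m_test_ev[OF T_ev half] unfolding uniformly_convergent_on_def by blast
  have T_sum: "summable (\<lambda>j. T m k j t)" for m k t
    by (rule summable_comparison_test_ev[OF eventually_mono[OF T_ev[of m k]] half]) simp
  define B where "B m t = (\<Sum>j. T m 0 j t)" for m t
  have B_smooth: "smooth_on UNIV (B m)" for m
  proof (rule smooth_on_real_coinduct[OF open_UNIV, where X = "range (\<lambda>k t. \<Sum>j. T m k j t)"])
    show "B m \<in> range (\<lambda>k t. \<Sum>j. T m k j t)" unfolding B_def by blast
    fix F assume "F \<in> range (\<lambda>k t. \<Sum>j. T m k j t)"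
    then obtain k where F: "F = (\<lambda>t. \<Sum>j. T m k j t)" by blast
    have "(F has_real_derivative (\<Sum>j. T m (Suc k) j t)) (at t)" for t
      unfolding F
    proof (rule has_field_derivative_series'(2)[where S = UNIV and f' = "\<lambda>j. T m (Suc k) j" and ?x0.0 = 0])
      show "summable (\<lambda>j. T m k j 0)" by (rule T_sum)
      show "uniformly_convergent_on UNIV (\<lambda>n t. \<Sum>j<n. T m (Suc k) j t)" by (rule T_unif)
    qed (simp_all add: T_deriv)
    then show "\<exists>G\<in>range (\<lambda>k t. \<Sum>j. T m k j t). \<forall>t\<in>UNIV. (F has_real_derivative G t) (at t)"
      by (intro bexI[of _ "\<lambda>t. \<Sum>j. T m (Suc k) j t"]) auto
  qed
  have T0: "T m 0 j t = a (j + m) * t ^ j * cut (l (j + m) * t)" for m j t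
    using l1[of "j + m"] by (simp add: T_def D0 power_mult_distrib)
  have B_rec: "B m t = a m * cut (l m * t) + t * B (Suc m) t" for m t
  proof -
    have "B m t = T m 0 0 t + (\<Sum>j. T m 0 (Suc j) t)"
      unfolding B_def using suminf_split_head[OF T_sum[of m 0 t]] by simp
    also have "T m 0 (Suc j) t = t * T (Suc m) 0 j t" for j by (simp add: T0)
    then have "(\<Sum>j. T m 0 (Suc j) t) = t * B (Suc m) t"
      unfolding B_def using suminf_mult[OF T_sum] by simp
    finally show ?thesis by (simp add: T0)
  qed
  have flat: "flat_at_0 (\<lambda>t. a m * (cut (l m * t) - 1))" for m
  proof (rule flat_at_0_vanishing[of _ "1 / l m"])
    have "smooth_on UNIV (\<lambda>t. cut (l m * t))"
      by (rule smooth_on_compose[OF open_UNIV cut]) (auto intro!: smooth_intros)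
    then show "smooth_on UNIV (\<lambda>t. a m * (cut (l m * t) - 1))" by (intro smooth_intros open_UNIV)
    show "1 / l m > 0" using l1[of m] by simp
    fix t assume "\<bar>t\<bar> < 1 / l m"
    then have "\<bar>l m * t\<bar> \<le> 1" using l1[of m] by (simp add: abs_mult field_simps)
    then show "a m * (cut (l m * t) - 1) = 0" by (simp add: cut_1)
  qed
  \<comment> \<open>The flat summand \<open>h\<close> strengthens the induction: it absorbs the
    error \<open>a m * (cut (l m * t) - 1)\<close> at each step, and dividing the sum by
    \<open>t\<close> leaves a flat function for the next one.\<close>
  have "\<exists>g. smooth_on UNIV g \<and> (\<forall>t. B m t + h t = (\<Sum>j<N. a (m + j) * t ^ j) + t ^ N * g t)"
    if "flat_at_0 h" for N m h
    using that
  proof (induction N arbitrary: m h)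
    case 0
    have "smooth_on UNIV (\<lambda>t. B m t + h t)"
      by (intro smooth_intros open_UNIV B_smooth flat_at_0_smooth[OF 0])
    then show ?case by (intro exI[of _ "\<lambda>t. B m t + h t"]) simp
  next
    case (Suc N)
    obtain h' where h': "flat_at_0 h'" "\<And>t. a m * (cut (l m * t) - 1) + h t = t * h' t"
      using flat_at_0_divide[OF flat_at_0_add[OF flat[of m] Suc.prems]] by metis
    obtain g where g: "smooth_on UNIV g"
      "\<And>t. B (Suc m) t + h' t = (\<Sum>j<N. a (Suc m + j) * t ^ j) + t ^ N * g t"
      using Suc.IH[OF h'(1)] by metis
    have "B m t + h t = (\<Sum>j<Suc N. a (m + j) * t ^ j) + t ^ Suc N * g t" for t
    proof -
      have "B m t + h t = a m + t * (B (Suc m) t + h' t)"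
        using B_rec[of m t] h'(2)[of t] by (simp add: algebra_simps)
      also have "\<dots> = a m + (\<Sum>j<N. a (Suc m + j) * t ^ Suc j) + t ^ Suc N * g t"
        unfolding g(2) by (simp add: distrib_left sum_distrib_left mult_ac)
      also have "a m + (\<Sum>j<N. a (Suc m + j) * t ^ Suc j) = (\<Sum>j<Suc N. a (m + j) * t ^ j)"
        by (simp add: sum.lessThan_Suc_shift del: sum.lessThan_Suc)
      finally show ?thesis .
    qed
    with g(1) show ?case by blast
  qed
  moreover have "flat_at_0 (\<lambda>_. 0)" by (rule flat_at_0_vanishing[of _ 1]) (auto intro: smooth_intros)
  ultimately have "\<exists>g. smooth_on UNIV g \<and> (\<forall>t. B 0 t + 0 = (\<Sum>j<N. a (0 + j) * t ^ j) + t ^ N * g t)" for N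
    by blast
  then show thesis by (intro that[of "B 0"]) simp
qed

section \<open>Even and odd parts\<close>

lemma sum_even_odd:
  fixes f :: "nat \<Rightarrow> 'a::comm_monoid_add"
  shows "(\<Sum>j<2 * N. f j) = (\<Sum>j<N. f (2 * j)) + (\<Sum>j<N. f (2 * j + 1))"
  by (induction N) (simp_all add: add_ac)

text \<open>The Taylor coefficients are split by parity and realised by two smooth functions
  \<open>e\<close> and \<open>d\<close>. What remains of \<open>f\<close> after subtracting
  \<open>e (x\<^sup>2) + x * d (x\<^sup>2)\<close> is flat: order 2 N of \<open>f\<close> matches
  order N of \<open>e\<close> and \<open>d\<close>. For a flat function, the even part and the odd
  part divided by x are smooth functions of x^2 by \<open>smooth_on_flat_sqrt\<close>.\<close>

theorem Whitney_even_odd: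
  fixes f :: "real \<Rightarrow> real"
  assumes f: "smooth_on UNIV f"
  obtains E O' where "smooth_on UNIV E" "smooth_on UNIV O'"
    "\<And>x. f x = E (x\<^sup>2) + x * O' (x\<^sup>2)"
proof -
  obtain a where a: "\<And>N. \<exists>g. smooth_on UNIV g \<and> (\<forall>t. f t = (\<Sum>j<N. a j * t ^ j) + t ^ N * g t)"
    using smooth_Taylor[OF f] by metis
  obtain e where e: "\<And>N. \<exists>g. smooth_on UNIV g \<and> (\<forall>t. e t = (\<Sum>j<N. a (2 * j) * t ^ j) + t ^ N * g t)"
    using Borel[of "\<lambda>j. a (2 * j)"] by metis
  obtain d where d: "\<And>N. \<exists>g. smooth_on UNIV g \<and> (\<forall>t. d t = (\<Sum>j<N. a (2 * j + 1) * t ^ j) + t ^ N * g t)"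
    using Borel[of "\<lambda>j. a (2 * j + 1)"] by metis
  define R where "R x = f x - e (x\<^sup>2) - x * d (x\<^sup>2)" for x
  have smooth_sq: "smooth_on UNIV (\<lambda>x. g (x\<^sup>2))" if "smooth_on UNIV g" for g :: "real \<Rightarrow> real"
    by (rule smooth_on_compose[OF open_UNIV that]) (auto intro!: smooth_intros)
  have R: "flat_at_0 R"
    unfolding flat_at_0_def
  proof
    fix N
    obtain f1 where f1: "smooth_on UNIV f1" "\<And>t. f t = (\<Sum>j<2 * N. a j * t ^ j) + t ^ (2 * N) * f1 t"
      using a by metis
    obtain e1 where e1: "smooth_on UNIV e1" "\<And>t. e t = (\<Sum>j<N. a (2 * j) * t ^ j) + t ^ N * e1 t"
      using e by metis
    obtain d1 where d1: "smooth_on UNIV d1" "\<And>t. d t = (\<Sum>j<N. a (2 * j + 1) * t ^ j) + t ^ N * d1 t"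
      using d by metis
    have "R x = x ^ N * (x ^ N * (f1 x - e1 (x\<^sup>2) - x * d1 (x\<^sup>2)))" for x
      unfolding R_def f1(2) e1(2) d1(2) sum_even_odd
      by (simp add: sum_distrib_left power_add power_mult algebra_simps)
        (simp add: power2_eq_square power_mult_distrib)
    moreover have "smooth_on UNIV (\<lambda>x. x ^ N * (f1 x - e1 (x\<^sup>2) - x * d1 (x\<^sup>2)))"
      by (intro smooth_intros open_UNIV smooth_sq f1(1) e1(1) d1(1))
    ultimately show "\<exists>g. smooth_on UNIV g \<and> (\<forall>x. R x = x ^ N * g x)" by blast
  qed
  have p: "flat_at_0 (\<lambda>t. 1 / 2 * (R t + R (- t)))"
    by (intro flat_at_0_cmult flat_at_0_add flat_at_0_reflect R)
  have "flat_at_0 (\<lambda>t. 1 / 2 * (R t + (- 1) * R (- t)))"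
    by (intro flat_at_0_cmult flat_at_0_add flat_at_0_reflect R)
  then obtain q where q: "flat_at_0 q" "\<And>t. 1 / 2 * (R t + (- 1) * R (- t)) = t * q t"
    by (rule flat_at_0_divide) metis
  let ?e = "\<lambda>f u. if u > (0::real) then f (sqrt u) else (0::real)"
  let ?p = "\<lambda>t. 1 / 2 * (R t + R (- t))"
  have R_eq: "R x = ?e ?p (x\<^sup>2) + x * ?e q (x\<^sup>2)" for x
  proof (cases "x = 0")
    case True
    then show ?thesis using flat_at_0_zero[OF R] by simp
  next
    case False
    have "R x = ?p \<bar>x\<bar> + x * q \<bar>x\<bar>"
    proof (cases "x > 0")
      case True
      then show ?thesis using q(2)[of x] by (simp add: field_simps)
    next
      case False
      then show ?thesis using q(2)[of "- x"] by (simp add: field_simps)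
    qed
    then show ?thesis using False by simp
  qed
  have e_smooth: "smooth_on UNIV e" using e[of 0] by (auto simp flip: fun_eq_iff)
  have d_smooth: "smooth_on UNIV d" using d[of 0] by (auto simp flip: fun_eq_iff)
  show thesis
  proof (intro that[of "\<lambda>u. e u + ?e ?p u" "\<lambda>u. d u + ?e q u"])
    show "f x = e (x\<^sup>2) + ?e ?p (x\<^sup>2) + x * (d (x\<^sup>2) + ?e q (x\<^sup>2))" for x
      using R_eq[of x] unfolding R_def by (simp only: distrib_left)
  qed (intro smooth_on_add open_UNIV smooth_on_flat_sqrt p q(1) e_smooth d_smooth)+
qed

section \<open>The universal cover of the source\<close>

text \<open>Maps and vector fields on the quotient are treated as deck-compatible ones on this
  linear space; the charts of the atlas enter only through transfer lemmas.\<close>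

definition cover :: "(real \<times> real) \<times> complex \<Rightarrow> moebius \<times> complex"
  where "cover = (\<lambda>(q, z). (moebius_class q, z))"

definition deck :: "int \<Rightarrow> (real \<times> real) \<times> complex \<Rightarrow> (real \<times> real) \<times> complex"
  where "deck n = (\<lambda>(q, z). (moebius_action n q, z))"

lemma cover_eq_iff: "cover p = cover q \<longleftrightarrow> (\<exists>n. q = deck n p)"
  by (auto simp: cover_def deck_def moebius_class_eq_iff split: prod.splits)

lemma cover_deck [simp]: "cover (deck n p) = cover p"
  by (metis cover_eq_iff)

lemma deck_apply: "deck n ((r, s), z) = (((-1) powi n * r, s + of_int n), z)"
  by (simp add: deck_def moebius_action_def)

lemma surj_cover: "surj cover"
proof (rule surjI)
  show "cover (rep_moebius (fst p), snd p) = p" for p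
    by (simp add: cover_def Quotient3_abs_rep[OF Quotient3_moebius])
qed

lemma smooth_on_deck [smooth_intros]:
  "open S \<Longrightarrow> smooth_on S f \<Longrightarrow> smooth_on S (\<lambda>x. deck n (f x))"
  unfolding deck_def moebius_action_def case_prod_unfold by (intro smooth_intros) simp_all

lemma open_deck_vimage: "open S \<Longrightarrow> open (deck n -` S)"
proof -
  assume "open S"
  moreover have "continuous_on UNIV (\<lambda>x. deck n x)"
    by (intro smooth_on_continuous_on smooth_intros open_UNIV)
  ultimately show ?thesis by (rule open_vimage)
qed

lemma continuous_on_cover: "continuous_on S cover"
  unfolding cover_def case_prod_unfold
  by (intro continuous_intros continuous_on_compose2[OF continuous_moebius_class[of UNIV]]) auto

lemma open_cover_image:
  assumes "open S" shows "open (cover ` S)"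
  unfolding open_prod_def
proof
  fix p assume "p \<in> cover ` S"
  then obtain q z where p: "p = (moebius_class q, z)" "(q, z) \<in> S" by (auto simp: cover_def)
  then obtain U V where UV: "open U" "open V" "(q, z) \<in> U \<times> V" "U \<times> V \<subseteq> S"
    using assms open_prod_elim by metis
  have "moebius_class ` U \<times> V \<subseteq> cover ` S"
    using UV(4) by (force simp: cover_def image_iff)
  then show "\<exists>A B. open A \<and> open B \<and> p \<in> A \<times> B \<and> A \<times> B \<subseteq> cover ` S"
    using UV p(1) open_moebius_class_image[OF UV(1)] by (intro exI[of _ "moebius_class ` U"] exI[of _ V]) auto
qed

lemma inj_on_cover_strip: "inj_on cover ((UNIV \<times> {s - 1/2<..<s + 1/2}) \<times> UNIV)"
proof (rule inj_onI)
  fix p q assume pq: "p \<in> (UNIV \<times> {s - 1/2<..<s + 1/2}) \<times> UNIV"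
    "q \<in> (UNIV \<times> {s - 1/2<..<s + 1/2}) \<times> UNIV" "cover p = cover q"
  then obtain n where n: "q = deck n p" by (auto simp: cover_eq_iff)
  obtain r t z where p: "p = ((r, t), z)" by (metis prod.exhaust)
  from pq n have "\<bar>real_of_int n\<bar> < 1" by (auto simp: p deck_apply)
  then have "n = 0" by linarith
  with n show "p = q" by (simp add: p deck_apply)
qed

section \<open>Transfer between charts and the cover\<close>

text \<open>Each chart of the atlas inverts \<open>cover\<close> on an open set \<open>S\<close> of
  the cover, so a map read in the chart is its lift restricted to \<open>S\<close>.\<close>

lemma moebius_C_chart:
  assumes "c \<in> moebius_C_atlas"
  obtains S where "open S" "inj_on cover S" "fst c = cover ` S" "snd c ` fst c = S"
    "\<And>q. q \<in> S \<Longrightarrow> snd c (cover q) = q" "\<And>q. q \<in> S \<Longrightarrow> inv_into (fst c) (snd c) q = cover q"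
proof -
  obtain U where U: "open U" "inj_on moebius_class U"
    "c = (moebius_class ` U \<times> UNIV, map_prod (inv_into U moebius_class) (\<lambda>z. z))"
    using assms unfolding moebius_C_atlas_def product_atlas_def moebius_atlas_def euclidean_atlas_def
    by auto
  define S where "S = U \<times> (UNIV :: complex set)"
  have fst_c: "fst c = cover ` S"
    by (force simp: U(3) S_def cover_def)
  have snd_c: "snd c (cover q) = q" if "q \<in> S" for q
    using that U(2) by (auto simp: U(3) S_def cover_def inv_into_f_f)
  have inj: "inj_on (snd c) (fst c)"
    unfolding fst_c by (rule inj_onI) (metis imageE snd_c)
  show thesis
  proof
    show "open S" using U(1) by (simp add: S_def open_Times)
    show "inj_on cover S" by (rule inj_on_inverseI[of S "snd c"]) (rule snd_c)
    show "snd c ` fst c = S" unfolding fst_c image_image using snd_c by force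
    show "inv_into (fst c) (snd c) q = cover q" if "q \<in> S" for q
      by (rule inv_into_f_eq[OF inj]) (use that fst_c snd_c in auto)
  qed (fact fst_c snd_c)+
qed

lemma moebius_C_chart_exists:
  obtains c where "c \<in> moebius_C_atlas" "cover q \<in> fst c" "snd c (cover q) = q"
proof -
  obtain r s z where q: "q = ((r, s), z)" by (metis prod.exhaust)
  define U :: "(real \<times> real) set" where "U = UNIV \<times> {s - 1/2<..<s + 1/2}"
  have "open U" unfolding U_def by (intro open_Times) auto
  moreover have inj: "inj_on moebius_class U"
  proof (rule inj_onI)
    fix a b assume "a \<in> U" "b \<in> U" "moebius_class a = moebius_class b"
    then have "(a, 0::complex) = (b, 0)"
      by (intro inj_onD[OF inj_on_cover_strip[of s]]) (auto simp: U_def cover_def)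
    then show "a = b" by simp
  qed
  ultimately have "(moebius_class ` U, inv_into U moebius_class) \<in> moebius_atlas"
    unfolding moebius_atlas_def by blast
  then have "(moebius_class ` U \<times> UNIV, map_prod (inv_into U moebius_class) (\<lambda>z. z)) \<in> moebius_C_atlas"
    unfolding moebius_C_atlas_def product_atlas_def euclidean_atlas_def by blast
  moreover have "(r, s) \<in> U" by (simp add: U_def)
  ultimately show thesis
    using inj by (intro that) (auto simp: q cover_def inv_into_f_f)
qed

lemma deck_into:
  assumes "cover q \<in> cover ` S" obtains n where "deck n q \<in> S"
  using assms by (metis cover_eq_iff imageE)

lemma smooth_map_iff: "smooth_map moebius_C_atlas f \<longleftrightarrow> smooth_on UNIV (\<lambda>q. f (cover q))"
proof
  assume f: "smooth_map moebius_C_atlas f"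
  show "smooth_on UNIV (\<lambda>q. f (cover q))"
  proof (rule smooth_on_locally)
    fix q
    obtain c where c: "c \<in> moebius_C_atlas" "cover q \<in> fst c" "snd c (cover q) = q"
      using moebius_C_chart_exists .
    obtain S where S: "open S" "snd c ` fst c = S" "\<And>q. q \<in> S \<Longrightarrow> inv_into (fst c) (snd c) q = cover q"
      using moebius_C_chart[OF c(1)] by metis
    have "smooth_on S (f \<circ> inv_into (fst c) (snd c))"
      using f c(1) S(2) unfolding smooth_map_def by fastforce
    then have "smooth_on S (\<lambda>q. f (cover q))"
      by (rule smooth_on_cong) (use S in auto)
    moreover have "q \<in> S" using c S(2) by force
    ultimately show "\<exists>T. open T \<and> q \<in> T \<and> smooth_on T (\<lambda>q. f (cover q))" using S(1) by blast
  qed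
next
  assume f: "smooth_on UNIV (\<lambda>q. f (cover q))"
  show "smooth_map moebius_C_atlas f"
    unfolding smooth_map_def
  proof (intro ballI case_prodI2)
    fix c U \<phi> assume c: "c \<in> moebius_C_atlas" "c = (U, \<phi>)"
    obtain S where S: "open S" "snd c ` fst c = S" "\<And>q. q \<in> S \<Longrightarrow> inv_into (fst c) (snd c) q = cover q"
      using moebius_C_chart[OF c(1)] by metis
    have "smooth_on S (f \<circ> inv_into (fst c) (snd c))"
      by (rule smooth_on_cong[OF smooth_on_subset[OF f]]) (use S in auto)
    then show "smooth_on (\<phi> ` U) (f \<circ> inv_into U \<phi>)" using S(2) c(2) by simp
  qed
qed

text \<open>Both sides choose from the same predicate, which settles differentiable and
  non-differentiable points alike.\<close>

lemma frechet_derivative_cong: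
  assumes "open S" "x \<in> S" "\<And>y. y \<in> S \<Longrightarrow> f y = g y"
  shows "frechet_derivative f (at x) = frechet_derivative g (at x)"
proof -
  have "(f has_derivative f') (at x) \<longleftrightarrow> (g has_derivative f') (at x)" for f'
  proof
    assume "(f has_derivative f') (at x)"
    then show "(g has_derivative f') (at x)"
      by (rule has_derivative_transform_within_open[OF _ assms(1,2)]) (rule assms(3))
  next
    assume "(g has_derivative f') (at x)"
    then show "(f has_derivative f') (at x)"
      by (rule has_derivative_transform_within_open[OF _ assms(1,2)]) (rule assms(3)[symmetric])
  qed
  then have "(\<lambda>f'. (f has_derivative f') (at x)) = (\<lambda>f'. (g has_derivative f') (at x))" by (rule ext)
  then have "(SOME f'. (f has_derivative f') (at x)) = (SOME f'. (g has_derivative f') (at x))"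
    by (rule arg_cong[where f = Eps])
  then show ?thesis unfolding frechet_derivative_def .
qed

lemma differential_in_eq:
  assumes "c \<in> moebius_C_atlas" "p \<in> fst c"
  shows "differential_in c f p = frechet_derivative (\<lambda>q. f (cover q)) (at (snd c p))"
    "cover (snd c p) = p"
proof -
  obtain S where S: "open S" "fst c = cover ` S" "snd c ` fst c = S" "\<And>q. q \<in> S \<Longrightarrow> snd c (cover q) = q"
    "\<And>q. q \<in> S \<Longrightarrow> inv_into (fst c) (snd c) q = cover q"
    by (rule moebius_C_chart[OF assms(1)]) blast
  obtain x where "x \<in> S" "p = cover x" using assms(2) unfolding S(2) by blast
  then show "cover (snd c p) = p" by (simp only: S(4))
  have "snd c p \<in> S" using S(3) assms(2) by blast
  then have "frechet_derivative (f \<circ> inv_into (fst c) (snd c)) (at (snd c p)) =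
      frechet_derivative (\<lambda>q. f (cover q)) (at (snd c p))"
    by (rule frechet_derivative_cong[OF S(1)]) (simp add: S(5))
  then show "differential_in c f p = frechet_derivative (\<lambda>q. f (cover q)) (at (snd c p))"
    by (simp add: differential_in_def case_prod_unfold)
qed

lemma critical_points_eq:
  "critical_points moebius_C_atlas f = cover ` {q. \<not> surj (frechet_derivative (\<lambda>q. f (cover q)) (at q))}"
proof (intro set_eqI iffI)
  fix p assume "p \<in> critical_points moebius_C_atlas f"
  then obtain c where c: "c \<in> moebius_C_atlas" "p \<in> fst c" "\<not> surj (differential_in c f p)"
    unfolding critical_points_def by blast
  then show "p \<in> cover ` {q. \<not> surj (frechet_derivative (\<lambda>q. f (cover q)) (at q))}"
    using differential_in_eq(1)[OF c(1,2), of f] differential_in_eq(2)[OF c(1,2)] by (intro image_eqI[of _ _ "snd c p"]) auto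
next
  fix p assume "p \<in> cover ` {q. \<not> surj (frechet_derivative (\<lambda>q. f (cover q)) (at q))}"
  then obtain q where q: "p = cover q" "\<not> surj (frechet_derivative (\<lambda>q. f (cover q)) (at q))" by blast
  obtain c where c: "c \<in> moebius_C_atlas" "cover q \<in> fst c" "snd c (cover q) = q"
    using moebius_C_chart_exists .
  then show "p \<in> critical_points moebius_C_atlas f"
    unfolding critical_points_def using q differential_in_eq(1)[OF c(1,2), of f] by auto
qed

section \<open>Diffeomorphisms and local coordinates\<close>

text \<open>The inverse is an argument: the charts below are invertible by formulas, and smoothness
  of the inverse is read off from them instead of the inverse function theorem.\<close>

definition diffeo ::
    "'a::euclidean_space set \<Rightarrow> 'b::euclidean_space set \<Rightarrow> ('a \<Rightarrow> 'b) \<Rightarrow> ('b \<Rightarrow> 'a) \<Rightarrow> bool"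
  where "diffeo S T f g \<longleftrightarrow> open S \<and> open T \<and> smooth_on S f \<and> smooth_on T g \<and>
    (\<forall>x\<in>S. f x \<in> T \<and> g (f x) = x) \<and> (\<forall>y\<in>T. g y \<in> S \<and> f (g y) = y)"

lemma diffeo_image: "diffeo S T f g \<Longrightarrow> f ` S = T"
  unfolding diffeo_def by force

lemma diffeo_compose:
  assumes "diffeo S T f g" "diffeo T U f' g'"
  shows "diffeo S U (\<lambda>x. f' (f x)) (\<lambda>y. g (g' y))"
proof -
  have "smooth_on S (\<lambda>x. f' (f x))"
    by (rule smooth_on_compose[of S T]) (use assms in \<open>auto simp: diffeo_def\<close>)
  moreover have "smooth_on U (\<lambda>y. g (g' y))"
    by (rule smooth_on_compose[of U T]) (use assms in \<open>auto simp: diffeo_def\<close>)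
  ultimately show ?thesis using assms unfolding diffeo_def by auto
qed

lemma diffeo_restrict:
  assumes "diffeo S T f g" "open U"
  shows "diffeo {x \<in> S. f x \<in> U} (T \<inter> U) f g"
proof -
  have "S \<inter> f -` U = {x \<in> S. f x \<in> U}" by auto
  then have "open {x \<in> S. f x \<in> U}"
    using assms continuous_on_open_vimage[of S f] smooth_on_continuous_on[of S f]
    unfolding diffeo_def by (metis Int_commute)
  then show ?thesis
    using assms unfolding diffeo_def by (auto intro: smooth_on_subset)
qed

lemma inv_into_diffeo:
  assumes "diffeo S T f g" "y \<in> T" shows "inv_into S f y = g y"
proof (rule inv_into_f_eq)
  show "inj_on f S" using assms(1) unfolding diffeo_def by (metis inj_on_inverseI)
qed (use assms in \<open>auto simp: diffeo_def\<close>)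

lemma local_coordinates_euclidean:
  assumes "diffeo V W \<psi> \<psi>'"
  shows "local_coordinates euclidean_atlas V \<psi>"
proof -
  have V: "open V" "open W" "smooth_on V \<psi>" "smooth_on W \<psi>'" using assms by (auto simp: diffeo_def)
  have im: "\<psi> ` V = W" using assms by (rule diffeo_image)
  have inv: "smooth_on W (inv_into V \<psi>)"
    by (rule smooth_on_cong[OF V(4,2)]) (simp add: inv_into_diffeo[OF assms])
  have "homeomorphism V W \<psi> (inv_into V \<psi>)"
  proof (rule homeomorphismI)
    show "continuous_on V \<psi>" "continuous_on W (inv_into V \<psi>)"
      by (rule smooth_on_continuous_on, fact)+
  qed (use assms inv_into_diffeo[OF assms] in \<open>auto simp: diffeo_def\<close>)
  moreover have "inv_into UNIV (\<lambda>x::'a. x) = (\<lambda>x. x)"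
    using inv_id by (simp add: id_def)
  ultimately show ?thesis
    unfolding local_coordinates_def euclidean_atlas_def using V inv
    by (simp add: im o_def)
qed

text \<open>Two lifts of a point differ by a deck transformation with locally constant index, so
  each change to or from an atlas chart is locally \<open>\<Psi>\<close> followed, or
  \<open>\<Phi>\<close> preceded, by one \<open>deck n\<close>.\<close>

lemma local_coordinates_cover:
  assumes "diffeo S T \<Phi> \<Psi>" "inj_on cover S"
  shows "local_coordinates moebius_C_atlas (cover ` S) (\<Phi> \<circ> inv_into S cover)"
proof -
  let ?g = "inv_into S cover" let ?\<phi> = "\<Phi> \<circ> ?g" let ?U = "cover ` S"
  have S: "open S" "open T" "smooth_on S \<Phi>" "smooth_on T \<Psi>" using assms by (auto simp: diffeo_def)
  have g: "?g (cover q) = q" if "q \<in> S" for q using assms(2) that by (rule inv_into_f_f)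
  have \<phi>: "?\<phi> (cover q) = \<Phi> q" if "q \<in> S" for q using g[OF that] by simp
  have im: "?\<phi> ` ?U = T"
    using \<phi> diffeo_image[OF assms(1)] by (metis (no_types, lifting) image_cong image_image)
  have inj: "inj_on ?\<phi> ?U"
  proof (rule inj_on_inverseI)
    show "cover (\<Psi> (?\<phi> p)) = p" if "p \<in> ?U" for p
      using that assms(1) \<phi> unfolding diffeo_def by auto
  qed
  have inv: "inv_into ?U ?\<phi> y = cover (\<Psi> y)" if "y \<in> T" for y
    by (rule inv_into_f_eq[OF inj]) (use that assms(1) \<phi> in \<open>auto simp: diffeo_def\<close>)
  have cont_g: "continuous_on ?U ?g"
  proof (subst continuous_on_open_vimage[OF open_cover_image[OF S(1)]], intro allI impI)
    fix B :: "((real \<times> real) \<times> complex) set" assume "open B"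
    have "?g -` B \<inter> ?U = cover ` (S \<inter> B)" using g by auto
    then show "open (?g -` B \<inter> ?U)" using open_cover_image S(1) \<open>open B\<close> by (simp add: open_Int)
  qed
  have "homeomorphism ?U T ?\<phi> (inv_into ?U ?\<phi>)"
  proof (rule homeomorphismI)
    show "continuous_on ?U ?\<phi>"
      by (intro continuous_on_compose cont_g continuous_on_subset[OF smooth_on_continuous_on[OF S(3)]])
        (use g in auto)
    have "continuous_on T (\<lambda>y. cover (\<Psi> y))"
      by (intro continuous_on_compose2[OF continuous_on_cover[of UNIV]] smooth_on_continuous_on S(4)) auto
    then show "continuous_on T (inv_into ?U ?\<phi>)" by (rule continuous_on_eq) (simp add: inv)
    show "?\<phi> ` ?U \<subseteq> T" using im by simp
    show "inv_into ?U ?\<phi> ` T \<subseteq> ?U"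
      by (rule image_subsetI) (use assms(1) in \<open>simp add: inv diffeo_def\<close>)
    show "inv_into ?U ?\<phi> (?\<phi> p) = p" if "p \<in> ?U" for p using inj that by (rule inv_into_f_f)
    show "?\<phi> (inv_into ?U ?\<phi> y) = y" if "y \<in> T" for y
      using that unfolding im[symmetric] by (rule f_inv_into_f)
  qed
  moreover have "smooth_on (?\<phi> ` (?U \<inter> V)) (\<psi> \<circ> inv_into ?U ?\<phi>) \<and>
      smooth_on (\<psi> ` (?U \<inter> V)) (?\<phi> \<circ> inv_into V \<psi>)" if c: "(V, \<psi>) \<in> moebius_C_atlas" for V \<psi>
  proof
    obtain S' where S': "open S'" "V = cover ` S'" "\<psi> ` V = S'"
      "\<And>q. q \<in> S' \<Longrightarrow> \<psi> (cover q) = q" "\<And>q. q \<in> S' \<Longrightarrow> inv_into V \<psi> q = cover q"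
      using moebius_C_chart[OF c] unfolding fst_conv snd_conv by metis
    show "smooth_on (?\<phi> ` (?U \<inter> V)) (\<psi> \<circ> inv_into ?U ?\<phi>)"
    proof (rule smooth_on_locally)
      fix y assume "y \<in> ?\<phi> ` (?U \<inter> V)"
      then obtain p where p: "y = ?\<phi> p" "p \<in> ?U" "p \<in> cover ` S'" unfolding S'(2) by blast
      from p(2) obtain q where q': "q \<in> S" "p = cover q" by blast
      have q: "q \<in> S" "cover q \<in> cover ` S'" "y = \<Phi> q"
        using p q' \<phi>[OF q'(1)] by simp_all
      then obtain n where n: "deck n q \<in> S'" using deck_into by metis
      let ?T = "\<Psi> -` (deck n -` S') \<inter> T"
      have "open ?T"
        using continuous_on_open_vimage[OF S(2), of \<Psi>] smooth_on_continuous_on[OF S(4)]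
          open_deck_vimage[OF S'(1)] by blast
      moreover have "y \<in> ?T" using q n assms(1) by (auto simp: diffeo_def)
      moreover have "smooth_on ?T (\<psi> \<circ> inv_into ?U ?\<phi>)"
      proof (rule smooth_on_cong)
        show "smooth_on ?T (\<lambda>y. deck n (\<Psi> y))"
          by (intro smooth_intros smooth_on_subset[OF S(4)] \<open>open ?T\<close>) auto
        show "deck n (\<Psi> y) = (\<psi> \<circ> inv_into ?U ?\<phi>) y" if "y \<in> ?T" for y
          using that inv[of y] S'(4)[of "deck n (\<Psi> y)"] by simp
      qed fact
      ultimately show "\<exists>T. open T \<and> y \<in> T \<and> smooth_on T (\<psi> \<circ> inv_into ?U ?\<phi>)" by blast
    qed
    show "smooth_on (\<psi> ` (?U \<inter> V)) (?\<phi> \<circ> inv_into V \<psi>)"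
    proof (rule smooth_on_locally)
      fix y assume "y \<in> \<psi> ` (?U \<inter> V)"
      then obtain p where p: "y = \<psi> p" "p \<in> ?U" "p \<in> cover ` S'" unfolding S'(2) by blast
      from p(3) obtain q where q: "q \<in> S'" "p = cover q" by blast
      have y: "y \<in> S'" "cover y \<in> cover ` S" using p q S'(4)[OF q(1)] by simp_all
      then obtain n where n: "deck n y \<in> S" using deck_into by metis
      let ?T = "S' \<inter> deck n -` S"
      have "open ?T" using S'(1) open_deck_vimage[OF S(1)] by blast
      moreover have "smooth_on ?T (?\<phi> \<circ> inv_into V \<psi>)"
      proof (rule smooth_on_cong)
        show "smooth_on ?T (\<lambda>y. \<Phi> (deck n y))"
          by (rule smooth_on_compose[OF \<open>open ?T\<close> S(3)])
            (auto intro!: smooth_intros \<open>open ?T\<close> S(1))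
        show "\<Phi> (deck n y) = (?\<phi> \<circ> inv_into V \<psi>) y" if "y \<in> ?T" for y
          using that S'(5)[of y] \<phi>[of "deck n y"] by simp
      qed fact
      ultimately show "\<exists>T. open T \<and> y \<in> T \<and> smooth_on T (?\<phi> \<circ> inv_into V \<psi>)" using y n by blast
    qed
  qed
  ultimately show ?thesis
    unfolding local_coordinates_def im using open_cover_image[OF S(1)] S(2) by blast
qed

lemma has_local_formI:
  assumes "diffeo S T \<Phi> \<Psi>" "inj_on cover S" "q \<in> S" "\<Phi> q = 0"
    and "diffeo V W \<psi> \<psi>'" "\<And>x. x \<in> S \<Longrightarrow> f (cover x) \<in> V" "\<psi> (f (cover q)) = 0"
    and "\<And>x. x \<in> S \<Longrightarrow> \<psi> (f (cover x)) = g (\<Phi> x)"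
  shows "has_local_form moebius_C_atlas f (cover q) g"
  unfolding has_local_form_def
proof (intro exI conjI)
  show "local_coordinates moebius_C_atlas (cover ` S) (\<Phi> \<circ> inv_into S cover)"
    using assms(1,2) by (rule local_coordinates_cover)
  show "local_coordinates euclidean_atlas V \<psi>" using assms(5) by (rule local_coordinates_euclidean)
qed (use assms in \<open>auto simp: inv_into_f_f\<close>)

text \<open>The converse transfer, for coordinates that are merely known to exist: it lifts an
  arbitrary cusp normal form to the cover, where derivatives can be compared.\<close>

lemma local_coordinates_coverD:
  assumes "local_coordinates moebius_C_atlas U \<phi>" "cover q \<in> U"
  obtains T W \<Psi> where "open T" "q \<in> T" "smooth_on T (\<lambda>x. \<phi> (cover x))" "\<And>x. x \<in> T \<Longrightarrow> cover x \<in> U"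
    "open W" "\<phi> (cover q) \<in> W" "smooth_on W \<Psi>" "\<Psi> (\<phi> (cover q)) = q"
    "\<And>y. y \<in> W \<Longrightarrow> y \<in> \<phi> ` U \<and> inv_into U \<phi> y = cover (\<Psi> y)"
proof -
  obtain c where c: "c \<in> moebius_C_atlas" "cover q \<in> fst c" "snd c (cover q) = q"
    using moebius_C_chart_exists .
  obtain V \<psi> where V: "c = (V, \<psi>)" by fastforce
  obtain S where S: "open S" "V = cover ` S" "\<psi> ` V = S"
    "\<And>x. x \<in> S \<Longrightarrow> \<psi> (cover x) = x" "\<And>x. x \<in> S \<Longrightarrow> inv_into V \<psi> x = cover x"
    using moebius_C_chart[OF c(1)] unfolding V fst_conv snd_conv by metis
  have U: "open U" "open (\<phi> ` U)" "homeomorphism U (\<phi> ` U) \<phi> (inv_into U \<phi>)"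
    and s1: "smooth_on (\<phi> ` (U \<inter> V)) (\<psi> \<circ> inv_into U \<phi>)"
    and s2: "smooth_on (\<psi> ` (U \<inter> V)) (\<phi> \<circ> inv_into V \<psi>)"
    using assms(1) c(1) unfolding local_coordinates_def V by auto
  have inv: "inv_into U \<phi> (\<phi> p) = p" if "p \<in> U" for p
    using U(3) that by (rule homeomorphism_apply1)
  have qS: "q \<in> S" using c(2,3) S(3) V by force
  have qV: "cover q \<in> U \<inter> V" using assms(2) c(2) V by simp
  have T: "\<psi> ` (U \<inter> V) = S \<inter> cover -` U"
  proof (intro subset_antisym subsetI)
    fix x assume "x \<in> S \<inter> cover -` U"
    then show "x \<in> \<psi> ` (U \<inter> V)" using S(2,4) by (intro image_eqI[of _ _ "cover x"]) auto
  qed (use S(2,4) in auto)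
  have oT: "open (S \<inter> cover -` U)"
    by (intro open_Int S(1) open_vimage[OF U(1) continuous_on_cover])
  have W: "\<phi> ` (U \<inter> V) = inv_into U \<phi> -` V \<inter> \<phi> ` U" using inv by auto
  have oW: "open (inv_into U \<phi> -` V \<inter> \<phi> ` U)"
    using continuous_on_open_vimage[OF U(2), of "inv_into U \<phi>"] homeomorphism_cont2[OF U(3)]
      open_cover_image[OF S(1)] unfolding S(2) by simp
  show thesis
  proof (rule that[OF oT _ _ _ oW _ s1[unfolded W]])
    show "smooth_on (S \<inter> cover -` U) (\<lambda>x. \<phi> (cover x))"
      by (rule smooth_on_cong[OF s2[unfolded T] oT]) (simp add: S(5))
    show "q \<in> S \<inter> cover -` U" using qS assms(2) by simp
    show "\<phi> (cover q) \<in> inv_into U \<phi> -` V \<inter> \<phi> ` U" using inv qV by auto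
    show "(\<psi> \<circ> inv_into U \<phi>) (\<phi> (cover q)) = q" using inv qV S(4) qS by simp
    show "y \<in> \<phi> ` U \<and> inv_into U \<phi> y = cover ((\<psi> \<circ> inv_into U \<phi>) y)"
      if "y \<in> inv_into U \<phi> -` V \<inter> \<phi> ` U" for y
      using that S(2,4) by auto
  qed auto
qed

section \<open>Charts in which the map is a versal cubic\<close>

lemma diffeo_sym: "diffeo S T f g \<Longrightarrow> diffeo T S g f"
  unfolding diffeo_def by blast

lemma diffeo_restrict_source:
  "diffeo S T f g \<Longrightarrow> open U \<Longrightarrow> diffeo (S \<inter> U) {y \<in> T. g y \<in> U} f g"
  by (rule diffeo_sym[OF diffeo_restrict[OF diffeo_sym]])

lemma diffeo_id: "diffeo UNIV UNIV (\<lambda>x. x) (\<lambda>x. x)"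
  by (simp add: diffeo_def smooth_on_id)

lemma open_vimage_on:
  assumes "open S" "continuous_on S f" "open B" shows "open (f -` B \<inter> S)"
  using continuous_on_open_vimage[OF assms(1), of f] assms(2,3) by blast

lemma open_Collect_less_on:
  fixes f g :: "'a::topological_space \<Rightarrow> real"
  assumes "open S" "continuous_on S f" "continuous_on S g"
  shows "open {x \<in> S. f x < g x}"
proof -
  have "continuous_on S (\<lambda>x. g x - f x)" by (intro continuous_intros assms)
  then have "open ((\<lambda>x. g x - f x) -` {0<..} \<inter> S)"
    by (intro open_vimage_on assms(1) open_greaterThan)
  moreover have "(\<lambda>x. g x - f x) -` {0<..} \<inter> S = {x \<in> S. f x < g x}" by auto
  ultimately show ?thesis by simp
qed

section \<open>The cubic and its middle root\<close>

lemma sin_triple: "sin (3 * x) = 3 * sin x - 4 * sin x ^ 3" for x :: real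
proof -
  have c: "cos x ^ 2 = 1 - sin x ^ 2" by (simp add: cos_squared_eq)
  have "sin (3 * x) = sin (2 * x + x)" by simp
  also have "\<dots> = 3 * sin x * cos x ^ 2 - sin x ^ 3"
    unfolding sin_add sin_double cos_double by (simp add: algebra_simps power2_eq_square power3_eq_cube)
  finally show ?thesis unfolding c by (simp add: algebra_simps power2_eq_square power3_eq_cube)
qed

lemma cos_triple: "cos (3 * x) = 4 * cos x ^ 3 - 3 * cos x" for x :: real
proof -
  have s: "sin x ^ 2 = 1 - cos x ^ 2" by (simp add: sin_squared_eq)
  have "cos (3 * x) = cos (2 * x + x)" by simp
  also have "\<dots> = cos x ^ 3 - 3 * cos x * sin x ^ 2"
    unfolding cos_add sin_double cos_double by (simp add: algebra_simps power2_eq_square power3_eq_cube)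
  finally show ?thesis unfolding s by (simp add: algebra_simps power2_eq_square power3_eq_cube)
qed

text \<open>Vieta's trigonometric solution of the cubic \<open>A\<^sup>3 - (3 - t) A = V\<close> on its branch through
  \<open>A = 0\<close>.\<close>

definition amplitude :: "real \<Rightarrow> real"
  where "amplitude t = 2 * sqrt ((3 - t) / 3)"

definition middle_root :: "real \<Rightarrow> real \<Rightarrow> real"
  where "middle_root t V = - amplitude t * sin (arcsin (4 * V / amplitude t ^ 3) / 3)"

lemma amplitude: "t < 3 \<Longrightarrow> amplitude t > 0" "t < 3 \<Longrightarrow> 3 - t = 3 / 4 * amplitude t ^ 2"
  by (simp_all add: amplitude_def power_mult_distrib)

text \<open>For A = - c sin \<theta> and 3 - t = 3 c^2 / 4 the cubic equals c^3 / 4 (3 sin \<theta>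
  - 4 sin^3 \<theta>) = c^3 / 4 sin 3\<theta>.\<close>

lemma middle_root_cubic:
  assumes "t < 3" "\<bar>4 * V\<bar> < amplitude t ^ 3"
  shows "middle_root t V ^ 3 - (3 - t) * middle_root t V = V"
proof -
  define c where "c = amplitude t"
  have c: "c > 0" "3 - t = 3 / 4 * c ^ 2" using amplitude[OF assms(1)] by (simp_all add: c_def)
  define \<theta> where "\<theta> = arcsin (4 * V / c ^ 3) / 3"
  have "\<bar>4 * V / c ^ 3\<bar> < 1" using assms(2) c(1) by (simp add: c_def abs_mult)
  then have "-1 \<le> 4 * V / c ^ 3" "4 * V / c ^ 3 \<le> 1" by linarith+
  then have "sin (3 * \<theta>) = 4 * V / c ^ 3" by (simp add: \<theta>_def)
  then have V: "V = c ^ 3 / 4 * (3 * sin \<theta> - 4 * sin \<theta> ^ 3)"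
    using c(1) unfolding sin_triple by simp
  show ?thesis
    unfolding middle_root_def c_def[symmetric] \<theta>_def[symmetric] c(2)
    by (subst V) (simp add: algebra_simps power2_eq_square power3_eq_cube)
qed

text \<open>The inequality 3 A^2 < 3 - t places A strictly between the turning points of the cubic,
  that is 2 \<bar>A\<bar> < c. Then \<bar>\<theta>\<bar> < pi / 6, so 3\<theta> lies where the
  arcsine inverts the sine.\<close>

lemma middle_root_unique:
  assumes "t < 3" "3 * A\<^sup>2 < 3 - t" "V = A ^ 3 - (3 - t) * A"
  shows "\<bar>4 * V\<bar> < amplitude t ^ 3" "middle_root t V = A"
proof -
  define c where "c = amplitude t"
  have c: "c > 0" "3 - t = 3 / 4 * c ^ 2" using amplitude[OF assms(1)] by (simp_all add: c_def)
  have "(2 * \<bar>A\<bar>)\<^sup>2 < c\<^sup>2" using assms(2) c(2) by (simp add: power_mult_distrib)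
  then have A: "2 * \<bar>A\<bar> < c" using c(1) by (meson less_imp_le power_less_imp_less_base)
  define \<theta> where "\<theta> = arcsin (- A / c)"
  have b: "\<bar>- A / c\<bar> < 1 / 2" using A c(1) by (simp add: field_simps)
  have s: "sin \<theta> = - A / c" unfolding \<theta>_def by (rule sin_arcsin) (use b in linarith)+
  have pi6: "arcsin (1 / 2) = pi / 6" "arcsin (- (1 / 2)) = - (pi / 6)"
    using arcsin_sin[of "pi / 6"] arcsin_sin[of "- (pi / 6)"] by (simp_all add: sin_30)
  have "arcsin (- (1 / 2)) < \<theta>" "\<theta> < arcsin (1 / 2)"
    unfolding \<theta>_def by (rule arcsin_less_arcsin; use b in linarith)+
  then have \<theta>: "- (pi / 2) < 3 * \<theta>" "3 * \<theta> < pi / 2" unfolding pi6 by linarith+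
  have "4 * V / c ^ 3 = 3 * sin \<theta> - 4 * sin \<theta> ^ 3"
    unfolding s assms(3) c(2) using c(1)
    by (simp add: field_simps power2_eq_square power3_eq_cube)
  then have V: "4 * V / c ^ 3 = sin (3 * \<theta>)" by (simp add: sin_triple)
  have "cos (3 * \<theta>) > 0" using \<theta> by (intro cos_gt_zero_pi) auto
  then have "(sin (3 * \<theta>))\<^sup>2 < 1" by (simp add: sin_squared_eq)
  then have "\<bar>4 * V / c ^ 3\<bar> < 1" unfolding V by (simp add: abs_square_less_1)
  then show "\<bar>4 * V\<bar> < amplitude t ^ 3" using c(1) by (simp add: c_def abs_mult)
  have "arcsin (4 * V / c ^ 3) = 3 * \<theta>" unfolding V by (rule arcsin_sin) (use \<theta> in linarith)+
  then show "middle_root t V = A"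
    unfolding middle_root_def c_def[symmetric] using s c(1) by simp
qed

lemma smooth_on_amplitude [smooth_intros]:
  "open S \<Longrightarrow> smooth_on S f \<Longrightarrow> (\<And>x. x \<in> S \<Longrightarrow> f x < 3) \<Longrightarrow> smooth_on S (\<lambda>x. amplitude (f x))"
  unfolding amplitude_def by (intro smooth_intros) simp_all

lemma smooth_on_middle_root [smooth_intros]:
  assumes "open S" "smooth_on S f" "smooth_on S g" "\<And>x. x \<in> S \<Longrightarrow> f x < 3"
    "\<And>x. x \<in> S \<Longrightarrow> \<bar>4 * g x\<bar> < amplitude (f x) ^ 3"
  shows "smooth_on S (\<lambda>x. middle_root (f x) (g x))"
proof -
  have "amplitude (f x) ^ 3 \<noteq> 0" "\<bar>4 * g x / amplitude (f x) ^ 3\<bar> < 1" if "x \<in> S" for x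
    using amplitude(1)[OF assms(4)[OF that]] assms(5)[OF that] by (simp_all add: abs_mult)
  then show ?thesis
    unfolding middle_root_def by (intro smooth_intros assms) simp_all
qed

text \<open>In the coordinates \<open>(u, v)\<close> of the plane, the lines tangent to the deltoid with slope \<open>\<tau>\<close> pass
  through \<open>(u, v)\<close> iff \<open>\<tau>\<^sup>3 + 3 A \<tau>\<^sup>2 - B \<tau> + 3 A = 0\<close>, where \<open>A = v / (3 k)\<close>, \<open>B = 4 \<epsilon> / k - 1\<close> and
  \<open>k = \<epsilon> - u\<close>. The substitution \<open>x = \<tau> + A\<close> turns this cubic into \<open>x\<^sup>3 + t x - V\<close>.\<close>

definition cubic_A :: "real \<Rightarrow> real \<times> real \<Rightarrow> real"
  where "cubic_A \<epsilon> = (\<lambda>(u, v). v / (3 * (\<epsilon> - u)))"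

definition cubic_t :: "real \<Rightarrow> real \<times> real \<Rightarrow> real"
  where "cubic_t \<epsilon> = (\<lambda>(u, v). 1 - 4 * \<epsilon> / (\<epsilon> - u) - 3 * (cubic_A \<epsilon> (u, v))\<^sup>2)"

text \<open>Depressing the cubic leaves the constant 2 A^3 + A B + 3 A. Since B = - t - 3 A^2, this
  is the negative of the second component, V = A^3 - (3 - t) A. Hence A is recovered from (t, V) as
  a root of a cubic, and then k from 4 \<epsilon> / k = 1 - t - 3 A^2.\<close>

definition cubic_coeffs :: "real \<Rightarrow> real \<times> real \<Rightarrow> real \<times> real"
  where "cubic_coeffs \<epsilon> p =
    (cubic_t \<epsilon> p, cubic_A \<epsilon> p ^ 3 - (3 - cubic_t \<epsilon> p) * cubic_A \<epsilon> p)"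

definition cubic_k :: "real \<Rightarrow> real \<times> real \<Rightarrow> real"
  where "cubic_k \<epsilon> = (\<lambda>(t, V). 4 * \<epsilon> / (1 - t - 3 * (middle_root t V)\<^sup>2))"

definition cubic_inv :: "real \<Rightarrow> real \<times> real \<Rightarrow> real \<times> real"
  where "cubic_inv \<epsilon> = (\<lambda>(t, V). (\<epsilon> - cubic_k \<epsilon> (t, V), 3 * cubic_k \<epsilon> (t, V) * middle_root t V))"

text \<open>The last inequality says that the recovered k = \<epsilon> - u is positive.\<close>

definition cubic_range :: "(real \<times> real) set"
  where "cubic_range =
    {p \<in> {(t, V). t < 3 \<and> \<bar>4 * V\<bar> < amplitude t ^ 3}. 3 * (middle_root (fst p) (snd p))\<^sup>2 < 1 - fst p}"

lemma open_root_domain: "open {(t, V). t < 3 \<and> \<bar>4 * V\<bar> < amplitude t ^ 3}"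
proof -
  have "{(t, V). t < 3 \<and> \<bar>4 * V\<bar> < amplitude t ^ 3} =
      {p. fst p < 3} \<inter> {p. \<bar>4 * snd p\<bar> < amplitude (fst p) ^ 3}" by auto
  moreover have "open \<dots>"
    unfolding amplitude_def by (intro open_Int open_Collect_less continuous_intros) simp_all
  ultimately show ?thesis by simp
qed

lemma smooth_on_root_domain:
  "smooth_on {(t, V). t < 3 \<and> \<bar>4 * V\<bar> < amplitude t ^ 3} (\<lambda>p. middle_root (fst p) (snd p))"
  by (intro smooth_intros open_root_domain) auto

lemma open_cubic_range: "open cubic_range"
  unfolding cubic_range_def
  by (intro open_Collect_less_on open_root_domain continuous_intros
      smooth_on_continuous_on[OF smooth_on_root_domain])

text \<open>For u < \<epsilon> the number 4 \<epsilon> / k = 1 - t - 3 A^2 is positive. Therefore 3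
  A^2 < 3 - t, so A is the middle root and the trigonometric formula returns it.\<close>

lemma diffeo_cubic_coeffs:
  assumes \<epsilon>: "\<epsilon> > 0"
  shows "diffeo {p. fst p < \<epsilon>} cubic_range (cubic_coeffs \<epsilon>) (cubic_inv \<epsilon>)"
  unfolding diffeo_def
proof (intro conjI ballI)
  show o: "open {p :: real \<times> real. fst p < \<epsilon>}" by (intro open_Collect_less continuous_intros)
  show "open cubic_range" by (rule open_cubic_range)
  show "smooth_on {p. fst p < \<epsilon>} (cubic_coeffs \<epsilon>)"
    unfolding cubic_coeffs_def cubic_t_def cubic_A_def case_prod_unfold prod.sel
    by (intro smooth_intros o) auto
  have sm: "smooth_on cubic_range (\<lambda>p. middle_root (fst p) (snd p))"
    by (rule smooth_on_subset[OF smooth_on_root_domain]) (auto simp: cubic_range_def)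
  show "smooth_on cubic_range (cubic_inv \<epsilon>)"
    unfolding cubic_inv_def cubic_k_def case_prod_unfold prod.sel
    by (intro smooth_intros open_cubic_range sm) (auto simp: cubic_range_def)
next
  fix p :: "real \<times> real" assume "p \<in> {p. fst p < \<epsilon>}"
  then obtain u v where p: "p = (u, v)" and u: "u < \<epsilon>" by (cases p) auto
  define k A t where "k = \<epsilon> - u" and "A = v / (3 * k)" and "t = 1 - 4 * \<epsilon> / k - 3 * A\<^sup>2"
  have k: "k > 0" using u by (simp add: k_def)
  then have B: "4 * \<epsilon> / k > 0" using \<epsilon> by simp
  have co: "cubic_coeffs \<epsilon> p = (t, A ^ 3 - (3 - t) * A)"
    by (simp add: cubic_coeffs_def cubic_t_def cubic_A_def p k_def A_def t_def)
  have t: "t < 3" "3 * A\<^sup>2 < 3 - t" unfolding t_def using B zero_le_power2[of A] by linarith+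
  note r = middle_root_unique[OF t refl]
  show "cubic_coeffs \<epsilon> p \<in> cubic_range"
    unfolding co cubic_range_def using t r B by (simp add: t_def)
  have "cubic_k \<epsilon> (cubic_coeffs \<epsilon> p) = k"
    unfolding co cubic_k_def by (simp add: r(2)) (use k \<epsilon> in \<open>simp add: t_def\<close>)
  then have "cubic_inv \<epsilon> (cubic_coeffs \<epsilon> p) = (\<epsilon> - k, 3 * k * A)"
    unfolding cubic_inv_def co by (simp add: r(2))
  also have "\<dots> = p" using k by (simp add: p A_def) (simp add: k_def)
  finally show "cubic_inv \<epsilon> (cubic_coeffs \<epsilon> p) = p" .
next
  fix p assume p: "p \<in> cubic_range"
  obtain t V where tV: "p = (t, V)" by fastforce
  define A k where "A = middle_root t V" and "k = cubic_k \<epsilon> p"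
  have h: "t < 3" "\<bar>4 * V\<bar> < amplitude t ^ 3" "3 * A\<^sup>2 < 1 - t"
    using p by (auto simp: cubic_range_def tV A_def)
  have k: "k = 4 * \<epsilon> / (1 - t - 3 * A\<^sup>2)" "k > 0"
    using h(3) \<epsilon> by (simp_all add: k_def cubic_k_def tV A_def)
  have inv: "cubic_inv \<epsilon> p = (\<epsilon> - k, 3 * k * A)"
    by (simp add: cubic_inv_def k_def A_def tV)
  show "cubic_inv \<epsilon> p \<in> {p. fst p < \<epsilon>}" using k(2) by (simp add: inv)
  have "cubic_A \<epsilon> (cubic_inv \<epsilon> p) = A" using k(2) by (simp add: inv cubic_A_def)
  moreover from this have "cubic_t \<epsilon> (cubic_inv \<epsilon> p) = t"
    using k(2) \<epsilon> h(3) unfolding inv by (simp add: cubic_t_def k(1) field_simps)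
  ultimately show "cubic_coeffs \<epsilon> (cubic_inv \<epsilon> p) = p"
    using middle_root_cubic[OF h(1,2)] by (simp add: cubic_coeffs_def tV A_def)
qed

lemma cubic_inv_coeffs:
  assumes "\<epsilon> > 0" "fst p < \<epsilon>"
  shows "cubic_k \<epsilon> (cubic_coeffs \<epsilon> p) = \<epsilon> - fst p"
    "middle_root (fst (cubic_coeffs \<epsilon> p)) (snd (cubic_coeffs \<epsilon> p)) = cubic_A \<epsilon> p"
proof -
  obtain u v where p: "p = (u, v)" by fastforce
  have "cubic_inv \<epsilon> (cubic_coeffs \<epsilon> p) = p"
    using diffeo_cubic_coeffs[OF assms(1)] assms(2) unfolding diffeo_def by blast
  then have *: "\<epsilon> - cubic_k \<epsilon> (cubic_coeffs \<epsilon> p) = u"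
    and A: "3 * cubic_k \<epsilon> (cubic_coeffs \<epsilon> p) *
      middle_root (fst (cubic_coeffs \<epsilon> p)) (snd (cubic_coeffs \<epsilon> p)) = v"
    unfolding cubic_inv_def case_prod_unfold p by auto
  from * show k: "cubic_k \<epsilon> (cubic_coeffs \<epsilon> p) = \<epsilon> - fst p" by (simp add: p)
  show "middle_root (fst (cubic_coeffs \<epsilon> p)) (snd (cubic_coeffs \<epsilon> p)) = cubic_A \<epsilon> p"
    using A assms(2) unfolding k[unfolded p] cubic_A_def p by (simp add: field_simps)
qed

section \<open>Source coordinates in which the map is the cubic form\<close>

text \<open>If cis \<sigma> (R + i I) has real part u and \<tau> = tan \<sigma>, eliminating R gives
  the imaginary part \<tau> u + I / cos \<sigma>. Here I = 2 a b + \<epsilon> sin 3\<sigma>.\<close>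

definition slope_v :: "real \<Rightarrow> real \<times> real \<times> real \<times> real \<Rightarrow> real"
  where "slope_v \<epsilon> = (\<lambda>(u, \<tau>, a, b).
    \<tau> * u + (2 * a * b + \<epsilon> * sin (3 * arctan \<tau>)) / cos (arctan \<tau>))"

text \<open>Since C^2 (1 + \<tau>^2) = 1, multiplying v minus the slope value by 1 + \<tau>^2 clears
  the trigonometric functions and leaves k times the difference of the two sides of the cubic
  equation.\<close>

lemma slope_v_iff:
  fixes u \<tau> a b v \<epsilon> :: real
  defines "k \<equiv> \<epsilon> - u" and "C \<equiv> cos (arctan \<tau>)"
  assumes "u < \<epsilon>"
  shows "v = slope_v \<epsilon> (u, \<tau>, a, b) \<longleftrightarrow>
    \<tau> ^ 3 + 3 * (v / (3 * k)) * \<tau>\<^sup>2 + (1 - 4 * \<epsilon> / k) * \<tau> + 3 * (v / (3 * k)) = 2 * a * b / (k * C ^ 3)"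
proof -
  have k: "k > 0" using assms(3) by (simp add: k_def)
  have C: "C > 0" unfolding C_def by (simp add: cos_arctan_not_zero cos_arctan add_pos_nonneg)
  have sin: "sin (arctan \<tau>) = \<tau> * C" by (simp add: C_def sin_arctan cos_arctan)
  have C2: "C\<^sup>2 * (1 + \<tau>\<^sup>2) = 1"
    by (simp add: C_def cos_arctan power_divide) (metis add_eq_0_iff_both_eq_0 divide_self_if
        power_not_zero zero_neq_one add_nonneg_eq_0_iff zero_le_one zero_le_power2)
  have slope: "slope_v \<epsilon> (u, \<tau>, a, b) = \<tau> * u + 2 * a * b / C + \<epsilon> * (3 * \<tau> - 4 * \<tau> ^ 3 * C\<^sup>2)"
    using C unfolding slope_v_def prod.case sin_triple sin C_def[symmetric]
    by (simp add: field_simps power2_eq_square power3_eq_cube)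
  have "(v - slope_v \<epsilon> (u, \<tau>, a, b)) * (1 + \<tau>\<^sup>2) =
      (v - \<tau> * u) * (1 + \<tau>\<^sup>2) - 2 * a * b / C * (1 + \<tau>\<^sup>2)
        - \<epsilon> * (3 * \<tau> * (1 + \<tau>\<^sup>2) - 4 * \<tau> ^ 3 * (C\<^sup>2 * (1 + \<tau>\<^sup>2)))"
    unfolding slope by (simp add: algebra_simps)
  also have "2 * a * b / C * (1 + \<tau>\<^sup>2) = 2 * a * b / C ^ 3 * (C\<^sup>2 * (1 + \<tau>\<^sup>2))"
    using C by (simp add: power2_eq_square power3_eq_cube)
  also have "(v - \<tau> * u) * (1 + \<tau>\<^sup>2) - 2 * a * b / C ^ 3 * (C\<^sup>2 * (1 + \<tau>\<^sup>2))
        - \<epsilon> * (3 * \<tau> * (1 + \<tau>\<^sup>2) - 4 * \<tau> ^ 3 * (C\<^sup>2 * (1 + \<tau>\<^sup>2))) =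
      k * (\<tau> ^ 3 + 3 * (v / (3 * k)) * \<tau>\<^sup>2 + (1 - 4 * \<epsilon> / k) * \<tau> + 3 * (v / (3 * k))
        - 2 * a * b / (k * C ^ 3))"
    unfolding C2 using k by (simp add: field_simps) (simp add: k_def algebra_simps power2_eq_square power3_eq_cube)
  finally have eq: "(v - slope_v \<epsilon> (u, \<tau>, a, b)) * (1 + \<tau>\<^sup>2) =
      k * (\<tau> ^ 3 + 3 * (v / (3 * k)) * \<tau>\<^sup>2 + (1 - 4 * \<epsilon> / k) * \<tau> + 3 * (v / (3 * k))
        - 2 * a * b / (k * C ^ 3))" .
  have "1 + \<tau>\<^sup>2 \<noteq> 0" using C2 by auto
  then have "v = slope_v \<epsilon> (u, \<tau>, a, b) \<longleftrightarrow> (v - slope_v \<epsilon> (u, \<tau>, a, b)) * (1 + \<tau>\<^sup>2) = 0" by simp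
  then show ?thesis unfolding eq using k by simp
qed

definition cusp_form :: "real \<times> real \<times> real \<times> real \<Rightarrow> real \<times> real"
  where "cusp_form = (\<lambda>(t, x, y, z). (t, x ^ 3 + t * x + y\<^sup>2 - z\<^sup>2))"

text \<open>The factor l with 4 l^2 = 2 / (k cos^3 \<sigma>): it makes 2 a b / (k cos^3 \<sigma>)
  equal to z^2 - y^2 for y = l (a - b) and z = l (a + b).\<close>

definition pair_scale :: "real \<Rightarrow> real \<Rightarrow> real"
  where "pair_scale k \<tau> = 1 / sqrt (2 * k * cos (arctan \<tau>) ^ 3)"

definition slope_chart :: "real \<Rightarrow> real \<times> real \<times> real \<times> real \<Rightarrow> real \<times> real \<times> real \<times> real"
  where "slope_chart \<epsilon> = (\<lambda>(u, \<tau>, a, b).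
    (cubic_t \<epsilon> (u, slope_v \<epsilon> (u, \<tau>, a, b)), \<tau> + cubic_A \<epsilon> (u, slope_v \<epsilon> (u, \<tau>, a, b)),
     pair_scale (\<epsilon> - u) \<tau> * (a - b), pair_scale (\<epsilon> - u) \<tau> * (a + b)))"

text \<open>The normal form of (t, x, y, z) already gives the image point (t, V), hence k and A;
  only then are \<tau> = x - A and the pair (a, b) recovered.\<close>

definition slope_chart_inv :: "real \<Rightarrow> real \<times> real \<times> real \<times> real \<Rightarrow> real \<times> real \<times> real \<times> real"
  where "slope_chart_inv \<epsilon> = (\<lambda>(t, x, y, z).
    let p = cusp_form (t, x, y, z); \<tau> = x - middle_root (fst p) (snd p); l = pair_scale (cubic_k \<epsilon> p) \<tau>
    in (\<epsilon> - cubic_k \<epsilon> p, \<tau>, (z + y) / (2 * l), (z - y) / (2 * l)))"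

lemma pair_scale:
  assumes "k > 0"
  shows "pair_scale k \<tau> > 0" "(pair_scale k \<tau>)\<^sup>2 * (2 * k * cos (arctan \<tau>) ^ 3) = 1"
proof -
  have "cos (arctan \<tau>) > 0" by (simp add: cos_arctan add_pos_nonneg)
  then have "2 * k * cos (arctan \<tau>) ^ 3 > 0" using assms by simp
  then show "pair_scale k \<tau> > 0" "(pair_scale k \<tau>)\<^sup>2 * (2 * k * cos (arctan \<tau>) ^ 3) = 1"
    using assms by (simp_all add: pair_scale_def power_divide)
qed

lemma smooth_on_pair_scale [smooth_intros]:
  assumes "open S" "smooth_on S f" "smooth_on S g" "\<And>x. x \<in> S \<Longrightarrow> f x > 0"
  shows "smooth_on S (\<lambda>x. pair_scale (f x) (g x))"
proof -
  have "2 * f x * cos (arctan (g x)) ^ 3 > 0" if "x \<in> S" for x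
    using assms(4)[OF that] by (simp add: cos_arctan add_pos_nonneg)
  moreover from this have "sqrt (2 * f x * cos (arctan (g x)) ^ 3) \<noteq> 0" if "x \<in> S" for x
    using that by (metis less_irrefl real_sqrt_eq_0_iff)
  ultimately show ?thesis
    unfolding pair_scale_def by (intro smooth_intros assms)
qed

lemma slope_chart_cusp_form:
  assumes "u < \<epsilon>"
  shows "cusp_form (slope_chart \<epsilon> (u, \<tau>, a, b)) = cubic_coeffs \<epsilon> (u, slope_v \<epsilon> (u, \<tau>, a, b))"
proof -
  define v k C where "v = slope_v \<epsilon> (u, \<tau>, a, b)" and "k = \<epsilon> - u" and "C = cos (arctan \<tau>)"
  define A B l where "A = v / (3 * k)" and "B = 4 * \<epsilon> / k - 1" and "l = pair_scale k \<tau>"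
  have k: "k > 0" using assms by (simp add: k_def)
  have C: "C > 0" unfolding C_def by (simp add: cos_arctan add_pos_nonneg)
  have "\<tau> ^ 3 + 3 * A * \<tau>\<^sup>2 - B * \<tau> + 3 * A = 2 * a * b / (k * C ^ 3)"
    using slope_v_iff[OF assms, of v \<tau> a b] unfolding v_def[symmetric] k_def[symmetric] C_def[symmetric] A_def B_def
    by (simp add: algebra_simps)
  moreover have "(l * (a - b))\<^sup>2 - (l * (a + b))\<^sup>2 = - (2 * a * b / (k * C ^ 3))"
  proof -
    have "(l * (a - b))\<^sup>2 - (l * (a + b))\<^sup>2 = - 4 * a * b * l\<^sup>2"
      by (simp add: power2_eq_square algebra_simps)
    also have "l\<^sup>2 = 1 / (2 * k * C ^ 3)"
      using pair_scale(2)[OF k, of \<tau>] k C unfolding l_def[symmetric] C_def[symmetric]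
      by (simp add: field_simps)
    finally show ?thesis by simp
  qed
  ultimately have "(\<tau> + A) ^ 3 + (- B - 3 * A\<^sup>2) * (\<tau> + A) + (l * (a - b))\<^sup>2 - (l * (a + b))\<^sup>2 =
      A ^ 3 - (3 - (- B - 3 * A\<^sup>2)) * A"
    by (simp add: algebra_simps power2_eq_square power3_eq_cube)
  moreover have "cubic_A \<epsilon> (u, v) = A" "cubic_t \<epsilon> (u, v) = - B - 3 * A\<^sup>2"
    by (simp_all add: cubic_t_def cubic_A_def A_def k_def B_def)
  ultimately show ?thesis
    unfolding cusp_form_def cubic_coeffs_def slope_chart_def v_def[symmetric] prod.case
    by (simp add: l_def k_def)
qed

lemma smooth_on_cusp_form: "smooth_on UNIV cusp_form"
  unfolding cusp_form_def case_prod_unfold by (intro smooth_intros open_UNIV)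

text \<open>The image is the full preimage of \<open>cubic_range\<close>: for a point over (t, V),
  the recovered \<tau>, a, b satisfy the cubic with coefficients A and k. By
  \<open>slope_v_iff\<close> the value of the map there has second coordinate 3 k A, as
  required.\<close>

lemma diffeo_slope_chart:
  assumes \<epsilon>: "\<epsilon> > 0"
  shows "diffeo {p. fst p < \<epsilon>} (cusp_form -` cubic_range) (slope_chart \<epsilon>) (slope_chart_inv \<epsilon>)"
  unfolding diffeo_def
proof (intro conjI ballI)
  show o: "open {p :: real \<times> real \<times> real \<times> real. fst p < \<epsilon>}" by (intro open_Collect_less continuous_intros)
  show o': "open (cusp_form -` cubic_range)"
    by (intro open_vimage open_cubic_range smooth_on_continuous_on smooth_on_cusp_form)
  have cc: "cos (arctan t) \<noteq> 0" for t by (rule cos_arctan_not_zero)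
  show "smooth_on {p. fst p < \<epsilon>} (slope_chart \<epsilon>)"
    unfolding slope_chart_def slope_v_def cubic_t_def cubic_A_def case_prod_unfold prod.sel
    by (intro smooth_intros o) (auto simp: cc)
  have sm: "smooth_on (cusp_form -` cubic_range) cusp_form"
    by (rule smooth_on_subset[OF smooth_on_cusp_form]) simp
  have mr: "smooth_on (cusp_form -` cubic_range) (\<lambda>p. middle_root (fst (cusp_form p)) (snd (cusp_form p)))"
    by (intro smooth_intros o' sm) (auto simp: cubic_range_def case_prod_unfold)
  have pos: "1 - fst p - 3 * (middle_root (fst p) (snd p))\<^sup>2 > 0" if "p \<in> cubic_range" for p
    using that by (simp add: cubic_range_def)
  have kpos: "cubic_k \<epsilon> p > 0" if "p \<in> cubic_range" for p
    unfolding cubic_k_def case_prod_unfold using pos[OF that] \<epsilon> by simp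
  have k: "smooth_on (cusp_form -` cubic_range) (\<lambda>p. cubic_k \<epsilon> (cusp_form p))"
    unfolding cubic_k_def case_prod_unfold
    by (intro smooth_intros o' sm mr) (use pos in \<open>force+\<close>)
  have snds: "smooth_on (cusp_form -` cubic_range) (\<lambda>p :: real \<times> real \<times> real \<times> real. fst (snd p))"
    by (intro smooth_intros o')
  show "smooth_on (cusp_form -` cubic_range) (slope_chart_inv \<epsilon>)"
    unfolding slope_chart_inv_def Let_def case_prod_unfold prod.collapse
    by (intro smooth_intros o' mr k) (use kpos pair_scale(1) in \<open>auto simp: less_imp_neq[symmetric]\<close>)
next
  fix p :: "real \<times> real \<times> real \<times> real" assume "p \<in> {p. fst p < \<epsilon>}"
  then obtain u \<tau> a b where p: "p = (u, \<tau>, a, b)" and u: "u < \<epsilon>" by (cases p) auto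
  let ?v = "slope_v \<epsilon> (u, \<tau>, a, b)"
  have uv: "(u, ?v) \<in> {p. fst p < \<epsilon>}" using u by simp
  note D = diffeo_cubic_coeffs[OF \<epsilon>]
  have cf: "cusp_form (slope_chart \<epsilon> p) = cubic_coeffs \<epsilon> (u, ?v)"
    unfolding p by (rule slope_chart_cusp_form[OF u])
  then show "slope_chart \<epsilon> p \<in> cusp_form -` cubic_range"
    using D uv unfolding diffeo_def by simp
  have k: "cubic_k \<epsilon> (cubic_coeffs \<epsilon> (u, ?v)) = \<epsilon> - u"
    and A': "middle_root (fst (cubic_coeffs \<epsilon> (u, ?v))) (snd (cubic_coeffs \<epsilon> (u, ?v))) = cubic_A \<epsilon> (u, ?v)"
    using cubic_inv_coeffs[OF \<epsilon>, of "(u, ?v)"] u by simp_all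
  let ?l = "pair_scale (\<epsilon> - u) \<tau>"
  have l: "?l > 0" using u by (intro pair_scale) simp
  have "slope_chart_inv \<epsilon> (slope_chart \<epsilon> p) =
      (u, \<tau>, (?l * (a + b) + ?l * (a - b)) / (2 * ?l), (?l * (a + b) - ?l * (a - b)) / (2 * ?l))"
    unfolding slope_chart_inv_def Let_def case_prod_unfold prod.collapse cf k A'
    by (simp add: slope_chart_def p)
  also have "\<dots> = p" using l by (simp add: p field_simps)
  finally show "slope_chart_inv \<epsilon> (slope_chart \<epsilon> p) = p" .
next
  fix p assume p: "p \<in> cusp_form -` cubic_range"
  obtain t x y z where q: "p = (t, x, y, z)" by (metis prod.exhaust)
  define V where "V = x ^ 3 + t * x + y\<^sup>2 - z\<^sup>2"
  have cf: "cusp_form p = (t, V)" by (simp add: cusp_form_def q V_def)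
  define A k \<tau> l where "A = middle_root t V" and "k = cubic_k \<epsilon> (t, V)" and "\<tau> = x - A"
    and "l = pair_scale k \<tau>"
  define a b where "a = (z + y) / (2 * l)" and "b = (z - y) / (2 * l)"
  define C where "C = cos (arctan \<tau>)"
  have h: "t < 3" "\<bar>4 * V\<bar> < amplitude t ^ 3" "3 * A\<^sup>2 < 1 - t"
    using p cf by (auto simp: cubic_range_def A_def)
  have k: "k = 4 * \<epsilon> / (1 - t - 3 * A\<^sup>2)" "k > 0"
    using h(3) \<epsilon> by (simp_all add: k_def cubic_k_def A_def)
  have l: "l > 0" "l\<^sup>2 * (2 * k * C ^ 3) = 1"
    unfolding l_def C_def by (rule pair_scale[OF k(2)])+
  have C: "C > 0" unfolding C_def by (simp add: cos_arctan add_pos_nonneg)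
  have inv: "slope_chart_inv \<epsilon> p = (\<epsilon> - k, \<tau>, a, b)"
    unfolding slope_chart_inv_def Let_def case_prod_unfold prod.collapse cf
    by (simp add: q A_def k_def \<tau>_def l_def a_def b_def)
  show "slope_chart_inv \<epsilon> p \<in> {p. fst p < \<epsilon>}" using k(2) by (simp add: inv)
  have kk: "4 * \<epsilon> / k = 1 - t - 3 * A\<^sup>2" using k \<epsilon> h(3) by simp
  have cub: "V = A ^ 3 - (3 - t) * A" using middle_root_cubic[OF h(1,2)] by (simp add: A_def)
  have "2 * a * b / (k * C ^ 3) = 4 * l\<^sup>2 * a * b"
    using l(2) k(2) C by (simp add: field_simps)
  also have "\<dots> = z\<^sup>2 - y\<^sup>2"
    using l(1) by (simp add: a_def b_def power2_eq_square field_simps)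
  also have "\<dots> = x ^ 3 + t * x - V" by (simp add: V_def)
  also have "\<dots> = \<tau> ^ 3 + 3 * A * \<tau>\<^sup>2 + (1 - 4 * \<epsilon> / k) * \<tau> + 3 * A"
    unfolding kk cub \<tau>_def by (simp add: algebra_simps power2_eq_square power3_eq_cube)
  finally have "3 * k * A = slope_v \<epsilon> (\<epsilon> - k, \<tau>, a, b)"
    using slope_v_iff[of "\<epsilon> - k" \<epsilon> "3 * k * A" \<tau> a b] k(2) by (simp add: C_def)
  then have "slope_chart \<epsilon> (\<epsilon> - k, \<tau>, a, b) =
      (cubic_t \<epsilon> (\<epsilon> - k, 3 * k * A), \<tau> + cubic_A \<epsilon> (\<epsilon> - k, 3 * k * A), l * (a - b), l * (a + b))"
    by (simp add: slope_chart_def l_def)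
  also have "cubic_A \<epsilon> (\<epsilon> - k, 3 * k * A) = A" using k(2) by (simp add: cubic_A_def)
  also have "cubic_t \<epsilon> (\<epsilon> - k, 3 * k * A) = t"
    using k(2) by (simp add: cubic_t_def cubic_A_def kk)
  also have "l * (a - b) = y" using l(1) by (simp add: a_def b_def field_simps)
  also have "l * (a + b) = z" using l(1) by (simp add: a_def b_def field_simps)
  finally show "slope_chart \<epsilon> (slope_chart_inv \<epsilon> p) = p" unfolding inv by (simp add: q \<tau>_def)
qed

section \<open>Coordinates on a strip of the cover\<close>

lemma F_map_cover:
  "F_map \<epsilon> (cover q) = of_real (fst (fst q)) * cis (pi * snd (fst q)) + (snd q)\<^sup>2
    + of_real \<epsilon> * cis (4 * pi * snd (fst q))"
  using F_map_class[of \<epsilon> "fst (fst q)" "snd (fst q)" "snd q"] by (simp add: cover_def case_prod_unfold)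

lemma smooth_on_F_map_cover [smooth_intros]:
  "open S \<Longrightarrow> smooth_on S f \<Longrightarrow> smooth_on S (\<lambda>x. F_map \<epsilon> (cover (f x)))"
  unfolding F_map_cover by (intro smooth_intros)

definition strip :: "real \<Rightarrow> ((real \<times> real) \<times> complex) set"
  where "strip s0 = (UNIV \<times> {s0 - 1/2<..<s0 + 1/2}) \<times> UNIV"

text \<open>The real part of the rotated value replaces the coordinate r, in which it is affine with
  slope cos (pi (s - s0)), positive on the strip. The coordinate z is turned by half the angle so
  that its square turns with r.\<close>

definition angle_chart :: "real \<Rightarrow> real \<Rightarrow> (real \<times> real) \<times> complex \<Rightarrow> real \<times> real \<times> real \<times> real"
  where "angle_chart \<epsilon> s0 = (\<lambda>q. let w = snd q * cis (- (pi * snd (fst q) / 2)) in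
    (Re (cis (- (pi * s0)) * F_map \<epsilon> (cover q)), tan (pi * (snd (fst q) - s0)), Re w, Im w))"

definition angle_chart_inv :: "real \<Rightarrow> real \<Rightarrow> real \<times> real \<times> real \<times> real \<Rightarrow> (real \<times> real) \<times> complex"
  where "angle_chart_inv \<epsilon> s0 = (\<lambda>(u, \<tau>, a, b).
    let s = s0 + arctan \<tau> / pi; z = Complex a b * cis (pi * s / 2)
    in (((u - Re (cis (- (pi * s0)) * (z\<^sup>2 + of_real \<epsilon> * cis (4 * pi * s)))) / cos (arctan \<tau>), s), z))"

lemma strip_angle:
  assumes "((r, s), z) \<in> strip s0"
  shows "\<bar>pi * (s - s0)\<bar> < pi / 2" "cos (pi * (s - s0)) > 0" "arctan (tan (pi * (s - s0))) = pi * (s - s0)"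
proof -
  have "s0 - 1 / 2 < s" "s < s0 + 1 / 2" using assms by (auto simp: strip_def)
  then have "\<bar>s - s0\<bar> < 1 / 2" unfolding abs_less_iff by linarith
  then have "pi * \<bar>s - s0\<bar> < pi * (1 / 2)" by (intro mult_strict_left_mono) auto
  then show 1: "\<bar>pi * (s - s0)\<bar> < pi / 2" by (simp add: abs_mult)
  then have 2: "- (pi / 2) < pi * (s - s0)" "pi * (s - s0) < pi / 2" by linarith+
  show "cos (pi * (s - s0)) > 0" using 2 by (intro cos_gt_zero_pi) auto
  show "arctan (tan (pi * (s - s0))) = pi * (s - s0)" using 2 by (intro arctan_tan) auto
qed

lemma diffeo_angle_chart: "diffeo (strip s0) UNIV (angle_chart \<epsilon> s0) (angle_chart_inv \<epsilon> s0)"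
  unfolding diffeo_def
proof (intro conjI ballI)
  show o: "open (strip s0)" unfolding strip_def by (intro open_Times) auto
  have "cos (pi * (snd (fst q) - s0)) \<noteq> 0" if "q \<in> strip s0" for q
    using strip_angle(2)[of "fst (fst q)" "snd (fst q)" "snd q" s0] that by simp
  then show "smooth_on (strip s0) (angle_chart \<epsilon> s0)"
    unfolding angle_chart_def Let_def by (intro smooth_intros o) auto
  show "smooth_on UNIV (angle_chart_inv \<epsilon> s0)"
    unfolding angle_chart_inv_def Let_def case_prod_unfold prod.sel
    by (intro smooth_intros open_UNIV) (auto simp: cos_arctan_not_zero)
next
  fix q assume "q \<in> strip s0"
  then obtain r s z where q: "q = ((r, s), z)" "((r, s), z) \<in> strip s0" by (metis prod.exhaust)
  note st = strip_angle[OF q(2)]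
  let ?w = "z * cis (- (pi * s / 2))"
  have z: "Complex (Re ?w) (Im ?w) * cis (pi * s / 2) = z"
    unfolding complex_surj by (simp add: mult.assoc cis_mult)
  have s: "s0 + pi * (s - s0) / pi = s" by simp
  have "Re (cis (- (pi * s0)) * F_map \<epsilon> (cover ((r, s), z))) -
      Re (cis (- (pi * s0)) * (z\<^sup>2 + of_real \<epsilon> * cis (4 * pi * s))) = r * cos (pi * (s - s0))"
    unfolding F_map_cover by (simp add: algebra_simps cos_diff)
  then show "angle_chart_inv \<epsilon> s0 (angle_chart \<epsilon> s0 q) = q"
    unfolding angle_chart_inv_def angle_chart_def Let_def q(1) prod.case prod.sel st(3) s z
    using st(2) by simp
next
  fix p :: "real \<times> real \<times> real \<times> real"
  obtain u \<tau> a b where p: "p = (u, \<tau>, a, b)" by (metis prod.exhaust)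
  define s where "s = s0 + arctan \<tau> / pi"
  define z where "z = Complex a b * cis (pi * s / 2)"
  define r where "r = (u - Re (cis (- (pi * s0)) * (z\<^sup>2 + of_real \<epsilon> * cis (4 * pi * s)))) / cos (arctan \<tau>)"
  have inv: "angle_chart_inv \<epsilon> s0 p = ((r, s), z)"
    by (simp add: angle_chart_inv_def Let_def p r_def s_def z_def)
  have "arctan \<tau> / pi < 1 / 2" "- (1 / 2) < arctan \<tau> / pi"
    using arctan_ubound[of \<tau>] arctan_lbound[of \<tau>] by (simp_all add: field_simps)
  then show "angle_chart_inv \<epsilon> s0 p \<in> strip s0" by (simp add: inv strip_def s_def)
  have sig: "pi * (s - s0) = arctan \<tau>" by (simp add: s_def)
  have w: "z * cis (- (pi * s / 2)) = Complex a b" by (simp add: z_def mult.assoc cis_mult)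
  have "Re (cis (- (pi * s0)) * F_map \<epsilon> (cover ((r, s), z))) = r * cos (pi * (s - s0)) +
      Re (cis (- (pi * s0)) * (z\<^sup>2 + of_real \<epsilon> * cis (4 * pi * s)))"
    unfolding F_map_cover by (simp add: algebra_simps cos_diff)
  also have "\<dots> = u" unfolding sig r_def by (simp add: cos_arctan_not_zero)
  finally show "angle_chart \<epsilon> s0 (angle_chart_inv \<epsilon> s0 p) = p"
    unfolding inv angle_chart_def Let_def prod.sel w sig by (simp add: p tan_arctan)
qed simp_all

text \<open>The hypothesis on \<open>s0\<close> turns the phase 3 pi s into 3\<sigma>. The rotated
  value becomes cis \<sigma> times r + w^2 + \<epsilon> cis 3\<sigma>, whose second factor has
  imaginary part 2 a b + \<epsilon> sin 3\<sigma>.\<close>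

lemma angle_chart_slope:
  assumes s0: "cis (3 * pi * s0) = 1" and q: "q \<in> strip s0"
  shows "Im (cis (- (pi * s0)) * F_map \<epsilon> (cover q)) = slope_v \<epsilon> (angle_chart \<epsilon> s0 q)"
proof -
  obtain r s z where q1: "q = ((r, s), z)" by (metis prod.exhaust)
  note st = strip_angle[OF q[unfolded q1]]
  define w where "w = z * cis (- (pi * s / 2))"
  define \<sigma> where "\<sigma> = pi * (s - s0)"
  define H where "H = of_real r + w\<^sup>2 + of_real \<epsilon> * cis (3 * \<sigma>)"
  have "cis (3 * \<sigma>) = cis (3 * pi * s)"
  proof -
    have "cis (3 * pi * s) = cis (3 * \<sigma>) * cis (3 * pi * s0)"
      unfolding cis_mult by (simp add: \<sigma>_def algebra_simps)
    then show ?thesis using s0 by simp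
  qed
  moreover have "cis (4 * pi * s) = cis (3 * pi * s) * cis (pi * s)" by (simp add: cis_mult algebra_simps)
  moreover have "z\<^sup>2 = w\<^sup>2 * cis (pi * s)"
    unfolding w_def power_mult_distrib by (simp add: mult.assoc power2_eq_square cis_mult)
  moreover have "cis (- (pi * s0)) * cis (pi * s) = cis \<sigma>" by (simp add: cis_mult \<sigma>_def algebra_simps)
  ultimately have G: "cis (- (pi * s0)) * F_map \<epsilon> (cover q) = cis \<sigma> * H"
    unfolding F_map_cover q1 prod.sel H_def by (simp add: algebra_simps) (simp flip: mult.assoc)
  have a: "angle_chart \<epsilon> s0 q = (Re (cis \<sigma> * H), tan \<sigma>, Re w, Im w)"
    unfolding angle_chart_def Let_def G by (simp add: q1 w_def \<sigma>_def)
  have H: "2 * Re w * Im w + \<epsilon> * sin (3 * \<sigma>) = Im H" by (simp add: H_def power2_eq_square)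
  have c: "cos \<sigma> > 0" and at: "arctan (tan \<sigma>) = \<sigma>" using st by (simp_all add: \<sigma>_def)
  have "tan \<sigma> * Re (cis \<sigma> * H) + Im H / cos \<sigma> = Re H * sin \<sigma> + Im H * ((1 - sin \<sigma> * sin \<sigma>) / cos \<sigma>)"
    using c by (simp add: tan_def field_simps)
  also have "1 - sin \<sigma> * sin \<sigma> = cos \<sigma> * cos \<sigma>"
    using sin_cos_squared_add[of \<sigma>] by (simp add: power2_eq_square)
  finally show ?thesis
    unfolding a slope_v_def prod.case at H G using c by (simp add: algebra_simps)
qed

section \<open>Charts around a cusp\<close>

definition plane_chart :: "real \<Rightarrow> real \<Rightarrow> complex \<Rightarrow> real \<times> real"
  where "plane_chart \<epsilon> s0 w =
    cubic_coeffs \<epsilon> (Re (cis (- (pi * s0)) * w), Im (cis (- (pi * s0)) * w))"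

definition half_plane :: "real \<Rightarrow> real \<Rightarrow> complex set"
  where "half_plane \<epsilon> s0 = {w. Re (cis (- (pi * s0)) * w) < \<epsilon>}"

definition cusp_chart :: "real \<Rightarrow> real \<Rightarrow> (real \<times> real) \<times> complex \<Rightarrow> real \<times> real \<times> real \<times> real"
  where "cusp_chart \<epsilon> s0 q = slope_chart \<epsilon> (angle_chart \<epsilon> s0 q)"

definition cusp_domain :: "real \<Rightarrow> real \<Rightarrow> ((real \<times> real) \<times> complex) set"
  where "cusp_domain \<epsilon> s0 = {q \<in> strip s0. F_map \<epsilon> (cover q) \<in> half_plane \<epsilon> s0}"

lemma diffeo_plane_chart:
  assumes "\<epsilon> > 0"
  obtains \<psi>' where "diffeo (half_plane \<epsilon> s0) cubic_range (plane_chart \<epsilon> s0) \<psi>'"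
proof -
  let ?f = "\<lambda>w. (Re (cis (- (pi * s0)) * w), Im (cis (- (pi * s0)) * w))"
  have "diffeo UNIV UNIV ?f (\<lambda>p. cis (pi * s0) * Complex (fst p) (snd p))"
    unfolding diffeo_def
  proof (intro conjI ballI)
    show "smooth_on UNIV ?f" by (intro smooth_intros open_UNIV)
    show "smooth_on UNIV (\<lambda>p. cis (pi * s0) * Complex (fst p) (snd p))" by (intro smooth_intros open_UNIV)
    show "cis (pi * s0) * Complex (fst (?f w)) (snd (?f w)) = w" for w
      unfolding prod.sel complex_surj mult.assoc[symmetric] cis_mult by simp
    show "?f (cis (pi * s0) * Complex (fst p) (snd p)) = p" for p
      unfolding mult.assoc[symmetric] cis_mult by simp
  qed simp_all
  from diffeo_restrict[OF this, of "{p. fst p < \<epsilon>}"]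
  have "diffeo (half_plane \<epsilon> s0) {p. fst p < \<epsilon>} ?f (\<lambda>p. cis (pi * s0) * Complex (fst p) (snd p))"
    by (simp add: half_plane_def open_Collect_less continuous_intros)
  from diffeo_compose[OF this diffeo_cubic_coeffs[OF assms]] that show thesis
    unfolding plane_chart_def by blast
qed

lemma diffeo_cusp_chart:
  assumes "\<epsilon> > 0"
  obtains \<Psi> where "diffeo (cusp_domain \<epsilon> s0) (cusp_form -` cubic_range) (cusp_chart \<epsilon> s0) \<Psi>"
proof -
  have "open {p :: real \<times> real \<times> real \<times> real. fst p < \<epsilon>}" by (intro open_Collect_less continuous_intros)
  from diffeo_restrict[OF diffeo_angle_chart this]
  have "diffeo (cusp_domain \<epsilon> s0) {p. fst p < \<epsilon>} (angle_chart \<epsilon> s0) (angle_chart_inv \<epsilon> s0)"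
    by (simp add: cusp_domain_def half_plane_def angle_chart_def Let_def)
  from diffeo_compose[OF this diffeo_slope_chart[OF assms]] that show thesis
    unfolding cusp_chart_def by blast
qed

lemma plane_chart_cusp_chart:
  assumes "cis (3 * pi * s0) = 1" "q \<in> cusp_domain \<epsilon> s0"
  shows "plane_chart \<epsilon> s0 (F_map \<epsilon> (cover q)) = cusp_form (cusp_chart \<epsilon> s0 q)"
proof -
  obtain u \<tau> a b where a: "angle_chart \<epsilon> s0 q = (u, \<tau>, a, b)" by (metis prod.exhaust)
  then have u: "Re (cis (- (pi * s0)) * F_map \<epsilon> (cover q)) = u"
    by (simp add: angle_chart_def Let_def)
  have "u < \<epsilon>" using assms(2) u by (simp add: cusp_domain_def half_plane_def)
  moreover have "Im (cis (- (pi * s0)) * F_map \<epsilon> (cover q)) = slope_v \<epsilon> (u, \<tau>, a, b)"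
    using angle_chart_slope[OF assms(1), of q \<epsilon>] assms(2) by (simp add: cusp_domain_def a)
  ultimately show ?thesis
    unfolding plane_chart_def cusp_chart_def a u using slope_chart_cusp_form by simp
qed

text \<open>Further coordinate changes \<open>h\<close> and \<open>k\<close> may be applied to the
  cusp form: identities at the cusp, the completion of the square at a fold.\<close>

lemma has_local_form_cusp_domain:
  assumes "\<epsilon> > 0" "cis (3 * pi * s0) = 1" "q \<in> cusp_domain \<epsilon> s0"
    and "diffeo S T h h'" "cusp_chart \<epsilon> s0 q \<in> S" "h (cusp_chart \<epsilon> s0 q) = 0"
    and "diffeo V W k k'" "\<And>y. y \<in> S \<Longrightarrow> cusp_form y \<in> V"
    and "\<And>y. y \<in> S \<Longrightarrow> k (cusp_form y) = g (h y)" "g 0 = 0"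
  shows "has_local_form moebius_C_atlas (F_map \<epsilon>) (cover q) g"
proof -
  let ?D = "cusp_domain \<epsilon> s0" let ?\<Phi> = "cusp_chart \<epsilon> s0" let ?\<psi> = "plane_chart \<epsilon> s0"
  obtain \<Psi> where 1: "diffeo ?D (cusp_form -` cubic_range) ?\<Phi> \<Psi>" using diffeo_cusp_chart[OF assms(1)] by blast
  obtain \<psi>' where 2: "diffeo (half_plane \<epsilon> s0) cubic_range ?\<psi> \<psi>'"
    using diffeo_plane_chart[OF assms(1)] by blast
  have o: "open S" "open V" "open cubic_range" "open (cusp_form -` cubic_range)"
    using assms(4,7) 1 2 by (auto simp: diffeo_def)
  have 3: "diffeo {x \<in> ?D. ?\<Phi> x \<in> S} {y \<in> T. h' y \<in> cusp_form -` cubic_range} (\<lambda>x. h (?\<Phi> x)) (\<lambda>y. \<Psi> (h' y))"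
    using diffeo_compose[OF diffeo_restrict[OF 1 o(1)]]
      diffeo_restrict_source[OF assms(4) o(4)] by (simp add: Int_commute)
  have 4: "diffeo {w \<in> half_plane \<epsilon> s0. ?\<psi> w \<in> V} {y \<in> W. k' y \<in> cubic_range} (\<lambda>w. k (?\<psi> w)) (\<lambda>y. \<psi>' (k' y))"
    using diffeo_compose[OF diffeo_restrict[OF 2 o(2)]]
      diffeo_restrict_source[OF assms(7) o(3)] by (simp add: Int_commute)
  have eq: "?\<psi> (F_map \<epsilon> (cover x)) = cusp_form (?\<Phi> x)" if "x \<in> ?D" for x
    using plane_chart_cusp_chart[OF assms(2) that] .
  show ?thesis
  proof (rule has_local_formI[OF 3 _ _ _ 4])
    show "inj_on cover {x \<in> ?D. ?\<Phi> x \<in> S}"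
      by (rule inj_on_subset[OF inj_on_cover_strip[of s0]]) (auto simp: cusp_domain_def strip_def)
    show "F_map \<epsilon> (cover x) \<in> {w \<in> half_plane \<epsilon> s0. ?\<psi> w \<in> V}" if "x \<in> {x \<in> ?D. ?\<Phi> x \<in> S}" for x
      using that eq[of x] assms(8) by (auto simp: cusp_domain_def)
    show "k (?\<psi> (F_map \<epsilon> (cover q))) = 0"
      using eq[OF assms(3)] assms(5,6,9,10) by simp
  qed (use assms eq in auto)
qed

section \<open>Completing the square at a fold point\<close>

text \<open>On (-1, 2), the increasing square root of y^3 - 3 y + 2, the height of the cubic above
  its local minimum at y = 1: an explicit Morse coordinate.\<close>

definition chebyshev :: "real \<Rightarrow> real" where "chebyshev y = (y - 1) * sqrt (y + 2)"

text \<open>With \<theta> = 2/3 arccos (X / 2), the arccosine being written through the arcsine,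
  whose smoothness is established.\<close>

definition chebyshev_inv :: "real \<Rightarrow> real"
  where "chebyshev_inv X = 2 * cos (2 / 3 * (pi / 2 - arcsin (X / 2)))"

text \<open>The substitution \<open>y = 2 cos \<theta>\<close> gives \<open>(y - 1) \<surd>(y + 2) = 2 cos (3 \<theta> / 2)\<close>.\<close>

lemma chebyshev_cos:
  assumes "0 < \<theta>" "\<theta> < 2 * pi / 3"
  shows "chebyshev (2 * cos \<theta>) = 2 * cos (3 / 2 * \<theta>)"
proof -
  define p where "p = \<theta> / 2"
  have "cos p > 0" using assms by (intro cos_gt_zero_pi) (auto simp: p_def)
  have t: "\<theta> = 2 * p" by (simp add: p_def)
  have "2 * cos \<theta> + 2 = (2 * cos p)\<^sup>2" unfolding t cos_double_cos by (simp add: power2_eq_square)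
  then have "sqrt (2 * cos \<theta> + 2) = 2 * cos p" using \<open>cos p > 0\<close> by (intro real_sqrt_unique) auto
  then have "chebyshev (2 * cos \<theta>) = (2 * cos \<theta> - 1) * (2 * cos p)" by (simp add: chebyshev_def)
  also have "\<dots> = 2 * cos (3 * p)"
    unfolding t cos_double_cos cos_triple by (simp add: algebra_simps power2_eq_square power3_eq_cube)
  finally show ?thesis by (simp add: p_def)
qed

text \<open>The interval (-1, 2) for y corresponds to 0 < \<theta> < 2 pi / 3, so 3\<theta>/2 runs
  through (0, pi), where the cosine is injective.\<close>

lemma diffeo_chebyshev: "diffeo {-1<..<2} {-2<..<2} chebyshev chebyshev_inv"
  unfolding diffeo_def
proof (intro conjI ballI)
  show "smooth_on {-1<..<2} chebyshev"
    unfolding chebyshev_def by (intro smooth_intros open_greaterThanLessThan) auto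
  show "smooth_on {-2<..<2} chebyshev_inv"
    unfolding chebyshev_inv_def by (intro smooth_intros open_greaterThanLessThan) auto
next
  fix y :: real assume y: "y \<in> {-1<..<2}"
  define \<theta> where "\<theta> = arccos (y / 2)"
  have yt: "y = 2 * cos \<theta>" using y by (simp add: \<theta>_def)
  have "\<theta> < arccos (- (1 / 2))" unfolding \<theta>_def by (rule arccos_less_arccos) (use y in auto)
  also have "arccos (- (1 / 2)) = 2 * pi / 3"
    using arccos_cos[of "2 * pi / 3"] by (simp add: cos_120)
  finally have \<theta>: "\<theta> < 2 * pi / 3" .
  have \<theta>0: "0 < \<theta>" using y by (simp add: \<theta>_def arccos_lt_bounded)
  have eq: "chebyshev y = 2 * cos (3 / 2 * \<theta>)" unfolding yt by (rule chebyshev_cos[OF \<theta>0 \<theta>])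
  have "cos pi < cos (3 / 2 * \<theta>)" "cos (3 / 2 * \<theta>) < cos 0"
    using \<theta> \<theta>0 by (intro cos_monotone_0_pi; simp)+
  then show "chebyshev y \<in> {-2<..<2}" unfolding eq by simp
  have "cos (3 / 2 * \<theta>) = sin (pi / 2 - 3 / 2 * \<theta>)" by (simp add: cos_sin_eq)
  moreover have "arcsin (sin (pi / 2 - 3 / 2 * \<theta>)) = pi / 2 - 3 / 2 * \<theta>"
    by (rule arcsin_sin) (use \<theta> \<theta>0 in auto)
  ultimately have "arcsin (cos (3 / 2 * \<theta>)) = pi / 2 - 3 / 2 * \<theta>" by simp
  then show "chebyshev_inv (chebyshev y) = y" unfolding eq chebyshev_inv_def by (simp add: yt)
next
  fix X :: real assume X: "X \<in> {-2<..<2}"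
  define \<theta> where "\<theta> = 2 / 3 * (pi / 2 - arcsin (X / 2))"
  have "- (pi / 2) < arcsin (X / 2)" "arcsin (X / 2) < pi / 2"
    using arcsin_lt_bounded[of "X / 2"] X by auto
  then have \<theta>: "0 < \<theta>" "\<theta> < 2 * pi / 3" unfolding \<theta>_def by (simp_all add: field_simps)
  have inv: "chebyshev_inv X = 2 * cos \<theta>" by (simp add: chebyshev_inv_def \<theta>_def)
  have "cos (2 * pi / 3) < cos \<theta>" "cos \<theta> < cos 0"
    using \<theta> by (intro cos_monotone_0_pi; simp)+
  then show "chebyshev_inv X \<in> {-1<..<2}" unfolding inv by (simp add: cos_120)
  have "3 / 2 * \<theta> = pi / 2 - arcsin (X / 2)" by (simp add: \<theta>_def)
  then have "cos (3 / 2 * \<theta>) = cos (pi / 2 - arcsin (X / 2))" by (rule arg_cong)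
  also have "\<dots> = X / 2" using X by (simp add: cos_diff)
  finally show "chebyshev (chebyshev_inv X) = X"
    unfolding inv chebyshev_cos[OF \<theta>] by simp
qed auto

text \<open>With \<open>t = - 3 M\<^sup>2\<close> and \<open>x = \<delta> M y\<close>, \<open>\<delta> = \<plusminus> 1\<close>, the identity
  \<open>y\<^sup>3 - 3 y + 2 = (y - 1)\<^sup>2 (y + 2)\<close> completes the square in \<open>x\<^sup>3 + t x\<close>.\<close>

definition fold_chart :: "real \<Rightarrow> real \<Rightarrow> real \<times> real \<times> real \<times> real \<Rightarrow> real \<times> real \<times> real \<times> real"
  where "fold_chart \<delta> t0 = (\<lambda>(t, x, y, z).
    let M = sqrt (- t / 3) in (t - t0, M * sqrt M * chebyshev (\<delta> * x / M), y, z))"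

definition fold_chart_inv :: "real \<Rightarrow> real \<Rightarrow> real \<times> real \<times> real \<times> real \<Rightarrow> real \<times> real \<times> real \<times> real"
  where "fold_chart_inv \<delta> t0 = (\<lambda>(t, x, y, z).
    let M = sqrt (- (t + t0) / 3) in (t + t0, \<delta> * M * chebyshev_inv (x / (M * sqrt M)), y, z))"

definition fold_domain :: "real \<Rightarrow> (real \<times> real \<times> real \<times> real) set"
  where "fold_domain \<delta> = {(t, x, y, z). t < 0 \<and> \<delta> * x / sqrt (- t / 3) \<in> {-1<..<2}}"

definition fold_range :: "real \<Rightarrow> (real \<times> real \<times> real \<times> real) set"
  where "fold_range t0 = {(t, x, y, z). t + t0 < 0 \<and>
    x / (sqrt (- (t + t0) / 3) * sqrt (sqrt (- (t + t0) / 3))) \<in> {-2<..<2}}"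

lemma diffeo_fold_chart:
  assumes \<delta>: "\<delta> * \<delta> = 1"
  shows "diffeo (fold_domain \<delta>) (fold_range t0) (fold_chart \<delta> t0) (fold_chart_inv \<delta> t0)"
  unfolding diffeo_def
proof (intro conjI ballI)
  have "open {p :: real \<times> real \<times> real \<times> real. fst p < 0}" (is "open ?S")
    by (intro open_Collect_less continuous_intros)
  then have "open ((\<lambda>p. \<delta> * fst (snd p) / sqrt (- fst p / 3)) -` {-1<..<2} \<inter> ?S)"
    by (intro open_vimage_on) (auto intro!: continuous_intros)
  moreover have "(\<lambda>p. \<delta> * fst (snd p) / sqrt (- fst p / 3)) -` {-1<..<2} \<inter> ?S = fold_domain \<delta>"
    by (auto simp: fold_domain_def)
  ultimately show o: "open (fold_domain \<delta>)" by simp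
  have "open {p :: real \<times> real \<times> real \<times> real. fst p + t0 < 0}" (is "open ?S")
    by (intro open_Collect_less continuous_intros)
  then have "open ((\<lambda>p. fst (snd p) / (sqrt (- (fst p + t0) / 3) * sqrt (sqrt (- (fst p + t0) / 3)))) -` {-2<..<2} \<inter> ?S)"
    by (intro open_vimage_on) (auto intro!: continuous_intros)
  moreover have "(\<lambda>p. fst (snd p) / (sqrt (- (fst p + t0) / 3) * sqrt (sqrt (- (fst p + t0) / 3)))) -` {-2<..<2} \<inter> ?S = fold_range t0"
    by (auto simp: fold_range_def)
  ultimately show o': "open (fold_range t0)" by simp
  have "smooth_on (fold_domain \<delta>) (\<lambda>p. chebyshev (\<delta> * fst (snd p) / sqrt (- fst p / 3)))"
  proof (rule smooth_on_compose[OF o, where g = chebyshev and T = "{-1<..<2}"])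
    show "smooth_on {-1<..<2} chebyshev" using diffeo_chebyshev by (simp add: diffeo_def)
    show "smooth_on (fold_domain \<delta>) (\<lambda>p. \<delta> * fst (snd p) / sqrt (- fst p / 3))"
      by (intro smooth_intros o) (auto simp: fold_domain_def)
  qed (auto simp: fold_domain_def)
  then show "smooth_on (fold_domain \<delta>) (fold_chart \<delta> t0)"
    unfolding fold_chart_def Let_def case_prod_unfold
    by (intro smooth_intros o) (auto simp: fold_domain_def)
  have "smooth_on (fold_range t0)
      (\<lambda>p. chebyshev_inv (fst (snd p) / (sqrt (- (fst p + t0) / 3) * sqrt (sqrt (- (fst p + t0) / 3)))))"
  proof (rule smooth_on_compose[OF o', where g = chebyshev_inv and T = "{-2<..<2}"])
    show "smooth_on {-2<..<2} chebyshev_inv" using diffeo_chebyshev by (simp add: diffeo_def)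
    show "smooth_on (fold_range t0)
        (\<lambda>p. fst (snd p) / (sqrt (- (fst p + t0) / 3) * sqrt (sqrt (- (fst p + t0) / 3))))"
      by (intro smooth_intros o') (auto simp: fold_range_def)
  qed (auto simp: fold_range_def)
  then show "smooth_on (fold_range t0) (fold_chart_inv \<delta> t0)"
    unfolding fold_chart_inv_def Let_def case_prod_unfold
    by (intro smooth_intros o') (auto simp: fold_range_def)
next
  fix p assume "p \<in> fold_domain \<delta>"
  then obtain t x y z where p: "p = (t, x, y, z)" "t < 0" "\<delta> * x / sqrt (- t / 3) \<in> {-1<..<2}"
    by (auto simp: fold_domain_def)
  define M where "M = sqrt (- t / 3)"
  have M: "M > 0" using p(2) by (simp add: M_def)
  have X: "M * sqrt M * chebyshev (\<delta> * x / M) / (M * sqrt M) = chebyshev (\<delta> * x / M)" using M by simp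
  have c: "chebyshev (\<delta> * x / M) \<in> {-2<..<2}" "chebyshev_inv (chebyshev (\<delta> * x / M)) = \<delta> * x / M"
    using diffeo_chebyshev p(3) unfolding diffeo_def M_def by blast+
  have fc: "fold_chart \<delta> t0 p = (t - t0, M * sqrt M * chebyshev (\<delta> * x / M), y, z)"
    by (simp add: fold_chart_def Let_def p(1) M_def)
  show "fold_chart \<delta> t0 p \<in> fold_range t0"
    unfolding fc fold_range_def using X c(1) p(2) by (simp add: M_def)
  have "fold_chart_inv \<delta> t0 (fold_chart \<delta> t0 p) = (t, \<delta> * M * (\<delta> * x / M), y, z)"
    unfolding fc fold_chart_inv_def Let_def prod.case diff_add_cancel M_def[symmetric] X c(2) ..
  also have "\<delta> * M * (\<delta> * x / M) = (\<delta> * \<delta>) * x" using M by simp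
  finally show "fold_chart_inv \<delta> t0 (fold_chart \<delta> t0 p) = p" by (simp add: \<delta> p(1))
next
  fix p assume "p \<in> fold_range t0"
  then obtain t x y z where p: "p = (t, x, y, z)" "t + t0 < 0"
    "x / (sqrt (- (t + t0) / 3) * sqrt (sqrt (- (t + t0) / 3))) \<in> {-2<..<2}"
    by (auto simp: fold_range_def)
  define M where "M = sqrt (- (t + t0) / 3)"
  have M: "M > 0" using p(2) by (simp add: M_def)
  let ?c = "chebyshev_inv (x / (M * sqrt M))"
  have c: "?c \<in> {-1<..<2}" "chebyshev ?c = x / (M * sqrt M)"
    using diffeo_chebyshev p(3) unfolding diffeo_def M_def by blast+
  have fc: "fold_chart_inv \<delta> t0 p = (t + t0, \<delta> * M * ?c, y, z)"
    by (simp add: fold_chart_inv_def Let_def p(1) M_def)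
  have "\<delta> * (\<delta> * M * ?c) / M = (\<delta> * \<delta>) * ?c" using M by simp
  then have X: "\<delta> * (\<delta> * M * ?c) / M = ?c" by (simp add: \<delta>)
  show "fold_chart_inv \<delta> t0 p \<in> fold_domain \<delta>"
    unfolding fc fold_domain_def mem_Collect_eq prod.case M_def[symmetric] X using c(1) p(2) by blast
  have "fold_chart \<delta> t0 (fold_chart_inv \<delta> t0 p) = (t, M * sqrt M * (x / (M * sqrt M)), y, z)"
    unfolding fc fold_chart_def Let_def prod.case M_def[symmetric] X c(2) by simp
  then show "fold_chart \<delta> t0 (fold_chart_inv \<delta> t0 p) = p" using M by (simp add: p(1))
qed

text \<open>The critical point x = \<delta> M of x^3 + t x has value - 2 \<delta> M^3. Above this
  value the cubic is \<delta> M^3 (Y - 1)^2 (Y + 2), and the factor \<open>M * sqrt M\<close> is the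
  square root of M^3.\<close>

lemma cusp_form_fold_chart:
  assumes \<delta>: "\<delta> * \<delta> = 1" and p: "(t, x, y, z) \<in> fold_domain \<delta>"
  shows "fst (cusp_form (t, x, y, z)) - t0 = fst (fold_chart \<delta> t0 (t, x, y, z))"
    "snd (cusp_form (t, x, y, z)) + 2 * \<delta> * sqrt (- t / 3) ^ 3 =
      \<delta> * (fst (snd (fold_chart \<delta> t0 (t, x, y, z))))\<^sup>2 + y\<^sup>2 - z\<^sup>2"
proof -
  define M Y where "M = sqrt (- t / 3)" and "Y = \<delta> * x / M"
  have t: "t < 0" and Y: "-1 < Y" using p by (auto simp: fold_domain_def Y_def M_def)
  have M: "M > 0" "t = - 3 * M\<^sup>2" using t by (simp_all add: M_def)
  have "\<delta> * M * Y = (\<delta> * \<delta>) * x" using M(1) by (simp add: Y_def)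
  then have x: "x = \<delta> * M * Y" by (simp add: \<delta>)
  have d3: "\<delta> ^ 3 = \<delta>" using \<delta> by (simp add: power3_eq_cube)
  have "(M * sqrt M * chebyshev Y)\<^sup>2 = M\<^sup>2 * (sqrt M)\<^sup>2 * ((Y - 1)\<^sup>2 * (sqrt (Y + 2))\<^sup>2)"
    by (simp add: chebyshev_def power_mult_distrib)
  also have "\<dots> = M ^ 3 * ((Y - 1)\<^sup>2 * (Y + 2))"
    using M(1) Y by (simp add: power3_eq_cube power2_eq_square)
  finally have sq: "(M * sqrt M * chebyshev Y)\<^sup>2 = M ^ 3 * ((Y - 1)\<^sup>2 * (Y + 2))" .
  have "x ^ 3 + t * x + 2 * \<delta> * M ^ 3 = \<delta> * (M ^ 3 * ((Y - 1)\<^sup>2 * (Y + 2)))"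
    unfolding x M(2) power_mult_distrib d3 by (simp add: algebra_simps power2_eq_square power3_eq_cube)
  then show "snd (cusp_form (t, x, y, z)) + 2 * \<delta> * sqrt (- t / 3) ^ 3 =
      \<delta> * (fst (snd (fold_chart \<delta> t0 (t, x, y, z))))\<^sup>2 + y\<^sup>2 - z\<^sup>2"
    unfolding cusp_form_def fold_chart_def Let_def prod.case M_def[symmetric] Y_def[symmetric] prod.sel sq
    by simp
qed (simp add: cusp_form_def fold_chart_def Let_def)

lemma is_cusp_cusp_domain:
  assumes "\<epsilon> > 0" "cis (3 * pi * s0) = 1" "q \<in> cusp_domain \<epsilon> s0" "cusp_chart \<epsilon> s0 q = 0"
  shows "is_cusp moebius_C_atlas (F_map \<epsilon>) (cover q)"
  unfolding is_cusp_def
proof (intro bexI)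
  show "has_local_form moebius_C_atlas (F_map \<epsilon>) (cover q)
      (\<lambda>(t, x, y, z). (t, x ^ 3 + t * x + 1 * y\<^sup>2 + - 1 * z\<^sup>2))"
    by (rule has_local_form_cusp_domain[OF assms(1-3) diffeo_id _ _ diffeo_id])
      (auto simp: assms(4) cusp_form_def zero_prod_def)
qed auto

text \<open>At the given point M = \<bar>x\<bar>, so the argument of \<open>chebyshev\<close> is 1,
  its zero. The target change \<open>?k\<close> adds 2 \<delta> M^3 and thereby straightens the
  branch (- 3 M^2, - 2 \<delta> M^3) of critical values.\<close>

lemma is_fold_cusp_domain:
  assumes "\<epsilon> > 0" "cis (3 * pi * s0) = 1" "q \<in> cusp_domain \<epsilon> s0"
    "cusp_chart \<epsilon> s0 q = (- 3 * x\<^sup>2, x, 0, 0)" "x \<noteq> 0"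
  shows "is_fold moebius_C_atlas (F_map \<epsilon>) (cover q)"
  unfolding is_fold_def
proof (intro bexI)
  define \<delta> t0 where "\<delta> = sgn x" and "t0 = - 3 * x\<^sup>2"
  have \<delta>: "\<delta> * \<delta> = 1" "\<delta> \<in> {-1, 1}" "\<delta> * x = \<bar>x\<bar>" using assms(5) by (auto simp: \<delta>_def sgn_real_def)
  have M: "sqrt (- t0 / 3) = \<bar>x\<bar>" by (simp add: t0_def)
  let ?k = "\<lambda>p. (fst p - t0, snd p + 2 * \<delta> * sqrt (- fst p / 3) ^ 3)"
  let ?k' = "\<lambda>p. (fst p + t0, snd p - 2 * \<delta> * sqrt (- (fst p + t0) / 3) ^ 3)"
  have k: "diffeo {p. fst p < 0} {p. fst p + t0 < 0} ?k ?k'"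
    unfolding diffeo_def
  proof (intro conjI ballI)
    show o: "open {p :: real \<times> real. fst p < 0}" by (intro open_Collect_less continuous_intros)
    show o': "open {p :: real \<times> real. fst p + t0 < 0}" by (intro open_Collect_less continuous_intros)
    show "smooth_on {p. fst p < 0} ?k" by (intro smooth_intros o) auto
    show "smooth_on {p. fst p + t0 < 0} ?k'" by (intro smooth_intros o') auto
  qed auto
  have c: "cusp_chart \<epsilon> s0 q = (t0, x, 0, 0)" using assms(4) by (simp add: t0_def)
  show "has_local_form moebius_C_atlas (F_map \<epsilon>) (cover q)
      (\<lambda>(t, x, y, z). (t, \<delta> * x\<^sup>2 + 1 * y\<^sup>2 + - 1 * z\<^sup>2))"
  proof (rule has_local_form_cusp_domain[OF assms(1-3) diffeo_fold_chart[OF \<delta>(1), of t0] _ _ k])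
    show "cusp_chart \<epsilon> s0 q \<in> fold_domain \<delta>"
      unfolding c fold_domain_def using assms(5) by (simp add: M \<delta>(3)) (simp add: t0_def)
    show "fold_chart \<delta> t0 (cusp_chart \<epsilon> s0 q) = 0"
      unfolding c fold_chart_def Let_def prod.case M \<delta>(3) using assms(5)
      by (simp add: chebyshev_def zero_prod_def)
    fix p assume p: "p \<in> fold_domain \<delta>"
    obtain t x y z where q: "p = (t, x, y, z)" by (metis prod.exhaust)
    show "cusp_form p \<in> {p. fst p < 0}" using p by (simp add: q cusp_form_def fold_domain_def)
    show "?k (cusp_form p) = (case fold_chart \<delta> t0 p of (t, x, y, z) \<Rightarrow> (t, \<delta> * x\<^sup>2 + 1 * y\<^sup>2 + - 1 * z\<^sup>2))"
      using cusp_form_fold_chart[OF \<delta>(1) p[unfolded q], of t0]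
      by (simp add: q) (simp add: cusp_form_def fold_chart_def Let_def)
  qed (simp add: zero_prod_def)
qed (auto simp: sgn_real_def assms(5))

section \<open>The critical set\<close>

definition crit :: "real \<Rightarrow> real \<Rightarrow> (real \<times> real) \<times> complex"
  where "crit \<epsilon> s = ((- 4 * \<epsilon> * cos (3 * pi * s), s), 0)"

lemma cis_3_pi_add_int: "cis (3 * pi * (s + of_int n)) = of_real ((-1) powi n) * cis (3 * pi * s)"
proof -
  have "3 * pi * (s + of_int n) = 3 * pi * s + (pi * of_int n + 2 * pi * of_int n)"
    by (simp add: algebra_simps)
  then have "cis (3 * pi * (s + of_int n)) = cis (3 * pi * s) * (cis (pi * of_int n) * cis (2 * pi * of_int n))"
    by (simp only: cis_mult)
  then show ?thesis by (simp add: cis_multiple_2pi cis_pi_of_int of_real_power_int)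
qed

text \<open>Both r and cos 3 pi s change sign under s -> s + 1, so the curve is invariant under the
  deck group.\<close>

lemma deck_crit: "deck n (crit \<epsilon> s) = crit \<epsilon> (s + of_int n)"
  using arg_cong[OF cis_3_pi_add_int[of s n], of Re]
  by (simp add: crit_def deck_apply del: of_real_power_int)

lemma cover_crit_add_int: "cover (crit \<epsilon> (s + of_int n)) = cover (crit \<epsilon> s)"
  by (metis cover_deck deck_crit)

section \<open>The derivative and its rank\<close>

definition F_derivative :: "real \<Rightarrow> (real \<times> real) \<times> complex \<Rightarrow> (real \<times> real) \<times> complex \<Rightarrow> complex"
  where "F_derivative \<epsilon> = (\<lambda>((r, s), z) ((dr, ds), dz).
    cis (pi * s) * (of_real dr + \<i> * of_real (pi * ds) * (of_real r + 4 * of_real \<epsilon> * cis (3 * pi * s)))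
      + 2 * z * dz)"

lemma F_map_cover_has_derivative:
  "((\<lambda>q. F_map \<epsilon> (cover q)) has_derivative F_derivative \<epsilon> q) (at q)"
proof -
  obtain r s z where q: "q = ((r, s), z)" by (metis prod.exhaust)
  have "cis (4 * pi * s) = cis (pi * s) * cis (3 * pi * s)" by (simp add: cis_mult algebra_simps)
  then show ?thesis
    unfolding F_map_cover
    by (auto intro!: derivative_eq_intros ext simp: q F_derivative_def scaleR_conv_of_real algebra_simps)
qed

lemma frechet_derivative_F_map_cover:
  "frechet_derivative (\<lambda>q. F_map \<epsilon> (cover q)) (at q) = F_derivative \<epsilon> q"
  using F_map_cover_has_derivative by (rule frechet_derivative_at[symmetric])

lemma F_derivative_crit:
  "F_derivative \<epsilon> (crit \<epsilon> s) ((dr, ds), dz) =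
    of_real (dr - 4 * pi * \<epsilon> * sin (3 * pi * s) * ds) * cis (pi * s)"
proof -
  have "of_real dr + \<i> * of_real (pi * ds) * (of_real (- 4 * \<epsilon> * cos (3 * pi * s)) + 4 * of_real \<epsilon> * cis (3 * pi * s)) =
      of_real (dr - 4 * pi * \<epsilon> * sin (3 * pi * s) * ds)"
    by (rule complex_eqI) (simp_all add: algebra_simps)
  then show ?thesis by (simp add: F_derivative_def crit_def)
qed

text \<open>After removing the factor cis (pi s), dr covers the real direction. The imaginary
  direction is reached through dz when z is nonzero, and through ds when r + 4 \<epsilon> cos 3 pi s
  is nonzero.\<close>

lemma surj_F_derivative_iff: "surj (F_derivative \<epsilon> q) \<longleftrightarrow> q \<notin> range (crit \<epsilon>)"
proof -
  obtain r s z where q: "q = ((r, s), z)" by (metis prod.exhaust)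
  have "\<not> surj (F_derivative \<epsilon> (crit \<epsilon> s))"
  proof
    assume "surj (F_derivative \<epsilon> (crit \<epsilon> s))"
    then obtain d where "F_derivative \<epsilon> (crit \<epsilon> s) d = \<i> * cis (pi * s)" by (metis surjD)
    then have "of_real (fst (fst d) - 4 * pi * \<epsilon> * sin (3 * pi * s) * snd (fst d)) * cis (pi * s) = \<i> * cis (pi * s)"
      by (metis F_derivative_crit prod.collapse)
    then have "complex_of_real (fst (fst d) - 4 * pi * \<epsilon> * sin (3 * pi * s) * snd (fst d)) = \<i>" by simp
    then show False by (metis Im_complex_of_real imaginary_unit.sel(2) zero_neq_one)
  qed
  moreover have "surj (F_derivative \<epsilon> q)" if "z \<noteq> 0"
  proof (rule surjI)
    show "F_derivative \<epsilon> q ((0, 0), w / (2 * z)) = w" for w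
      using that by (simp add: F_derivative_def q)
  qed
  moreover have "surj (F_derivative \<epsilon> q)" if z: "z = 0" and r: "r \<noteq> - 4 * \<epsilon> * cos (3 * pi * s)"
  proof (rule surjI)
    fix w
    define v where "v = cis (- (pi * s)) * w"
    define \<rho> where "\<rho> = r + 4 * \<epsilon> * cos (3 * pi * s)"
    define ds where "ds = Im v / (pi * \<rho>)"
    have \<rho>: "\<rho> \<noteq> 0" using r by (simp add: \<rho>_def)
    have "Im v = pi * ds * \<rho>" using \<rho> by (simp add: ds_def)
    then have "of_real (Re v + 4 * pi * \<epsilon> * sin (3 * pi * s) * ds) +
        \<i> * of_real (pi * ds) * (of_real r + 4 * of_real \<epsilon> * cis (3 * pi * s)) = v"
      by (intro complex_eqI) (simp_all add: \<rho>_def algebra_simps)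
    then have "F_derivative \<epsilon> q ((Re v + 4 * pi * \<epsilon> * sin (3 * pi * s) * ds, ds), 0) = cis (pi * s) * v"
      by (simp add: F_derivative_def q)
    also have "\<dots> = w" by (simp add: v_def cis_mult flip: mult.assoc)
    finally show "F_derivative \<epsilon> q ((Re v + 4 * pi * \<epsilon> * sin (3 * pi * s) * ds, ds), 0) = w" .
  qed
  ultimately show ?thesis by (auto simp: q crit_def)
qed

lemma critical_points_F_map:
  "critical_points moebius_C_atlas (F_map \<epsilon>) = range (\<lambda>s. cover (crit \<epsilon> s))"
  unfolding critical_points_eq frechet_derivative_F_map_cover surj_F_derivative_iff by auto

section \<open>Injectivity on the critical set\<close>

lemma F_map_crit:
  "F_map \<epsilon> (cover (crit \<epsilon> s)) = - of_real \<epsilon> * (cis (2 * pi * s) ^ 2 + 2 * cnj (cis (2 * pi * s)))"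
proof -
  have 1: "cis (4 * pi * s) = cis (3 * pi * s) * cis (pi * s)" by (simp add: cis_mult algebra_simps)
  have 2: "cis (2 * pi * s) ^ 2 = cis (3 * pi * s) * cis (pi * s)"
    by (simp add: cis_mult power2_eq_square algebra_simps)
  have 3: "cnj (cis (2 * pi * s)) = cnj (cis (3 * pi * s)) * cis (pi * s)"
    by (simp add: cis_mult cis_cnj algebra_simps)
  have 4: "complex_of_real (- 4 * \<epsilon> * cos (3 * pi * s)) =
      - 2 * of_real \<epsilon> * (cis (3 * pi * s) + cnj (cis (3 * pi * s)))"
    by (rule complex_eqI) simp_all
  show ?thesis unfolding F_map_cover crit_def prod.sel 1 2 3 4 by (simp add: algebra_simps)
qed

text \<open>On the unit circle the conjugate is the inverse; cancelling x - y leaves (x + y) x y =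
  2. So x + y has norm 2, which the parallelogram law allows only for x = y.\<close>

lemma deltoid_inj:
  fixes x y :: complex
  assumes "norm x = 1" "norm y = 1" "x\<^sup>2 + 2 * cnj x = y\<^sup>2 + 2 * cnj y"
  shows "x = y"
proof (rule ccontr)
  assume ne: "x \<noteq> y"
  have xy: "x \<noteq> 0" "y \<noteq> 0" "x * cnj x = 1" "y * cnj y = 1"
    using assms(1,2) by (auto simp: complex_norm_square[symmetric])
  have "(x - y) * ((x + y) * (x * y)) = (x\<^sup>2 - y\<^sup>2) * (x * y)"
    by (simp add: algebra_simps power2_eq_square)
  also have "x\<^sup>2 - y\<^sup>2 = 2 * cnj y - 2 * cnj x" using assms(3) by (simp add: algebra_simps)
  also have "\<dots> * (x * y) = 2 * x * (y * cnj y) - 2 * y * (x * cnj x)" by (simp add: algebra_simps)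
  also have "\<dots> = (x - y) * 2" unfolding xy by (simp add: algebra_simps)
  finally have "(x + y) * (x * y) = 2" using ne by (metis mult_cancel_left right_minus_eq)
  then have "norm ((x + y) * (x * y)) = 2" by simp
  then have n: "norm (x + y) = 2" using assms(1,2) by (simp add: norm_mult)
  have "(norm (x - y))\<^sup>2 = 2 * (norm x)\<^sup>2 + 2 * (norm y)\<^sup>2 - (norm (x + y))\<^sup>2"
    by (simp only: power2_norm_eq_inner inner_diff_left inner_diff_right inner_add_left inner_add_right)
  also have "\<dots> = 0" using n assms(1,2) by simp
  finally show False using ne by simp
qed

lemma cis_2_pi_eq_iff: "cis (2 * pi * s) = cis (2 * pi * t) \<longleftrightarrow> (\<exists>n. t = s + of_int n)"
proof
  assume "cis (2 * pi * s) = cis (2 * pi * t)"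
  then have "cis (2 * pi * t - 2 * pi * s) = 1"
    unfolding cis_divide[symmetric] by simp
  then have "cos (2 * pi * t - 2 * pi * s) = 1" by (simp add: complex_eq_iff)
  then obtain n where "2 * pi * t - 2 * pi * s = of_int n * 2 * pi"
    using cos_one_2pi_int by blast
  then have "2 * pi * t = 2 * pi * (s + of_int n)" by (simp add: algebra_simps)
  then show "\<exists>n. t = s + of_int n" by (intro exI[of _ n]) simp
next
  assume "\<exists>n. t = s + of_int n"
  then obtain n where "t = s + of_int n" ..
  then have "2 * pi * t = 2 * pi * s + 2 * pi * of_int n" by (simp add: algebra_simps)
  then show "cis (2 * pi * s) = cis (2 * pi * t)"
    by (simp add: cis_multiple_2pi flip: cis_mult)
qed

lemma F_map_crit_eq:
  assumes "\<epsilon> > 0" "F_map \<epsilon> (cover (crit \<epsilon> s)) = F_map \<epsilon> (cover (crit \<epsilon> t))"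
  obtains n where "t = s + of_int n"
proof -
  have "cis (2 * pi * s) = cis (2 * pi * t)"
    by (rule deltoid_inj) (use assms in \<open>simp_all add: F_map_crit\<close>)
  then show thesis using that by (auto simp: cis_2_pi_eq_iff)
qed

lemma inj_on_F_map_crit:
  assumes "\<epsilon> > 0"
  shows "inj_on (F_map \<epsilon>) (range (\<lambda>s. cover (crit \<epsilon> s)))"
proof (rule inj_onI)
  fix p q assume *: "p \<in> range (\<lambda>s. cover (crit \<epsilon> s))" "q \<in> range (\<lambda>s. cover (crit \<epsilon> s))"
    "F_map \<epsilon> p = F_map \<epsilon> q"
  then obtain s t where st: "p = cover (crit \<epsilon> s)" "q = cover (crit \<epsilon> t)" by blast
  then obtain n where "t = s + of_int n" using *(3) F_map_crit_eq[OF assms] by metis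
  then show "p = q" by (simp add: st cover_crit_add_int)
qed

lemma smooth_on_crit: "open S \<Longrightarrow> smooth_on S (crit \<epsilon>)"
  unfolding crit_def by (intro smooth_intros)

lemma continuous_on_crit: "continuous_on S (crit \<epsilon>)"
  unfolding crit_def by (intro continuous_intros)

text \<open>Projection to the core circle of the band. A lift is chosen, but another lift shifts s
  by an integer and gives the same value.\<close>

definition circle_coordinate :: "moebius \<times> complex \<Rightarrow> complex"
  where "circle_coordinate p = cis (2 * pi * snd (fst (SOME q. cover q = p)))"

lemma circle_coordinate_cover: "circle_coordinate (cover q) = cis (2 * pi * snd (fst q))"
proof -
  have "cover (SOME q'. cover q' = cover q) = cover q" by (rule someI) (rule refl)
  then obtain n where "q = deck n (SOME q'. cover q' = cover q)" using cover_eq_iff by metis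
  then have "snd (fst q) = snd (fst (SOME q'. cover q' = cover q)) + of_int n"
    by (metis deck_apply prod.collapse prod.sel)
  then have "cis (2 * pi * snd (fst (SOME q'. cover q' = cover q))) = cis (2 * pi * snd (fst q))"
    unfolding cis_2_pi_eq_iff by blast
  then show ?thesis by (simp add: circle_coordinate_def)
qed

lemma continuous_on_circle_coordinate: "continuous_on S circle_coordinate"
proof -
  have "continuous_on UNIV circle_coordinate"
    unfolding continuous_on_open_vimage[OF open_UNIV]
  proof (intro allI impI)
    fix B :: "complex set" assume B: "open B"
    let ?f = "\<lambda>q :: (real \<times> real) \<times> complex. cis (2 * pi * snd (fst q))"
    have "continuous_on UNIV ?f" by (intro smooth_on_continuous_on smooth_intros open_UNIV)
    with B have "open (?f -` B)" by (rule open_vimage)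
    moreover have "circle_coordinate -` B = cover ` (?f -` B)"
    proof (intro subset_antisym subsetI)
      fix p assume p: "p \<in> circle_coordinate -` B"
      obtain q where q: "p = cover q" using surj_cover by (metis surjD)
      with p have "q \<in> ?f -` B" by (simp add: circle_coordinate_cover)
      then show "p \<in> cover ` (?f -` B)" unfolding q by (rule imageI)
    qed (auto simp: circle_coordinate_cover)
    ultimately show "open (circle_coordinate -` B \<inter> UNIV)" by (simp add: open_cover_image)
  qed
  then show ?thesis by (rule continuous_on_subset) simp
qed

text \<open>The critical curve is a graph over s, so \<open>circle_coordinate\<close> is injective
  on it. The homeomorphism is taken from the compact critical set into the Hausdorff plane;
  compactness comes from the period [0, 1] of s.\<close>

lemma crit_circle: "range (\<lambda>s. cover (crit \<epsilon> s)) homeomorphic sphere (0 :: complex) 1"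
proof -
  let ?C = "range (\<lambda>s. cover (crit \<epsilon> s))"
  have "?C = (\<lambda>s. cover (crit \<epsilon> s)) ` {0..1}"
  proof (intro subset_antisym subsetI)
    fix p assume "p \<in> ?C"
    then obtain s where "p = cover (crit \<epsilon> s)" by blast
    then have "p = cover (crit \<epsilon> (s + of_int (- \<lfloor>s\<rfloor>)))" by (simp only: cover_crit_add_int)
    moreover have "s + of_int (- \<lfloor>s\<rfloor>) \<in> {0..1}" using floor_correct[of s] by simp linarith
    ultimately show "p \<in> (\<lambda>s. cover (crit \<epsilon> s)) ` {0..1}" by blast
  qed auto
  moreover have "compact ((\<lambda>s. cover (crit \<epsilon> s)) ` {0..1})"
    by (intro compact_continuous_image continuous_on_compose2[OF continuous_on_cover[of UNIV]]
        continuous_on_crit) auto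
  ultimately have "compact ?C" by simp
  moreover have "circle_coordinate ` ?C = sphere 0 1"
  proof (intro subset_antisym subsetI)
    fix x :: complex assume "x \<in> sphere 0 1"
    then have "norm x = 1" by simp
    then have "x \<noteq> 0" "sgn x = x" by (auto simp: sgn_eq)
    then have "x = cis (Arg x)" by (simp add: cis_Arg)
    also have "\<dots> = circle_coordinate (cover (crit \<epsilon> (Arg x / (2 * pi))))"
      by (simp add: circle_coordinate_cover crit_def)
    finally show "x \<in> circle_coordinate ` ?C" by blast
  qed (auto simp: circle_coordinate_cover)
  moreover have "inj_on circle_coordinate ?C"
  proof (rule inj_onI)
    fix p q assume *: "p \<in> ?C" "q \<in> ?C" "circle_coordinate p = circle_coordinate q"
    then obtain s t where st: "p = cover (crit \<epsilon> s)" "q = cover (crit \<epsilon> t)" by blast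
    then obtain n where "t = s + of_int n"
      using *(3) by (auto simp: circle_coordinate_cover crit_def cis_2_pi_eq_iff)
    then show "p = q" by (simp add: st cover_crit_add_int)
  qed
  ultimately show ?thesis
    using homeomorphic_compact[OF _ continuous_on_circle_coordinate] by blast
qed

section \<open>Folds and cusps\<close>

lemma local_coordinates_euclideanD:
  assumes "local_coordinates euclidean_atlas V \<psi>"
  shows "open V" "smooth_on V \<psi>" "open (\<psi> ` V)" "smooth_on (\<psi> ` V) (inv_into V \<psi>)"
    "\<And>w. w \<in> V \<Longrightarrow> inv_into V \<psi> (\<psi> w) = w"
proof -
  have "inv_into UNIV (\<lambda>x::'a. x) = (\<lambda>x. x)" using inv_id by (simp add: id_def)
  then show "open V" "smooth_on V \<psi>" "open (\<psi> ` V)" "smooth_on (\<psi> ` V) (inv_into V \<psi>)"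
    using assms unfolding local_coordinates_def euclidean_atlas_def by (simp_all add: o_def)
  have "homeomorphism V (\<psi> ` V) \<psi> (inv_into V \<psi>)" using assms unfolding local_coordinates_def by blast
  then show "inv_into V \<psi> (\<psi> w) = w" if "w \<in> V" for w using that by (rule homeomorphism_apply1)
qed

text \<open>The critical set of the cusp normal form is \<open>t = - 3 x\<^sup>2\<close>, \<open>y = z = 0\<close>, and the normal form maps it
  to \<open>(- 3 x\<^sup>2, - 2 x\<^sup>3)\<close>. So the map, restricted to its critical set, has zero derivative at a cusp.\<close>

lemma is_cusp_crit_imp:
  assumes \<epsilon>: "\<epsilon> > 0" and cusp: "is_cusp moebius_C_atlas (F_map \<epsilon>) (cover (crit \<epsilon> s))"
  shows "sin (3 * pi * s) = 0"
proof -
  let ?F = "\<lambda>q. F_map \<epsilon> (cover q)"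
  obtain b c where bc: "b \<in> {-1, 1}" "c \<in> {-1, 1}" and "has_local_form moebius_C_atlas (F_map \<epsilon>)
      (cover (crit \<epsilon> s)) (\<lambda>(t, x, y, z). (t, x ^ 3 + t * x + b * y^2 + c * z^2))"
    using cusp unfolding is_cusp_def by blast
  then obtain U and \<phi> :: "moebius \<times> complex \<Rightarrow> real \<times> real \<times> real \<times> real" and V
    and \<psi> :: "complex \<Rightarrow> real \<times> real"
    where U: "local_coordinates moebius_C_atlas U \<phi>" "cover (crit \<epsilon> s) \<in> U" "\<phi> (cover (crit \<epsilon> s)) = 0"
    and V: "local_coordinates euclidean_atlas V \<psi>" "F_map \<epsilon> ` U \<subseteq> V"
    and form: "\<And>q. q \<in> U \<Longrightarrow> \<psi> (F_map \<epsilon> q) =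
        (case \<phi> q of (t, x, y, z) \<Rightarrow> (t, x ^ 3 + t * x + b * y^2 + c * z^2))"
    unfolding has_local_form_def by blast
  let ?g = "\<lambda>(t, x, y, z). (t, x ^ 3 + t * x + b * y^2 + c * z^2) :: real \<times> real"
  note Vd = local_coordinates_euclideanD[OF V(1)]
  \<comment> \<open>Being critical is invariant under coordinate changes, so critical points of the
    map go to points where the derivative of the normal form drops rank.\<close>
  have crit_form: "\<exists>x. \<phi> (cover (crit \<epsilon> s')) = (- 3 * x\<^sup>2, x, 0, 0)" if s': "cover (crit \<epsilon> s') \<in> U" for s'
  proof -
    obtain t x y z where p: "\<phi> (cover (crit \<epsilon> s')) = (t, x, y, z)" by (metis prod.exhaust)
    obtain T W \<Psi> where W: "open W" "\<phi> (cover (crit \<epsilon> s')) \<in> W" "smooth_on W \<Psi>"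
      "\<Psi> (\<phi> (cover (crit \<epsilon> s'))) = crit \<epsilon> s'"
      "\<And>y. y \<in> W \<Longrightarrow> y \<in> \<phi> ` U \<and> inv_into U \<phi> y = cover (\<Psi> y)"
      by (rule local_coordinates_coverD[OF U(1) s']) blast
    have p': "\<Psi> (t, x, y, z) = crit \<epsilon> s'" "(t, x, y, z) \<in> W" using W(2,4) p by simp_all
    have "((\<lambda>w. \<psi> (?F (\<Psi> w))) has_derivative (\<lambda>d. frechet_derivative \<psi> (at (?F (crit \<epsilon> s')))
        (F_derivative \<epsilon> (crit \<epsilon> s') (frechet_derivative \<Psi> (at (t, x, y, z)) d)))) (at (t, x, y, z))"
    proof (rule has_derivative_compose[of "\<lambda>w. ?F (\<Psi> w)"])
      show "(\<psi> has_derivative frechet_derivative \<psi> (at (?F (crit \<epsilon> s')))) (at (?F (\<Psi> (t, x, y, z))))"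
        unfolding p' by (rule smooth_on_has_derivative[OF Vd(2)]) (use V(2) s' in blast)
      show "((\<lambda>w. ?F (\<Psi> w)) has_derivative (\<lambda>d. F_derivative \<epsilon> (crit \<epsilon> s')
          (frechet_derivative \<Psi> (at (t, x, y, z)) d))) (at (t, x, y, z))"
        by (rule has_derivative_compose[OF smooth_on_has_derivative[OF W(3) p'(2)]])
          (simp only: p' F_map_cover_has_derivative)
    qed
    then have "(?g has_derivative (\<lambda>d. frechet_derivative \<psi> (at (?F (crit \<epsilon> s')))
        (F_derivative \<epsilon> (crit \<epsilon> s') (frechet_derivative \<Psi> (at (t, x, y, z)) d)))) (at (t, x, y, z))"
    proof (rule has_derivative_transform_within_open[OF _ W(1) p'(2)])
      fix w assume w: "w \<in> W"
      then obtain q where q: "q \<in> U" "w = \<phi> q" using W(5) by blast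
      have "homeomorphism U (\<phi> ` U) \<phi> (inv_into U \<phi>)" using U(1) unfolding local_coordinates_def by blast
      then have "inv_into U \<phi> w = q" using q homeomorphism_apply1 by fastforce
      then have "cover (\<Psi> w) = q" using W(5)[OF w] by simp
      then show "\<psi> (?F (\<Psi> w)) = ?g w" using form[OF q(1)] q(2) by simp
    qed
    moreover have "(?g has_derivative (\<lambda>(dt, dx, dy, dz). (dt, (3 * x\<^sup>2 + t) * dx + x * dt +
        2 * b * y * dy + 2 * c * z * dz))) (at (t, x, y, z))"
      unfolding case_prod_unfold
      by (auto intro!: derivative_eq_intros ext simp: algebra_simps)
    ultimately have D: "(\<lambda>(dt, dx, dy, dz). (dt, (3 * x\<^sup>2 + t) * dx + x * dt + 2 * b * y * dy + 2 * c * z * dz)) =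
        (\<lambda>d. frechet_derivative \<psi> (at (?F (crit \<epsilon> s')))
        (F_derivative \<epsilon> (crit \<epsilon> s') (frechet_derivative \<Psi> (at (t, x, y, z)) d)))"
      using has_derivative_unique by blast
    define w where "w = frechet_derivative \<psi> (at (?F (crit \<epsilon> s'))) (cis (pi * s'))"
    have lin: "linear (frechet_derivative \<psi> (at (?F (crit \<epsilon> s'))))"
      by (rule has_derivative_linear[OF smooth_on_has_derivative[OF Vd(2)]]) (use V(2) s' in blast)
    \<comment> \<open>At a critical point the image of the derivative is a line. The dt-column has
      first entry 1, hence the line is not vertical, and the other columns, whose first entry is 0,
      must vanish.\<close>
    have line: "\<exists>l. (dt, (3 * x\<^sup>2 + t) * dx + x * dt + 2 * b * y * dy + 2 * c * z * dz) = l *\<^sub>R w" for dt dx dy dz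
    proof -
      obtain dr ds dw where d: "frechet_derivative \<Psi> (at (t, x, y, z)) (dt, dx, dy, dz) = ((dr, ds), dw)"
        by (metis prod.exhaust)
      show ?thesis
        using fun_cong[OF D, of "(dt, dx, dy, dz)"]
        unfolding prod.case d F_derivative_crit scaleR_conv_of_real[symmetric] linear_scale[OF lin] w_def
        by blast
    qed
    obtain l where "(1, x) = l *\<^sub>R w" using line[of 1 0 0 0] by auto
    then have "l * fst w = 1" by (metis fst_conv fst_scaleR real_scaleR_def)
    then have w: "fst w \<noteq> 0" by auto
    have zero: "A = 0" if "\<exists>l. (0, A) = l *\<^sub>R w" for A
      using that w by (cases w) auto
    have "3 * x\<^sup>2 + t = 0" using line[of 0 1 0 0] by (intro zero) simp
    moreover have "2 * b * y = 0" using line[of 0 0 1 0] by (intro zero) simp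
    then have "y = 0" using bc(1) by auto
    moreover have "2 * c * z = 0" using line[of 0 0 0 1] by (intro zero) simp
    then have "z = 0" using bc(2) by auto
    ultimately show ?thesis using p by (intro exI[of _ x]) simp
  qed
  obtain T where T: "open T" "crit \<epsilon> s \<in> T" "smooth_on T (\<lambda>q. \<phi> (cover q))" "\<And>q. q \<in> T \<Longrightarrow> cover q \<in> U"
    by (rule local_coordinates_coverD[OF U(1,2)]) blast
  define x where "x s' = fst (snd (\<phi> (cover (crit \<epsilon> s'))))" for s'
  have crit_T: "open (crit \<epsilon> -` T)" by (rule open_vimage[OF T(1) continuous_on_crit])
  have "smooth_on (crit \<epsilon> -` T) (\<lambda>s'. \<phi> (cover (crit \<epsilon> s')))"
    by (rule smooth_on_compose[OF crit_T T(3) smooth_on_crit[OF crit_T] T(1)]) auto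
  then have "smooth_on (crit \<epsilon> -` T) x" unfolding x_def by (intro smooth_intros crit_T)
  then obtain x' where x': "(x has_real_derivative x') (at s)"
    using smooth_on_real_derivative T(2) by (metis vimageI2)
  have x0: "x s = 0" unfolding x_def U(3) by simp
  \<comment> \<open>The cusp curve (- 3 x^2, - 2 x^3) has velocity 0 at x = 0 for any differentiable
    x.\<close>
  have "((\<lambda>s'. (- 3 * x s' ^ 2, - 2 * x s' ^ 3)) has_derivative (\<lambda>_. 0)) (at s)"
    using x' x0 unfolding has_field_derivative_def
    by (auto intro!: derivative_eq_intros ext simp: zero_prod_def)
  then have "((\<lambda>s'. inv_into V \<psi> (- 3 * x s' ^ 2, - 2 * x s' ^ 3)) has_derivative
      (\<lambda>d. frechet_derivative (inv_into V \<psi>) (at (\<psi> (?F (crit \<epsilon> s)))) 0)) (at s)"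
  proof (rule has_derivative_compose)
    have "\<psi> (?F (crit \<epsilon> s)) = (- 3 * x s ^ 2, - 2 * x s ^ 3)"
      unfolding form[OF U(2)] U(3) x0 by (simp add: zero_prod_def)
    moreover have "\<psi> (?F (crit \<epsilon> s)) \<in> \<psi> ` V" using V(2) U(2) by blast
    ultimately show "(inv_into V \<psi> has_derivative frechet_derivative (inv_into V \<psi>) (at (\<psi> (?F (crit \<epsilon> s)))))
        (at (- 3 * x s ^ 2, - 2 * x s ^ 3))"
      using smooth_on_has_derivative[OF Vd(4)] by metis
  qed
  moreover have "frechet_derivative (inv_into V \<psi>) (at (\<psi> (?F (crit \<epsilon> s)))) 0 = 0"
  proof (rule linear_0[OF has_derivative_linear[OF smooth_on_has_derivative[OF Vd(4)]]])
    show "\<psi> (?F (crit \<epsilon> s)) \<in> \<psi> ` V" using V(2) U(2) by blast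
  qed
  ultimately have "((\<lambda>s'. inv_into V \<psi> (- 3 * x s' ^ 2, - 2 * x s' ^ 3)) has_derivative (\<lambda>_. 0)) (at s)" by simp
  then have 1: "((\<lambda>s'. ?F (crit \<epsilon> s')) has_derivative (\<lambda>_. 0)) (at s)"
  proof (rule has_derivative_transform_within_open[OF _ crit_T])
    show "s \<in> crit \<epsilon> -` T" using T(2) by simp
    fix s' assume "s' \<in> crit \<epsilon> -` T"
    then have s': "cover (crit \<epsilon> s') \<in> U" using T(4) by simp
    have "\<psi> (?F (crit \<epsilon> s')) = (- 3 * x s' ^ 2, - 2 * x s' ^ 3)"
      unfolding form[OF s'] x_def using crit_form[OF s'] by (auto simp: power2_eq_square power3_eq_cube)
    then show "inv_into V \<psi> (- 3 * x s' ^ 2, - 2 * x s' ^ 3) = ?F (crit \<epsilon> s')"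
      using Vd(5) V(2) s' by (metis image_subset_iff)
  qed
  \<comment> \<open>Computed directly, the critical value moves with velocity 8 pi \<epsilon> sin (3
    pi s) cis (pi s); comparison with the zero derivative forces the sine to vanish.\<close>
  have "(crit \<epsilon> has_derivative (\<lambda>d. ((12 * pi * \<epsilon> * sin (3 * pi * s) * d, d), 0))) (at s)"
    unfolding crit_def by (auto intro!: derivative_eq_intros ext)
  from has_derivative_compose[OF this F_map_cover_has_derivative[of \<epsilon>]]
  have "((\<lambda>s'. ?F (crit \<epsilon> s')) has_derivative
      (\<lambda>d. of_real (8 * pi * \<epsilon> * sin (3 * pi * s) * d) * cis (pi * s))) (at s)"
    unfolding F_derivative_crit by (simp add: algebra_simps)
  from fun_cong[OF has_derivative_unique[OF this 1], of 1] show ?thesis using \<epsilon> by simp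
qed

section \<open>Three half-planes and the singular points they contain\<close>

text \<open>The representative 4/3 stands for the cusp at s = 1/3 modulo 1: the direction cis (pi s)
  has period 2 in s, and cis (3 pi s0) = 1 fails for 1/3.\<close>

definition centers :: "real set" where "centers = {0, 2/3, 4/3}"

lemma finite_centers: "finite centers" "centers \<noteq> {}"
  by (simp_all add: centers_def)

lemma cis_centers: "s0 \<in> centers \<Longrightarrow> cis (3 * pi * s0) = 1"
proof -
  assume "s0 \<in> centers"
  then have "s0 = 2 / 3 * of_int 0 \<or> s0 = 2 / 3 * of_int 1 \<or> s0 = 2 / 3 * of_int 2"
    by (auto simp: centers_def)
  then obtain n :: int where "s0 = 2 / 3 * of_int n" by blast
  then have "3 * pi * s0 = 2 * pi * of_int n" by simp
  then show ?thesis using cis_multiple_2pi[OF Ints_of_int] by metis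
qed

text \<open>The directions cis (pi s0) are the cube roots of unity. As a consequence some rotated
  real part of any w is at most 0, and the half-planes cover the plane.\<close>

lemma sum_centers: "(\<Sum>s0\<in>centers. Re (cis (- (pi * s0)) * w)) = 0"
proof -
  have c: "cos (pi * 2 / 3) = - 1 / 2" "sin (pi * 2 / 3) = sqrt 3 / 2"
    using cos_120 sin_120 by (simp_all add: mult.commute)
  have "pi * 4 / 3 = 2 * (pi * 2 / 3)" by simp
  then have "cos (pi * 4 / 3) = - 1 / 2" "sin (pi * 4 / 3) = - sqrt 3 / 2"
    by (simp_all only: cos_double_cos sin_double c) (simp_all add: power2_eq_square)
  with c show ?thesis by (simp add: centers_def)
qed

lemma half_plane_center:
  obtains s0 where "s0 \<in> centers" "Re (cis (- (pi * s0)) * w) \<le> 0"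
proof -
  have "\<exists>s0\<in>centers. Re (cis (- (pi * s0)) * w) \<le> 0"
  proof (rule ccontr)
    assume "\<not> (\<exists>s0\<in>centers. Re (cis (- (pi * s0)) * w) \<le> 0)"
    then have "(\<Sum>s0\<in>centers. Re (cis (- (pi * s0)) * w)) > 0"
      by (intro sum_pos) (auto simp: not_le finite_centers)
    then show False using sum_centers[of w] by simp
  qed
  then show thesis using that by blast
qed

text \<open>Equivalently \<epsilon> - u = 4 \<epsilon> C^2 (2 C^2 - 1), which vanishes on the
  boundary of the strip, where C = 0.\<close>

lemma crit_u:
  fixes s s0 \<epsilon> :: real
  assumes "cis (3 * pi * s0) = 1"
  defines "C \<equiv> cos (pi * (s - s0))"
  shows "Re (cis (- (pi * s0)) * F_map \<epsilon> (cover (crit \<epsilon> s))) = \<epsilon> * (1 + 4 * C\<^sup>2 - 8 * C ^ 4)"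
proof -
  define \<sigma> where "\<sigma> = pi * (s - s0)"
  have 1: "cis (- (pi * s0)) * cis (2 * pi * s) ^ 2 = cis (2 * (2 * \<sigma>)) * cis (3 * pi * s0)"
    by (simp add: power2_eq_square cis_mult \<sigma>_def algebra_simps)
  have "cis (- (pi * s0)) * cnj (cis (2 * pi * s)) = cis (- (2 * \<sigma>)) * cnj (cis (3 * pi * s0))"
    by (simp add: cis_mult cis_cnj \<sigma>_def algebra_simps)
  then have 2: "cis (- (pi * s0)) * cnj (cis (2 * pi * s)) = cis (- (2 * \<sigma>))" using assms(1) by simp
  have "cis (- (pi * s0)) * F_map \<epsilon> (cover (crit \<epsilon> s)) =
      - of_real \<epsilon> * (cis (- (pi * s0)) * cis (2 * pi * s) ^ 2 + 2 * (cis (- (pi * s0)) * cnj (cis (2 * pi * s))))"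
    unfolding F_map_crit by (simp add: algebra_simps)
  also have "\<dots> = - of_real \<epsilon> * (cis (2 * (2 * \<sigma>)) + 2 * cis (- (2 * \<sigma>)))"
    unfolding 1 2 using assms(1) by simp
  finally have "Re (cis (- (pi * s0)) * F_map \<epsilon> (cover (crit \<epsilon> s))) =
      - \<epsilon> * (cos (2 * (2 * \<sigma>)) + 2 * cos (2 * \<sigma>))" by simp
  also have "\<dots> = \<epsilon> * (1 + 4 * C\<^sup>2 - 8 * C ^ 4)"
    unfolding cos_double_cos C_def \<sigma>_def by (simp add: algebra_simps power2_eq_square power4_eq_xxxx)
  finally show ?thesis .
qed

text \<open>An integer shift brings s - s0 into [-1/2, 1/2). The left end is excluded because u =
  \<epsilon> there, outside the open half-plane.\<close>

lemma crit_cusp_domain: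
  assumes "\<epsilon> > 0" "cis (3 * pi * s0) = 1" "F_map \<epsilon> (cover (crit \<epsilon> s)) \<in> half_plane \<epsilon> s0"
  obtains n where "crit \<epsilon> (s + of_int n) \<in> cusp_domain \<epsilon> s0"
proof -
  define n where "n = - \<lfloor>s - s0 + 1/2\<rfloor>"
  define t where "t = s + of_int n"
  have F: "F_map \<epsilon> (cover (crit \<epsilon> t)) \<in> half_plane \<epsilon> s0"
    using assms(3) by (simp add: t_def cover_crit_add_int)
  have "-1/2 \<le> t - s0" "t - s0 < 1/2"
    using floor_correct[of "s - s0 + 1/2"] by (simp_all add: t_def n_def) linarith+
  moreover have "t - s0 \<noteq> -1/2"
  proof
    assume "t - s0 = -1/2"
    then have "pi * (t - s0) = - (pi / 2)" by simp
    then have "cos (pi * (t - s0)) = 0" by (simp only: cos_minus cos_pi_half)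
    then have "Re (cis (- (pi * s0)) * F_map \<epsilon> (cover (crit \<epsilon> t))) = \<epsilon>"
      using crit_u[OF assms(2), of \<epsilon> t] by simp
    with F show False by (simp add: half_plane_def)
  qed
  ultimately have "crit \<epsilon> t \<in> strip s0" by (auto simp: strip_def crit_def)
  with F show thesis using that by (simp add: cusp_domain_def t_def)
qed

text \<open>At a critical point a = b = 0 and \<tau> is a double root of the cubic, so 3 x^2 + t =
  0. The computation verifies the equivalent equation k (3 \<tau>^2 + 6 A \<tau> - B) = 0 from the
  explicit critical value.\<close>

lemma cusp_chart_crit:
  fixes s \<epsilon> s0 :: real
  defines "w \<equiv> cis (- (pi * s0)) * F_map \<epsilon> (cover (crit \<epsilon> s))"
  defines "x \<equiv> tan (pi * (s - s0)) + cubic_A \<epsilon> (Re w, Im w)"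
  assumes \<epsilon>: "\<epsilon> > 0" and s0: "cis (3 * pi * s0) = 1" and dom: "crit \<epsilon> s \<in> cusp_domain \<epsilon> s0"
  shows "cusp_chart \<epsilon> s0 (crit \<epsilon> s) = (- 3 * x\<^sup>2, x, 0, 0)"
proof -
  define \<sigma> \<tau> C where "\<sigma> = pi * (s - s0)" and "\<tau> = tan \<sigma>" and "C = cos \<sigma>"
  have strip: "((- 4 * \<epsilon> * cos (3 * pi * s), s), 0) \<in> strip s0" and u: "Re w < \<epsilon>"
    using dom by (auto simp: cusp_domain_def crit_def half_plane_def w_def)
  have C: "C > 0" and at: "arctan \<tau> = \<sigma>" using strip_angle[OF strip] by (simp_all add: C_def \<tau>_def \<sigma>_def)
  have \<tau>: "\<tau>\<^sup>2 * C\<^sup>2 = 1 - C\<^sup>2"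
    using C by (simp add: \<tau>_def C_def tan_def power_divide sin_squared_eq)
  have sin: "sin \<sigma> = \<tau> * C" using C by (simp add: \<tau>_def C_def tan_def)
  have ac: "angle_chart \<epsilon> s0 (crit \<epsilon> s) = (Re w, \<tau>, 0, 0)"
    by (simp add: angle_chart_def Let_def w_def \<tau>_def \<sigma>_def crit_def)
  have v: "slope_v \<epsilon> (Re w, \<tau>, 0, 0) = Im w"
    using angle_chart_slope[OF s0, of "crit \<epsilon> s" \<epsilon>] dom by (simp add: ac w_def cusp_domain_def)
  define k where "k = \<epsilon> - Re w"
  have k: "k > 0" using u by (simp add: k_def)
  have Re_w: "Re w = \<epsilon> * (1 + 4 * C\<^sup>2 - 8 * (C\<^sup>2)\<^sup>2)"
    unfolding w_def crit_u[OF s0] by (simp add: C_def \<sigma>_def)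
  have "Im w = \<tau> * Re w + \<epsilon> * (3 * (\<tau> * C) - 4 * (\<tau> * C) ^ 3) / C"
    using v by (simp add: slope_v_def at C_def[symmetric] sin_triple sin)
  also have "\<dots> = \<tau> * Re w + \<epsilon> * (3 * \<tau> - 4 * \<tau> ^ 3 * C\<^sup>2)"
    using C by (simp add: field_simps power2_eq_square power3_eq_cube)
  finally have Im_w: "Im w = \<tau> * Re w + \<epsilon> * (3 * \<tau> - 4 * \<tau> ^ 3 * C\<^sup>2)" .
  \<comment> \<open>To be used with T = \<tau>^2 and D = cos^2 \<sigma>, which are related by T D =
    1 - D.\<close>
  have poly: "8 * D\<^sup>2 - 4 * D - 4 + 3 * T * (8 * D\<^sup>2 - 4 * D) + 2 * T * (1 + 4 * D - 8 * D\<^sup>2) + 6 * T - 8 * T\<^sup>2 * D = 0"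
    if "T * D = 1 - D" for T D :: real
    using that by algebra
  have "k - 4 * \<epsilon> + 3 * k * \<tau>\<^sup>2 + 2 * \<tau> * Im w = \<epsilon> * (8 * (C\<^sup>2)\<^sup>2 - 4 * C\<^sup>2 - 4 + 3 * \<tau>\<^sup>2 * (8 * (C\<^sup>2)\<^sup>2 - 4 * C\<^sup>2)
      + 2 * \<tau>\<^sup>2 * (1 + 4 * C\<^sup>2 - 8 * (C\<^sup>2)\<^sup>2) + 6 * \<tau>\<^sup>2 - 8 * (\<tau>\<^sup>2)\<^sup>2 * C\<^sup>2)"
    unfolding k_def Im_w Re_w by (simp add: algebra_simps power2_eq_square power3_eq_cube)
  also have "\<dots> = 0" unfolding poly[OF \<tau>] by simp
  finally have "(k - 4 * \<epsilon> + 3 * k * \<tau>\<^sup>2 + 2 * \<tau> * Im w) / k = 0" by simp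
  then have "1 - 4 * \<epsilon> / k + 3 * \<tau>\<^sup>2 + 6 * \<tau> * (Im w / (3 * k)) = 0"
    using k by (simp add: field_simps)
  then have "1 - 4 * \<epsilon> / k - 3 * (Im w / (3 * k))\<^sup>2 = - 3 * (\<tau> + Im w / (3 * k))\<^sup>2"
    unfolding power2_sum by (simp add: algebra_simps)
  then have "cubic_t \<epsilon> (Re w, Im w) = - 3 * x\<^sup>2"
    unfolding x_def cubic_t_def cubic_A_def prod.case k_def \<tau>_def \<sigma>_def .
  then show ?thesis
    unfolding cusp_chart_def ac slope_chart_def prod.case v by (simp add: x_def \<tau>_def \<sigma>_def)
qed

lemma is_fold_or_cusp_crit:
  assumes \<epsilon>: "\<epsilon> > 0"
  shows "is_fold moebius_C_atlas (F_map \<epsilon>) (cover (crit \<epsilon> s)) \<or>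
    is_cusp moebius_C_atlas (F_map \<epsilon>) (cover (crit \<epsilon> s))"
proof -
  obtain s0 where s0: "s0 \<in> centers" "Re (cis (- (pi * s0)) * F_map \<epsilon> (cover (crit \<epsilon> s))) \<le> 0"
    using half_plane_center by metis
  note c = cis_centers[OF s0(1)]
  have "F_map \<epsilon> (cover (crit \<epsilon> s)) \<in> half_plane \<epsilon> s0" using s0(2) \<epsilon> by (simp add: half_plane_def)
  then obtain n where n: "crit \<epsilon> (s + of_int n) \<in> cusp_domain \<epsilon> s0" using crit_cusp_domain[OF \<epsilon> c] by metis
  obtain x where x: "cusp_chart \<epsilon> s0 (crit \<epsilon> (s + of_int n)) = (- 3 * x\<^sup>2, x, 0, 0)"
    using cusp_chart_crit[OF \<epsilon> c n] by metis
  show ?thesis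
  proof (cases "x = 0")
    case True
    then have "cusp_chart \<epsilon> s0 (crit \<epsilon> (s + of_int n)) = 0" using x by (simp add: zero_prod_def)
    then show ?thesis using is_cusp_cusp_domain[OF \<epsilon> c n] by (simp add: cover_crit_add_int)
  next
    case False
    then show ?thesis using is_fold_cusp_domain[OF \<epsilon> c n x] by (simp add: cover_crit_add_int)
  qed
qed

lemma is_cusp_center:
  assumes \<epsilon>: "\<epsilon> > 0" and s0: "cis (3 * pi * s0) = 1"
  shows "is_cusp moebius_C_atlas (F_map \<epsilon>) (cover (crit \<epsilon> s0))"
proof -
  have u: "Re (cis (- (pi * s0)) * F_map \<epsilon> (cover (crit \<epsilon> s0))) = - 3 * \<epsilon>"
    using crit_u[OF s0, of \<epsilon> s0] by simp
  then have dom: "crit \<epsilon> s0 \<in> cusp_domain \<epsilon> s0"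
    using \<epsilon> by (simp add: cusp_domain_def half_plane_def strip_def crit_def)
  have "angle_chart \<epsilon> s0 (crit \<epsilon> s0) = (- 3 * \<epsilon>, 0, 0, 0)"
    using u by (simp add: angle_chart_def Let_def crit_def)
  then have "Im (cis (- (pi * s0)) * F_map \<epsilon> (cover (crit \<epsilon> s0))) = 0"
    using angle_chart_slope[OF s0, of "crit \<epsilon> s0" \<epsilon>] dom by (simp add: cusp_domain_def slope_v_def)
  then have "cusp_chart \<epsilon> s0 (crit \<epsilon> s0) = 0"
    using cusp_chart_crit[OF \<epsilon> s0 dom] by (simp add: cubic_A_def zero_prod_def)
  then show ?thesis by (rule is_cusp_cusp_domain[OF \<epsilon> s0 dom])
qed

lemma cusps_eq:
  assumes \<epsilon>: "\<epsilon> > 0"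
  shows "{p \<in> range (\<lambda>s. cover (crit \<epsilon> s)). is_cusp moebius_C_atlas (F_map \<epsilon>) p} =
    (\<lambda>s. cover (crit \<epsilon> s)) ` centers"
proof (intro subset_antisym subsetI)
  fix p assume "p \<in> {p \<in> range (\<lambda>s. cover (crit \<epsilon> s)). is_cusp moebius_C_atlas (F_map \<epsilon>) p}"
  then obtain s where p: "p = cover (crit \<epsilon> s)" and "is_cusp moebius_C_atlas (F_map \<epsilon>) (cover (crit \<epsilon> s))"
    by blast
  then have "sin (3 * pi * s) = 0" using is_cusp_crit_imp[OF \<epsilon>] by blast
  then obtain n :: int where "3 * pi * s = of_int n * pi" using sin_zero_iff_int2 by blast
  then have n: "s = of_int n / 3" by simp
  have "n mod 3 = 0 \<or> n mod 3 = 1 \<or> n mod 3 = 2" by presburger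
  \<comment> \<open>The residue 1 is written as 3 m + 4 and not 3 m + 1, to match the center
    4/3.\<close>
  then have "\<exists>m. n = 3 * m \<or> n = 3 * m + 2 \<or> n = 3 * m + 4" by presburger
  then obtain m where "n = 3 * m \<or> n = 3 * m + 2 \<or> n = 3 * m + 4" ..
  then have "s = 0 + of_int m \<or> s = 2/3 + of_int m \<or> s = 4/3 + of_int m"
    by (auto simp: n)
  then obtain s0 where "s0 \<in> centers" "s = s0 + of_int m" unfolding centers_def by blast
  then show "p \<in> (\<lambda>s. cover (crit \<epsilon> s)) ` centers" by (auto simp: p cover_crit_add_int)
next
  fix p assume "p \<in> (\<lambda>s. cover (crit \<epsilon> s)) ` centers"
  then show "p \<in> {p \<in> range (\<lambda>s. cover (crit \<epsilon> s)). is_cusp moebius_C_atlas (F_map \<epsilon>) p}"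
    using is_cusp_center[OF \<epsilon> cis_centers] by auto
qed

lemma card_cusps:
  assumes \<epsilon>: "\<epsilon> > 0"
  shows "card ((\<lambda>s. cover (crit \<epsilon> s)) ` centers) = 3"
proof -
  have "inj_on (\<lambda>s. cover (crit \<epsilon> s)) centers"
  proof (rule inj_onI)
    fix s t assume st: "s \<in> centers" "t \<in> centers" "cover (crit \<epsilon> s) = cover (crit \<epsilon> t)"
    then obtain n where n: "t = s + of_int n" using F_map_crit_eq[OF \<epsilon>, of s t] by metis
    then have disj: "real_of_int n = 0 \<or> 3 * real_of_int n = 2 \<or> 3 * real_of_int n = 4 \<or>
        3 * real_of_int n = -2 \<or> 3 * real_of_int n = -4"
      using st(1,2) by (auto simp: centers_def)
    then have "real_of_int n < 2" "- 2 < real_of_int n" by auto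
    then have "n = - 1 \<or> n = 0 \<or> n = 1" by linarith
    then have "n = 0" using disj by auto
    with n show "s = t" by simp
  qed
  then have "card ((\<lambda>s. cover (crit \<epsilon> s)) ` centers) = card centers" by (rule card_image)
  then show ?thesis by (simp add: centers_def)
qed

section \<open>Infinitesimal stability\<close>

lemma smooth_on_cubic_t [smooth_intros]:
  "open S \<Longrightarrow> smooth_on S f \<Longrightarrow> (\<And>x. x \<in> S \<Longrightarrow> fst (f x) \<noteq> \<epsilon>) \<Longrightarrow> smooth_on S (\<lambda>x. cubic_t \<epsilon> (f x))"
  unfolding cubic_t_def cubic_A_def case_prod_unfold prod.sel by (intro smooth_intros) auto

lemma smooth_on_cubic_A [smooth_intros]:
  "open S \<Longrightarrow> smooth_on S f \<Longrightarrow> (\<And>x. x \<in> S \<Longrightarrow> fst (f x) \<noteq> \<epsilon>) \<Longrightarrow> smooth_on S (\<lambda>x. cubic_A \<epsilon> (f x))"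
  unfolding cubic_A_def case_prod_unfold by (intro smooth_intros) auto

lemma cis_pi_add_int: "cis (- (pi * (s + of_int n))) = of_real ((-1) powi (- n)) * cis (- (pi * s))"
proof -
  have "- (pi * (s + of_int n)) = - (pi * s) + pi * of_int (- n)" by (simp add: algebra_simps)
  then show ?thesis by (simp only: cis_pi_of_int of_real_power_int of_real_minus of_real_1 flip: cis_mult) simp
qed

text \<open>In the chart around a cusp the condition \<open>Im (e\<^sup>-\<^sup>i\<^sup>\<phi> (Y - \<omega>)) = 0\<close> along the deltoid, divided by
  \<open>cos \<sigma>\<close>, says \<open>Y\<^sub>2 + A Y\<^sub>1 - x Y\<^sub>1 = f(x)\<close> where \<open>t = - 3 x\<^sup>2\<close>. Splitting \<open>f\<close> into its even and
  odd part solves this with functions of \<open>t\<close>.\<close>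

lemma half_plane_extension:
  fixes \<omega> :: "real \<Rightarrow> complex"
  assumes \<epsilon>: "\<epsilon> > 0" and s0: "cis (3 * pi * s0) = 1"
    and \<omega>: "smooth_on UNIV \<omega>" and per: "\<And>s n. \<omega> (s + of_int n) = \<omega> s"
  obtains Y where "smooth_on (half_plane \<epsilon> s0) Y"
    "\<And>s. F_map \<epsilon> (cover (crit \<epsilon> s)) \<in> half_plane \<epsilon> s0 \<Longrightarrow>
      Im (cis (- (pi * s)) * (Y (F_map \<epsilon> (cover (crit \<epsilon> s))) - \<omega> s)) = 0"
proof -
  define W where "W s = Im (cis (- (pi * s)) * \<omega> s)" for s
  have W: "smooth_on UNIV W" unfolding W_def by (intro smooth_intros open_UNIV \<omega>)
  \<comment> \<open>The coefficient A at the critical value with parameter x, since critical values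
    have (t, V) = (- 3 x^2, - 2 x^3).\<close>
  define a where "a x = middle_root (- 3 * x\<^sup>2) (- 2 * x ^ 3)" for x
  have a: "smooth_on UNIV a"
    unfolding a_def
  proof (intro smooth_intros open_UNIV)
    fix x :: real
    have x2: "0 \<le> x\<^sup>2" by simp
    then show "- 3 * x\<^sup>2 < 3" by linarith
    \<comment> \<open>The amplitude is 2 sqrt (1 + x^2), so the root condition reads 8
      \<bar>x\<bar>^3 < 8 sqrt (1 + x^2)^3.\<close>
    have "\<bar>x\<bar> < sqrt (1 + x\<^sup>2)" by (rule real_less_rsqrt) simp
    then have "\<bar>x\<bar> ^ 3 < sqrt (1 + x\<^sup>2) ^ 3" by (intro power_strict_mono) auto
    moreover have "amplitude (- 3 * x\<^sup>2) = 2 * sqrt (1 + x\<^sup>2)" by (simp add: amplitude_def)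
    ultimately show "\<bar>4 * (- 2 * x ^ 3)\<bar> < amplitude (- 3 * x\<^sup>2) ^ 3"
      by (simp add: power_mult_distrib abs_mult power_abs)
  qed
  \<comment> \<open>The slope is \<tau> = x - A, so x determines the angle of its critical point,
    and \<open>f\<close> is the prescribed function expressed in x alone, smooth on the whole
    line.\<close>
  define f where "f x = W (s0 + arctan (x - a x) / pi) / cos (arctan (x - a x))" for x
  have "smooth_on UNIV (\<lambda>x. W (s0 + arctan (x - a x) / pi))"
    by (rule smooth_on_compose[OF open_UNIV W]) (auto intro!: smooth_intros a)
  then have "smooth_on UNIV f"
    unfolding f_def by (intro smooth_intros open_UNIV a) (auto simp: cos_arctan_not_zero)
  then obtain E D where ED: "smooth_on UNIV E" "smooth_on UNIV D" "\<And>x. f x = E (x\<^sup>2) + x * D (x\<^sup>2)"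
    by (rule Whitney_even_odd) blast
  define c where "c w = (Re (cis (- (pi * s0)) * w), Im (cis (- (pi * s0)) * w))" for w
  \<comment> \<open>In the rotated frame Y_1 = - D and Y_2 = E + A D, evaluated at - t / 3, which
    equals x^2 on the deltoid. Then Y_2 + A Y_1 - x Y_1 = E + x D.\<close>
  define Y where "Y w = cis (pi * s0) * Complex (- D (- cubic_t \<epsilon> (c w) / 3))
    (E (- cubic_t \<epsilon> (c w) / 3) + cubic_A \<epsilon> (c w) * D (- cubic_t \<epsilon> (c w) / 3))" for w
  have o: "open (half_plane \<epsilon> s0)"
    unfolding half_plane_def by (intro open_Collect_less continuous_intros)
  have cs: "smooth_on (half_plane \<epsilon> s0) c" unfolding c_def by (intro smooth_intros o)
  have ne: "fst (c w) \<noteq> \<epsilon>" if "w \<in> half_plane \<epsilon> s0" for w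
    using that unfolding c_def half_plane_def mem_Collect_eq fst_conv by linarith
  have comp: "smooth_on (half_plane \<epsilon> s0) (\<lambda>w. g (- cubic_t \<epsilon> (c w) / 3))" if "smooth_on UNIV g" for g :: "real \<Rightarrow> real"
  proof (rule smooth_on_compose[OF o that])
    show "smooth_on (half_plane \<epsilon> s0) (\<lambda>w. - cubic_t \<epsilon> (c w) / 3)"
      by (intro smooth_intros o cs ne) simp_all
  qed simp_all
  show thesis
  proof
    show "smooth_on (half_plane \<epsilon> s0) Y"
      unfolding Y_def by (intro smooth_intros o comp ED(1,2) cs ne)
    fix s assume F: "F_map \<epsilon> (cover (crit \<epsilon> s)) \<in> half_plane \<epsilon> s0"
    then obtain n where dom: "crit \<epsilon> (s + of_int n) \<in> cusp_domain \<epsilon> s0"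
      using crit_cusp_domain[OF \<epsilon> s0] by metis
    define t w where "t = s + of_int n" and "w = F_map \<epsilon> (cover (crit \<epsilon> s))"
    define \<sigma> where "\<sigma> = pi * (t - s0)"
    define x where "x = tan \<sigma> + cubic_A \<epsilon> (c w)"
    have w: "w = F_map \<epsilon> (cover (crit \<epsilon> t))" by (simp add: w_def t_def cover_crit_add_int)
    note dom' = dom[folded t_def]
    have ch: "cusp_chart \<epsilon> s0 (crit \<epsilon> t) = (- 3 * x\<^sup>2, x, 0, 0)"
      using cusp_chart_crit[OF \<epsilon> s0 dom'] by (simp only: x_def c_def w \<sigma>_def)
    have "cubic_coeffs \<epsilon> (c w) = cusp_form (cusp_chart \<epsilon> s0 (crit \<epsilon> t))"
      using plane_chart_cusp_chart[OF s0 dom'] unfolding plane_chart_def c_def w by simp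
    also have "\<dots> = (- 3 * x\<^sup>2, - 2 * x ^ 3)"
      unfolding ch cusp_form_def by (simp add: power2_eq_square power3_eq_cube)
    finally have cc: "cubic_coeffs \<epsilon> (c w) = (- 3 * x\<^sup>2, - 2 * x ^ 3)" .
    then have ct: "cubic_t \<epsilon> (c w) = - 3 * x\<^sup>2" by (simp add: cubic_coeffs_def)
    have "fst (c w) < \<epsilon>" using F by (simp add: c_def half_plane_def w_def)
    from cubic_inv_coeffs(2)[OF \<epsilon> this] have ax: "a x = cubic_A \<epsilon> (c w)"
      by (simp add: cc a_def)
    have "((- 4 * \<epsilon> * cos (3 * pi * t), t), 0) \<in> strip s0"
      using dom' by (simp add: cusp_domain_def crit_def)
    then have C: "cos \<sigma> > 0" and at: "arctan (tan \<sigma>) = \<sigma>"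
      using strip_angle unfolding \<sigma>_def by blast+
    have "x - a x = tan \<sigma>" unfolding ax by (simp add: x_def)
    then have "f x = W t / cos \<sigma>" by (simp add: f_def at) (simp add: \<sigma>_def)
    then have fx: "E (x\<^sup>2) + x * D (x\<^sup>2) = W t / cos \<sigma>" by (simp only: ED(3))
    have "cis (- (pi * t)) * Y w = cis (- \<sigma>) * Complex (- D (x\<^sup>2)) (E (x\<^sup>2) + cubic_A \<epsilon> (c w) * D (x\<^sup>2))"
      unfolding Y_def ct by (simp add: cis_mult \<sigma>_def algebra_simps flip: mult.assoc)
    then have "Im (cis (- (pi * t)) * Y w) = cos \<sigma> * (E (x\<^sup>2) + cubic_A \<epsilon> (c w) * D (x\<^sup>2)) + sin \<sigma> * D (x\<^sup>2)"
      by simp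
    also have "\<dots> = cos \<sigma> * (E (x\<^sup>2) + x * D (x\<^sup>2))"
      using C by (simp add: x_def tan_def field_simps)
    also have "\<dots> = W t" using C unfolding fx by simp
    finally have "Im (cis (- (pi * t)) * (Y w - \<omega> s)) = 0"
      using per[of s n] by (simp add: W_def t_def right_diff_distrib)
    moreover have "cis (- (pi * t)) * (Y w - \<omega> s) =
        of_real ((-1) powi (- n)) * (cis (- (pi * s)) * (Y w - \<omega> s))"
      unfolding t_def cis_pi_add_int by (simp only: mult.assoc)
    \<comment> \<open>The point was shifted by \<open>n\<close> into the strip; the shift only
      contributes a sign to the condition.\<close>
    ultimately have "((-1) powi (- n)) * Im (cis (- (pi * s)) * (Y w - \<omega> s)) = 0"
      by (simp only: Im_complex_of_real Re_complex_of_real times_complex.sel mult_zero_left add_0_right)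
    then show "Im (cis (- (pi * s)) * (Y (F_map \<epsilon> (cover (crit \<epsilon> s))) - \<omega> s)) = 0"
      unfolding w_def by simp
  qed
qed

text \<open>The condition on Y at each critical value is affine in Y, so weighted means of the three
  local solutions with weights summing to 1 satisfy it as well.\<close>

lemma target_extension:
  fixes \<omega> :: "real \<Rightarrow> complex"
  assumes \<epsilon>: "\<epsilon> > 0" and \<omega>: "smooth_on UNIV \<omega>" and per: "\<And>s n. \<omega> (s + of_int n) = \<omega> s"
  obtains Y where "smooth_on UNIV Y"
    "\<And>s. Im (cis (- (pi * s)) * (Y (F_map \<epsilon> (cover (crit \<epsilon> s))) - \<omega> s)) = 0"
proof -
  let ?P = "\<lambda>s0 Y. smooth_on (half_plane \<epsilon> s0) Y \<and>
      (\<forall>s. F_map \<epsilon> (cover (crit \<epsilon> s)) \<in> half_plane \<epsilon> s0 \<longrightarrow>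
      Im (cis (- (pi * s)) * (Y (F_map \<epsilon> (cover (crit \<epsilon> s))) - \<omega> s)) = 0)"
  have "\<exists>Y. ?P s0 Y" if "s0 \<in> centers" for s0
    by (rule half_plane_extension[OF \<epsilon> cis_centers[OF that] \<omega> per]) blast
  then have "\<forall>s0\<in>centers. \<exists>Y. ?P s0 Y" by blast
  from bchoice[OF this] obtain Z where Z: "\<forall>s0\<in>centers. ?P s0 (Z s0)" ..
  \<comment> \<open>The threshold \<epsilon> / 2 lies strictly between 0, below which some center
    always occurs, and \<epsilon>, where the local solution ends. So the weights never vanish
    together, and each product extends smoothly by 0.\<close>
  define \<beta> where "\<beta> s0 w = exp_bump (\<epsilon> / 2 - Re (cis (- (pi * s0)) * w))" for s0 w
  define T where "T w = (\<Sum>s0\<in>centers. \<beta> s0 w)" for w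
  have T: "T w > 0" for w
  proof -
    obtain s0 where s0: "s0 \<in> centers" "Re (cis (- (pi * s0)) * w) \<le> 0" using half_plane_center by metis
    have "\<epsilon> / 2 - Re (cis (- (pi * s0)) * w) > 0" using s0(2) \<epsilon> by linarith
    then have "\<beta> s0 w > 0" unfolding \<beta>_def by (rule exp_bump_pos)
    then show ?thesis
      unfolding T_def by (rule sum_pos2[OF finite_centers(1) s0(1)]) (simp add: \<beta>_def exp_bump_nonneg)
  qed
  define Y where "Y w = (\<Sum>s0\<in>centers. (\<beta> s0 w / T w) *\<^sub>R Z s0 w)" for w
  have \<beta>: "smooth_on S (\<beta> s0)" if "open S" for S s0 unfolding \<beta>_def by (intro smooth_intros that)
  have Ts: "smooth_on S T" if "open S" for S unfolding T_def by (intro smooth_on_sum \<beta> that)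
  have T0: "T w \<noteq> 0" for w using T[of w] by simp
  show thesis
  proof
    show "smooth_on UNIV Y"
      unfolding Y_def
    proof (intro smooth_on_sum open_UNIV smooth_on_locally)
      fix s0 w assume s0: "s0 \<in> centers"
      show "\<exists>T'. open T' \<and> w \<in> T' \<and> smooth_on T' (\<lambda>w. (\<beta> s0 w / T w) *\<^sub>R Z s0 w)"
      proof (cases "w \<in> half_plane \<epsilon> s0")
        case True
        have o: "open (half_plane \<epsilon> s0)"
          unfolding half_plane_def by (intro open_Collect_less continuous_intros)
        have "smooth_on (half_plane \<epsilon> s0) (\<lambda>w. (\<beta> s0 w / T w) *\<^sub>R Z s0 w)"
          using Z s0 by (intro smooth_intros o \<beta> Ts T0) blast
        with o True show ?thesis by blast
      next
        case False
        let ?S = "{w. \<epsilon> / 2 < Re (cis (- (pi * s0)) * w)}"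
        have o: "open ?S" by (intro open_Collect_less continuous_intros)
        have "smooth_on ?S (\<lambda>w. (\<beta> s0 w / T w) *\<^sub>R Z s0 w)"
        proof (rule smooth_on_cong[OF smooth_on_const[of _ 0] o])
          fix w assume "w \<in> ?S"
          then have "\<beta> s0 w = 0" unfolding \<beta>_def by (intro exp_bump_zero) simp
          then show "0 = (\<beta> s0 w / T w) *\<^sub>R Z s0 w" by simp
        qed
        moreover have "w \<in> ?S" using False \<epsilon> unfolding half_plane_def mem_Collect_eq by linarith
        ultimately show ?thesis using o by blast
      qed
    qed
    fix s
    let ?w = "F_map \<epsilon> (cover (crit \<epsilon> s))" let ?c = "cis (- (pi * s))"
    have "(\<Sum>s0\<in>centers. \<beta> s0 ?w / T ?w) = 1"
      using T0[of ?w] by (simp add: T_def flip: sum_divide_distrib)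
    then have "\<omega> s = (\<Sum>s0\<in>centers. (\<beta> s0 ?w / T ?w) *\<^sub>R \<omega> s)" by (simp flip: scaleR_sum_left)
    then have "Y ?w - \<omega> s = (\<Sum>s0\<in>centers. (\<beta> s0 ?w / T ?w) *\<^sub>R (Z s0 ?w - \<omega> s))"
      by (simp add: Y_def scaleR_diff_right sum_subtractf)
    then have "Im (?c * (Y ?w - \<omega> s)) = (\<Sum>s0\<in>centers. \<beta> s0 ?w / T ?w * Im (?c * (Z s0 ?w - \<omega> s)))"
      by (simp only: sum_distrib_left mult_scaleR_right Im_sum scaleR_complex.sel)
    also have "\<dots> = 0"
    proof (rule sum.neutral, rule ballI)
      fix s0 assume s0: "s0 \<in> centers"
      show "\<beta> s0 ?w / T ?w * Im (?c * (Z s0 ?w - \<omega> s)) = 0"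
      proof (cases "?w \<in> half_plane \<epsilon> s0")
        case True
        then show ?thesis using Z s0 by simp
      next
        case False
        then have "\<beta> s0 ?w = 0"
          unfolding \<beta>_def half_plane_def using \<epsilon> by (intro exp_bump_zero) simp
        then show ?thesis by simp
      qed
    qed
    finally show "Im (?c * (Y ?w - \<omega> s)) = 0" .
  qed
qed

section \<open>Equivariant vector fields on the cover\<close>

definition deck_linear :: "int \<Rightarrow> (real \<times> real) \<times> complex \<Rightarrow> (real \<times> real) \<times> complex"
  where "deck_linear n = (\<lambda>((dr, ds), dz). (((-1) powi n * dr, ds), dz))"

lemma deck_has_derivative: "(deck n has_derivative deck_linear n) (at q)"
proof -
  have "deck n = (\<lambda>q. (((-1) powi n * fst (fst q), snd (fst q) + of_int n), snd q))"
    by (auto simp: deck_apply)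
  moreover have "(\<dots> has_derivative deck_linear n) (at q)"
    by (auto intro!: derivative_eq_intros ext simp: deck_linear_def)
  ultimately show ?thesis by simp
qed

lemma deck_add: "deck n (p + q) = deck n p + deck_linear n q"
  by (cases p; cases q) (auto simp: deck_apply deck_linear_def algebra_simps)

lemma deck_linear_scaleR: "deck_linear n (c *\<^sub>R q) = c *\<^sub>R deck_linear n q"
  by (auto simp: deck_linear_def case_prod_unfold)

lemma minus_one_powi_square: "((-1) powi n :: real) * (-1) powi n = 1"
  by (simp flip: power_int_mult_distrib)

text \<open>Hadamard's quotients of a function on the cover are taken along the affine fibres over the
  critical curve, with base point \<open>crit \<epsilon> s\<close>. The deck transformations are affine maps between these
  fibres, so that the quotients are equivariant.\<close>

lemma source_vector_field:
  assumes w: "smooth_on UNIV (\<lambda>q. w (cover q) :: complex)"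
    and vanish: "\<And>s. Im (cis (- (pi * s)) * w (cover (crit \<epsilon> s))) = 0"
  obtains X where "smooth_on UNIV X" "\<And>q. w (cover q) = F_derivative \<epsilon> q (X q)"
    "\<And>n q. X (deck n q) = deck_linear n (X q)"
proof -
  define f where "f q = w (cover q)" for q
  have f: "smooth_on UNIV f" using w by (simp add: f_def[abs_def])
  \<comment> \<open>The point of the critical curve with the same s; the increment from it has no
    ds-component, so only three Hadamard quotients occur.\<close>
  define base where "base q = crit \<epsilon> (snd (fst q))" for q :: "(real \<times> real) \<times> complex"
  define G where "G b q = Hadamard_quotient f b (base q) (q - base q)" for b q
  have base: "smooth_on UNIV base"
    unfolding base_def crit_def by (intro smooth_intros open_UNIV)
  have G: "smooth_on UNIV (G b)" for b
    unfolding G_def by (intro smooth_on_Hadamard_quotient smooth_intros f open_UNIV base)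
  have base_deck: "base (deck n q) = deck n (base q)" for n q
    by (cases q) (auto simp: base_def deck_crit deck_apply)
  have G_deck: "G (deck_linear n b) (deck n q) = G b q" for n b q
  proof -
    have f': "(f has_derivative frechet_derivative f (at p)) (at p)" for p
      using smooth_on_has_derivative[OF f] by simp
    have "(\<lambda>p. f (deck n p)) = f" by (simp add: f_def fun_eq_iff)
    then have "(f has_derivative (\<lambda>d. frechet_derivative f (at (deck n p)) (deck_linear n d))) (at p)" for p
      using has_derivative_compose[OF deck_has_derivative f'] by metis
    then have D: "frechet_derivative f (at (deck n p)) (deck_linear n b) = frechet_derivative f (at p) b" for p
      using has_derivative_unique[OF _ f'] by metis
    have "deck n q = deck n (base q) + deck_linear n (q - base q)" by (simp flip: deck_add)
    then have "deck n q - deck n (base q) = deck_linear n (q - base q)" by simp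
    then show ?thesis
      by (simp add: G_def Hadamard_quotient_def base_deck D flip: deck_linear_scaleR deck_add)
  qed
  let ?r = "((1, 0), 0) :: (real \<times> real) \<times> complex"
  let ?x = "((0, 0), 1) :: (real \<times> real) \<times> complex"
  let ?y = "((0, 0), \<i>) :: (real \<times> real) \<times> complex"
  define c where "c q = cis (- (pi * snd (fst q)))" for q :: "(real \<times> real) \<times> complex"
  \<comment> \<open>Only the components transverse to the image line of the derivative matter; the
    component along cis (pi s) is corrected by dr at the end.\<close>
  define \<alpha> \<beta> \<gamma> where "\<alpha> q = Im (c q * G ?r q)" and "\<beta> q = Im (c q * G ?x q)"
    and "\<gamma> q = Im (c q * G ?y q)" for q
  have c: "smooth_on UNIV c" unfolding c_def by (intro smooth_intros open_UNIV)
  have sm: "smooth_on UNIV \<alpha>" "smooth_on UNIV \<beta>" "smooth_on UNIV \<gamma>"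
    unfolding \<alpha>_def \<beta>_def \<gamma>_def by (intro smooth_intros open_UNIV c G)+
  \<comment> \<open>Solves 2 Im (z \<eta>) = Re z \<beta> + Im z \<gamma>, the part of the equation
    to be met by dz.\<close>
  define \<eta> where "\<eta> q = Complex (\<gamma> q / 2) (\<beta> q / 2)" for q
  \<comment> \<open>The ds-component accounts for the Hadamard term along r and the dz-component for
    those along z. The dr-component then cancels the real parts which these two produce.\<close>
  define X where "X q = ((Re (c q * f q) + 4 * \<epsilon> * sin (3 * pi * snd (fst q)) * \<alpha> q - 2 * Re (snd q * \<eta> q),
    \<alpha> q / pi), cis (pi * snd (fst q)) * \<eta> q)" for q
  show thesis
  proof
    have \<eta>: "smooth_on UNIV \<eta>" unfolding \<eta>_def by (intro smooth_intros open_UNIV sm) simp_all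
    show "smooth_on UNIV X"
      unfolding X_def by (intro smooth_intros open_UNIV sm c f \<eta>) simp_all
  next
    fix q :: "(real \<times> real) \<times> complex"
    obtain r s z where q: "q = ((r, s), z)" by (metis prod.exhaust)
    define \<rho> where "\<rho> = r + 4 * \<epsilon> * cos (3 * pi * s)"
    have h: "q - base q = ((\<rho>, 0), z)" by (simp add: q base_def crit_def \<rho>_def)
    have "f q = f (base q) + (\<Sum>b\<in>Basis. ((q - base q) \<bullet> b) *\<^sub>R G b q)"
      using Hadamard[OF f, of "base q" "q - base q"] by (simp add: G_def)
    also have "(\<Sum>b\<in>Basis. ((q - base q) \<bullet> b) *\<^sub>R G b q) =
        of_real \<rho> * G ?r q + of_real (Re z) * G ?x q + of_real (Im z) * G ?y q"
    proof -
      have B: "(Basis :: ((real \<times> real) \<times> complex) set) = {?r, ((0, 1), 0), ?x, ?y}"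
        by (auto simp: Basis_prod_def Basis_complex_def zero_prod_def)
      show ?thesis unfolding h B by (simp add: scaleR_conv_of_real)
    qed
    finally have f_eq: "f q = f (base q) + (of_real \<rho> * G ?r q + of_real (Re z) * G ?x q + of_real (Im z) * G ?y q)" .
    have "c q * f q = c q * f (base q) + of_real \<rho> * (c q * G ?r q) + of_real (Re z) * (c q * G ?x q)
        + of_real (Im z) * (c q * G ?y q)"
      unfolding f_eq by (simp add: algebra_simps)
    moreover have "Im (c q * f (base q)) = 0"
      using vanish[of s] by (simp only: f_def base_def q c_def prod.sel)
    moreover have "Im (of_real a * v) = a * Im v" for a v by simp
    ultimately have "Im (c q * f q) = \<rho> * \<alpha> q + Re z * \<beta> q + Im z * \<gamma> q"
      unfolding \<alpha>_def \<beta>_def \<gamma>_def by (simp only: plus_complex.sel add_0_left)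
    moreover have "2 * Im (z * \<eta> q) = Re z * \<beta> q + Im z * \<gamma> q" by (simp add: \<eta>_def field_simps)
    ultimately have Im_f: "Im (c q * f q) = \<rho> * \<alpha> q + 2 * Im (z * \<eta> q)" by simp
    have cc: "cis (pi * s) * c q = 1" by (simp add: c_def q cis_mult)
    define v e where "v = c q * f q" and "e = z * \<eta> q"
    have "fst (fst (X q)) = Re v + 4 * \<epsilon> * sin (3 * pi * s) * \<alpha> q - 2 * Re e"
      unfolding X_def v_def e_def by (simp only: q prod.sel)
    moreover have "Im v = \<rho> * \<alpha> q + 2 * Im e" using Im_f by (simp only: v_def e_def)
    ultimately have "of_real (fst (fst (X q))) + \<i> * of_real (\<alpha> q) * (of_real r + 4 * of_real \<epsilon> * cis (3 * pi * s))
        + 2 * e = v"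
      by (intro complex_eqI) (simp_all add: \<rho>_def algebra_simps)
    then have "of_real (fst (fst (X q))) + \<i> * of_real (\<alpha> q) * (of_real r + 4 * of_real \<epsilon> * cis (3 * pi * s))
        + 2 * (z * \<eta> q) = c q * f q"
      by (simp only: v_def e_def)
    then have "cis (pi * s) * (of_real (fst (fst (X q))) + \<i> * of_real (\<alpha> q) * (of_real r + 4 * of_real \<epsilon> * cis (3 * pi * s))
        + 2 * (z * \<eta> q)) = f q"
      by (simp add: cc flip: mult.assoc)
    moreover have "X q = ((fst (fst (X q)), \<alpha> q / pi), cis (pi * s) * \<eta> q)" by (simp add: X_def q)
    then have "F_derivative \<epsilon> q (X q) = F_derivative \<epsilon> q ((fst (fst (X q)), \<alpha> q / pi), cis (pi * s) * \<eta> q)"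
      by (rule arg_cong)
    ultimately show "w (cover q) = F_derivative \<epsilon> q (X q)"
      by (simp add: F_derivative_def q f_def algebra_simps)
  next
    fix n and q :: "(real \<times> real) \<times> complex"
    obtain r s z where q: "q = ((r, s), z)" by (metis prod.exhaust)
    \<comment> \<open>The sign of the deck transformation. The factors c, \<beta>, \<gamma>, \<eta>,
      cis (pi s) and sin (3 pi s) change by k; products of two of them are invariant, as is
      \<alpha>. Thus dr changes by k while ds and dz do not change.\<close>
    define k :: real where "k = (-1) powi n"
    have k: "k * k = 1" unfolding k_def by (rule minus_one_powi_square)
    have dq: "deck n q = ((k * r, s + of_int n), z)" by (simp add: q deck_apply k_def)
    have k': "(-1) powi (- n) = k" by (simp add: k_def power_int_minus flip: power_int_inverse)
    have snd_z: "snd q = z" by (simp add: q)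
    have s': "snd (fst (deck n q)) = s + of_int n" "snd (deck n q) = z" "snd (fst q) = s"
      by (simp_all add: dq) (simp add: q)
    have c': "c (deck n q) = of_real k * c q"
      unfolding c_def s' cis_pi_add_int k' ..
    have cis': "cis (pi * (s + of_int n)) = of_real k * cis (pi * s)"
    proof -
      have "cis (pi * (s + of_int n)) = cnj (cis (- (pi * (s + of_int n))))" by (simp add: cis_cnj)
      also have "\<dots> = of_real k * cis (pi * s)" unfolding cis_pi_add_int k' by (simp add: cis_cnj)
      finally show ?thesis .
    qed
    have sin': "sin (3 * pi * (s + of_int n)) = k * sin (3 * pi * s)"
      using arg_cong[OF cis_3_pi_add_int[of s n], of Im] by (simp add: k_def del: of_real_power_int)
    have f': "f (deck n q) = f q" by (simp add: f_def)
    have dl: "deck_linear n ?r = k *\<^sub>R ?r" "deck_linear n ?x = ?x" "deck_linear n ?y = ?y"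
      by (simp_all add: deck_linear_def k_def)
    have lin: "G (a *\<^sub>R b) p = a *\<^sub>R G b p" for a b p
    proof -
      have "linear (frechet_derivative f (at p))" for p
        using smooth_on_has_derivative[OF f, of p] by (auto intro: has_derivative_linear)
      then show ?thesis by (simp add: G_def Hadamard_quotient_def linear_scale)
    qed
    have "k *\<^sub>R G ?r (deck n q) = G ?r q" using G_deck[of n ?r q] unfolding dl lin .
    then have "k *\<^sub>R (k *\<^sub>R G ?r (deck n q)) = k *\<^sub>R G ?r q" by simp
    then have Gr: "G ?r (deck n q) = of_real k * G ?r q"
      unfolding scaleR_scaleR k scaleR_one by (simp only: scaleR_conv_of_real)
    have Gx: "G ?x (deck n q) = G ?x q" "G ?y (deck n q) = G ?y q"
      using G_deck[of n ?x q] G_deck[of n ?y q] unfolding dl by simp_all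
    have im: "Im (of_real k * v) = k * Im v" "Re (of_real k * v) = k * Re v" for v by simp_all
    have "of_real k * c q * (of_real k * G ?r q) = of_real (k * k) * (c q * G ?r q)"
      by simp
    then have \<alpha>': "\<alpha> (deck n q) = \<alpha> q" unfolding \<alpha>_def c' Gr k by (simp only: of_real_1 mult_1_left)
    have \<beta>': "\<beta> (deck n q) = k * \<beta> q" "\<gamma> (deck n q) = k * \<gamma> q"
      unfolding \<beta>_def \<gamma>_def c' Gx by (simp_all only: mult.assoc im)
    have \<eta>': "\<eta> (deck n q) = of_real k * \<eta> q" by (rule complex_eqI) (simp_all add: \<eta>_def \<beta>')
    have "Re (c (deck n q) * f (deck n q)) = k * Re (c q * f q)" unfolding c' f' mult.assoc im ..
    moreover have "Re (z * (of_real k * \<eta> q)) = k * Re (z * \<eta> q)" by (simp add: algebra_simps)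
    moreover have "of_real k * cis (pi * s) * (of_real k * \<eta> q) = of_real (k * k) * (cis (pi * s) * \<eta> q)"
      by simp
    ultimately show "X (deck n q) = deck_linear n (X q)"
      unfolding X_def s' \<alpha>' \<eta>' sin' cis' k deck_linear_def k_def[symmetric] prod.case
      by (simp only: of_real_1 mult_1_left snd_z) (simp add: algebra_simps)
  qed
qed

text \<open>The target field is chosen first, so that w - Y \<circ> F has no transverse component on
  the critical circle; the remainder is then in the image of the derivative.\<close>

lemma infinitesimally_stable_F_map:
  assumes \<epsilon>: "\<epsilon> > 0"
  shows "infinitesimally_stable moebius_C_atlas (F_map \<epsilon>)"
  unfolding infinitesimally_stable_def
proof (intro conjI allI impI)
  show "smooth_map moebius_C_atlas (F_map \<epsilon>)"
    unfolding smooth_map_iff by (intro smooth_intros open_UNIV)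
  fix w :: "moebius \<times> complex \<Rightarrow> complex" assume "smooth_map moebius_C_atlas w"
  then have w: "smooth_on UNIV (\<lambda>q. w (cover q))" by (simp only: smooth_map_iff)
  have "smooth_on UNIV (\<lambda>s. w (cover (crit \<epsilon> s)))"
    by (rule smooth_on_compose[OF open_UNIV w smooth_on_crit]) simp_all
  then obtain Y where Y: "smooth_on UNIV Y"
    "\<And>s. Im (cis (- (pi * s)) * (Y (F_map \<epsilon> (cover (crit \<epsilon> s))) - w (cover (crit \<epsilon> s)))) = 0"
    by (rule target_extension[OF \<epsilon>]) (simp_all only: cover_crit_add_int)
  define v where "v p = w p - Y (F_map \<epsilon> p)" for p
  have YF: "smooth_on UNIV (\<lambda>q. Y (F_map \<epsilon> (cover q)))"
    by (rule smooth_on_compose[OF open_UNIV Y(1)]) (auto intro!: smooth_intros)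
  have "smooth_on UNIV (\<lambda>q. v (cover q))"
    unfolding v_def by (intro smooth_intros open_UNIV w YF)
  moreover have "Im (cis (- (pi * s)) * v (cover (crit \<epsilon> s))) = 0" for s
    using Y(2)[of s] by (simp add: v_def right_diff_distrib)
  ultimately obtain X where X: "smooth_on UNIV X" "\<And>q. v (cover q) = F_derivative \<epsilon> q (X q)"
    "\<And>n q. X (deck n q) = deck_linear n (X q)"
    using source_vector_field by metis
  \<comment> \<open>The components in a chart are the values of \<open>X\<close> at the lift given
    by that chart. Two lifts differ by a deck transformation, so equivariance of \<open>X\<close> is
    the transformation law.\<close>
  define Xf where "Xf c p = X (snd c p)" for c :: "(moebius \<times> complex, (real \<times> real) \<times> complex) chart" and p
  have "smooth_vector_field moebius_C_atlas Xf"
    unfolding smooth_vector_field_def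
  proof (intro conjI ballI case_prodI2)
    fix c U \<phi> assume c: "c \<in> moebius_C_atlas" "c = (U, \<phi>)"
    obtain S where S: "open S" "\<phi> ` U = S" "\<And>q. q \<in> S \<Longrightarrow> \<phi> (cover q) = q"
      "\<And>q. q \<in> S \<Longrightarrow> inv_into U \<phi> q = cover q"
      using moebius_C_chart[OF c(1)] unfolding c(2) fst_conv snd_conv by metis
    show "smooth_on (\<phi> ` U) (Xf (U, \<phi>) \<circ> inv_into U \<phi>)"
      unfolding S(2)
      by (rule smooth_on_cong[OF smooth_on_subset[OF X(1)] S(1)]) (simp_all add: Xf_def S(3,4))
  next
    fix c d V \<psi> p
    assume c: "c \<in> moebius_C_atlas" and d: "d \<in> moebius_C_atlas" "d = (V, \<psi>)" and p: "p \<in> fst c \<inter> V"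
    obtain S where S: "open S" "V = cover ` S" "\<And>q. q \<in> S \<Longrightarrow> \<psi> (cover q) = q"
      using moebius_C_chart[OF d(1)] unfolding d(2) fst_conv snd_conv by metis
    define q where "q = snd c p"
    have q: "cover q = p" unfolding q_def using differential_in_eq(2)[OF c] p by blast
    then have "cover q \<in> cover ` S" using p S(2) by blast
    then obtain n where n: "deck n q \<in> S" using deck_into by metis
    have "\<psi> p = deck n q" using S(3)[OF n] by (simp add: q)
    have "(deck n has_derivative deck_linear n) (at q)" by (rule deck_has_derivative)
    then have "((\<lambda>q. \<psi> (cover q)) has_derivative deck_linear n) (at q)"
    proof (rule has_derivative_transform_within_open[OF _ open_deck_vimage[OF S(1)]])
      show "q \<in> deck n -` S" using n by simp
      show "deck n x = \<psi> (cover x)" if "x \<in> deck n -` S" for x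
        using S(3)[of "deck n x"] that by simp
    qed
    then have "frechet_derivative (\<lambda>q. \<psi> (cover q)) (at q) = deck_linear n"
      by (rule frechet_derivative_at[symmetric])
    then have "differential_in c \<psi> p = deck_linear n"
      using differential_in_eq(1)[OF c, of p \<psi>] p by (simp add: q_def)
    then show "Xf (V, \<psi>) p = differential_in c \<psi> p (Xf c p)"
      using \<open>\<psi> p = deck n q\<close> by (simp add: Xf_def X(3) q_def)
  qed
  moreover have "w p = differential_in c (F_map \<epsilon>) p (Xf c p) + Y (F_map \<epsilon> p)"
    if c: "c \<in> moebius_C_atlas" "p \<in> fst c" for c p
  proof -
    have "differential_in c (F_map \<epsilon>) p (Xf c p) = F_derivative \<epsilon> (snd c p) (X (snd c p))"
      unfolding differential_in_eq(1)[OF c] frechet_derivative_F_map_cover Xf_def ..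
    also have "\<dots> = v p" unfolding X(2)[symmetric] differential_in_eq(2)[OF c] ..
    finally show ?thesis by (simp add: v_def)
  qed
  ultimately show "\<exists>X Y. smooth_vector_field moebius_C_atlas X \<and> smooth_on UNIV Y \<and>
      (\<forall>c\<in>moebius_C_atlas. \<forall>p\<in>fst c. w p = differential_in c (F_map \<epsilon>) p (X c p) + Y (F_map \<epsilon> p))"
    using Y(1) by blast
qed

theorem propositionA2:
  shows "\<forall>\<^sub>F \<epsilon> :: real in at_right 0.
    (let A = moebius_C_atlas; F = F_map \<epsilon>; C = critical_points A F in
      C homeomorphic sphere (0::complex) 1 \<and>
      (\<forall>p\<in>C. is_fold A F p \<or> is_cusp A F p) \<and>
      card {p\<in>C. is_cusp A F p} = 3 \<and>
      inj_on F C \<and>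
      infinitesimally_stable A F)"
proof (rule eventually_mono[OF eventually_at_right_less])
  fix \<epsilon> :: real assume \<epsilon>: "0 < \<epsilon>"
  then show "let A = moebius_C_atlas; F = F_map \<epsilon>; C = critical_points A F in
      C homeomorphic sphere (0::complex) 1 \<and>
      (\<forall>p\<in>C. is_fold A F p \<or> is_cusp A F p) \<and>
      card {p\<in>C. is_cusp A F p} = 3 \<and>
      inj_on F C \<and>
      infinitesimally_stable A F"
    unfolding Let_def critical_points_F_map cusps_eq[OF \<epsilon>]
    using crit_circle is_fold_or_cusp_crit card_cusps inj_on_F_map_crit infinitesimally_stable_F_map
    by blast
qed

end
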